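(* Let $N$ be a positive integer. There exists $(a,b,c)\in C_0^\infty(\mathbb{R}\times\mathbb{R})^3$, real-valued functions of $(t,r)$, such that (i) the supports of $a$, $b$ and $c$ are included in $[-1,1]\times[-1,1]$; (ii) $\{(t,r):\ r>0,\ b(t,r)\neq0\text{ and }c(t,r)\neq0\}\neq\emptyset$; (iii) $a(t,r)=a(t,-r)$, $b(t,r)=b(t,-r)$, $c(t,r)=c(t,-r)$ for all $(t,r)\in\mathbb{R}\times\mathbb{R}$; (iv) $a_t-a_{rr}-\frac{N-1}{r}a_r=b^3$ in $\mathbb{R}\times\mathbb{R}^*$; (v) $b_t-b_{rr}-\frac{N-1}{r}b_r=c^3$ in $\mathbb{R}\times\mathbb{R}^*$.
   Context: $C_0^\infty(\mathbb{R}\times\mathbb{R})$ denotes the space of real-valued $C^\infty$ functions with compact support, and $\mathbb{R}^*=\mathbb{R}\setminus\{0\}$. *)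

theory Defs
  imports "HOL-Analysis.Analysis"
begin

text \<open>\<open>C^k\<close> on the whole space: \<open>f\<close> is Frechet differentiable everywhere and all its
  directional derivatives are \<open>C^(k-1)\<close>. In finite dimension this is the usual notion.\<close>

primrec C_k :: "nat \<Rightarrow> ('a::euclidean_space \<Rightarrow> 'b::real_normed_vector) \<Rightarrow> bool" where
  "C_k 0 f \<longleftrightarrow> continuous_on UNIV f"
| "C_k (Suc k) f \<longleftrightarrow>
     (\<forall>x. f differentiable (at x)) \<and> (\<forall>v. C_k k (\<lambda>x. frechet_derivative f (at x) v))"

definition smooth :: "('a::euclidean_space \<Rightarrow> 'b::real_normed_vector) \<Rightarrow> bool" where
  "smooth f \<longleftrightarrow> (\<forall>k. C_k k f)"

definition supp :: "('a::topological_space \<Rightarrow> 'b::zero) \<Rightarrow> 'a set" where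
  "supp f = closure {x. f x \<noteq> 0}"

definition C0_infinity :: "(real \<times> real \<Rightarrow> real) set" where
  "C0_infinity = {f. smooth f \<and> compact (supp f)}"

text \<open>Partial derivatives in the first variable \<open>t\<close> and the second variable \<open>r\<close>. \<^const>\<open>deriv\<close> is
  meaningful here because these are only applied to smooth functions.\<close>

definition partial_t :: "(real \<times> real \<Rightarrow> real) \<Rightarrow> real \<times> real \<Rightarrow> real" where
  "partial_t f = (\<lambda>(t, r). deriv (\<lambda>s. f (s, r)) t)"

definition partial_r :: "(real \<times> real \<Rightarrow> real) \<Rightarrow> real \<times> real \<Rightarrow> real" where
  "partial_r f = (\<lambda>(t, r). deriv (\<lambda>s. f (t, s)) r)"

end

theory Submission
  imports Defs "HOL-Real_Asymp.Real_Asymp"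
begin

text \<open>
  Look for \<open>a = f(t) E(z) G(t, z)\<close> with \<open>z = (r - 1/2) / (e (1 - t^2))\<close>, where \<open>f\<close> and \<open>E\<close> are flat at
  \<open>t = \<plusminus>1\<close> and \<open>z = \<plusminus>1\<close>. After conjugation with the weights and multiplication by \<open>(e (1 - t^2))^2\<close>, the
  operator has coefficients that are smooth in \<open>(e, t, z)\<close> and reduces to \<open>- d^2/dz^2\<close> for \<open>e = 0\<close>.

  For \<open>e = 0\<close> the problem \<open>- G'' = B^3\<close>, \<open>- B'' = C^3\<close> is solved by prescribing \<open>B''\<close> as a cube with four
  simple roots; the moment condition for \<open>B^3\<close> is met by the intermediate value theorem. The signs are
  stable under perturbation except at the simple roots of \<open>B\<close> and \<open>C\<close>, where the perturbed right-hand
  sides must still vanish to third order. This is achieved by correcting finitely many Taylor coefficients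
  in \<open>z\<close> at these roots: first in \<open>B\<close>, so that its image is a cube up to a high power of the roots, then
  in \<open>G\<close>, so that its image is \<open>B^3\<close> up to a still higher power. By compactness the remaining factors
  keep their sign for small \<open>e > 0\<close>, so that their cube roots are smooth. Finally everything is reflected
  in \<open>r\<close>.
\<close>

text \<open>The obstacle is that both right-hand sides must change sign: compact support forces the
  integral of \<open>B^3\<close> to vanish when \<open>- G'' = B^3\<close>, and likewise that of
  \<open>C^3\<close>. A smooth cube root at a sign change needs a zero of order at least three, and
  a generic perturbation breaks a triple zero up. So triple zeros are enforced, and everything else
  rests on strict signs, which must then hold up to the boundary of the support. There the quotients
  by the weights could vanish for arbitrary profiles; hence the stationary \<open>a\<close> is made
  an exact multiple of its weight near \<open>z = +-1\<close>, and \<open>b\<close> and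
  \<open>c\<close> follow from it with nonzero quotients.

  The width \<open>e (1 - t^2)\<close> closes the support in time, and multiplying the operator by
  its square makes the time derivative a perturbation of the second derivative in \<open>z\<close>.
  The centre \<open>1/2\<close> keeps the support away from \<open>r = 0\<close>, where the first
  order coefficient is singular, and makes the copy reflected in \<open>r\<close> disjoint from the
  original, so that the cube of the sum is the sum of the cubes.\<close>

section \<open>Calculus of \<open>C^k\<close> functions\<close>

lemma C_k_SucI:
  assumes "\<And>x. (f has_derivative f' x) (at x)" "\<And>v. C_k k (\<lambda>x. f' x v)"
  shows "C_k (Suc k) f"
proof -
  have "frechet_derivative f (at x) = f' x" for x
    using frechet_derivative_at[OF assms(1)] by simp
  then show ?thesis
    using assms by (auto simp: differentiable_def)
qed

lemma C_k_SucD: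
  assumes "C_k (Suc k) f"
  shows "(f has_derivative frechet_derivative f (at x)) (at x)"
    "C_k k (\<lambda>x. frechet_derivative f (at x) v)"
  using assms by (auto simp: frechet_derivative_works)

lemma C_k_continuous: "C_k k f \<Longrightarrow> continuous_on UNIV f"
proof (cases k)
  case (Suc n)
  assume "C_k k f"
  then have "isCont f x" for x
    using Suc C_k_SucD(1) has_derivative_continuous by blast
  then show ?thesis
    by (simp add: continuous_at_imp_continuous_on)
qed simp

lemma C_k_Suc_imp: "C_k (Suc k) f \<Longrightarrow> C_k k f"
proof (induction k arbitrary: f)
  case 0
  then show ?case using C_k_continuous by fastforce
next
  case (Suc k)
  then show ?case by (metis C_k.simps(2))
qed

lemma C_k_const: "C_k k (\<lambda>x. c)"
proof (induction k arbitrary: c)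
  case (Suc k)
  show ?case by (rule C_k_SucI[where f' = "\<lambda>_ _. 0"]) (auto simp: Suc)
qed simp

lemma C_k_bounded_linear:
  assumes "bounded_linear f"
  shows "C_k k f"
proof (cases k)
  case 0
  then show ?thesis using assms by (simp add: linear_continuous_on)
next
  case (Suc n)
  have "C_k (Suc n) f"
    by (rule C_k_SucI[OF bounded_linear_imp_has_derivative[OF assms] C_k_const])
  then show ?thesis using Suc by simp
qed

lemma C_k_add: "C_k k f \<Longrightarrow> C_k k g \<Longrightarrow> C_k k (\<lambda>x. f x + g x)"
proof (induction k arbitrary: f g)
  case 0
  then show ?case by (auto intro: continuous_intros)
next
  case (Suc k)
  show ?case
    by (rule C_k_SucI[OF has_derivative_add[OF C_k_SucD(1)[OF Suc.prems(1)] C_k_SucD(1)[OF Suc.prems(2)]]])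
      (intro Suc.IH C_k_SucD(2)[OF Suc.prems(1)] C_k_SucD(2)[OF Suc.prems(2)])
qed

lemma C_k_bilinear:
  assumes "bounded_bilinear pr"
  shows "C_k k f \<Longrightarrow> C_k k g \<Longrightarrow> C_k k (\<lambda>x. pr (f x) (g x))"
proof (induction k arbitrary: f g)
  case 0
  then show ?case by (auto intro: bounded_bilinear.continuous_on[OF assms])
next
  case (Suc k)
  show ?case
    by (rule C_k_SucI[OF bounded_bilinear.FDERIV[OF assms C_k_SucD(1)[OF Suc.prems(1)] C_k_SucD(1)[OF Suc.prems(2)]]])
      (intro Suc.IH C_k_add C_k_SucD(2)[OF Suc.prems(1)] C_k_SucD(2)[OF Suc.prems(2)]
        C_k_Suc_imp[OF Suc.prems(1)] C_k_Suc_imp[OF Suc.prems(2)])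
qed

lemma C_k_bounded_linear_comp:
  assumes "bounded_linear L"
  shows "C_k k f \<Longrightarrow> C_k k (\<lambda>x. L (f x))"
proof (induction k arbitrary: f)
  case 0
  then show ?case by (auto intro: bounded_linear.continuous_on[OF assms])
next
  case (Suc k)
  show ?case
    by (rule C_k_SucI[OF bounded_linear.has_derivative[OF assms C_k_SucD(1)[OF Suc.prems]]])
      (intro Suc.IH C_k_SucD(2)[OF Suc.prems])
qed

lemma C_k_sum: "(\<And>i. i \<in> I \<Longrightarrow> C_k k (f i)) \<Longrightarrow> C_k k (\<lambda>x. \<Sum>i\<in>I. f i x)"
  by (induction I rule: infinite_finite_induct) (auto simp: C_k_const C_k_add)

text \<open>The direction \<open>g' x v\<close> in which \<open>f\<close> is differentiated varies
  with \<open>x\<close>. Expanding it in the basis gives a finite sum of \<open>C^k\<close>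
  coefficients times derivatives of \<open>f\<close> in fixed directions, to which the induction
  applies.\<close>

lemma C_k_compose:
  fixes f :: "'a::euclidean_space \<Rightarrow> 'c::real_normed_vector" and g :: "'b::euclidean_space \<Rightarrow> 'a"
  shows "C_k k f \<Longrightarrow> C_k k g \<Longrightarrow> C_k k (\<lambda>x. f (g x))"
proof (induction k arbitrary: f)
  case 0
  then show ?case
    by (auto intro: continuous_on_compose2[where t = UNIV])
next
  case (Suc k)
  let ?f' = "\<lambda>x. frechet_derivative f (at x)" and ?g' = "\<lambda>x. frechet_derivative g (at x)"
  have f': "(f has_derivative ?f' x) (at x)" for x by (rule C_k_SucD(1)[OF Suc.prems(1)])
  have g': "(g has_derivative ?g' x) (at x)" for x by (rule C_k_SucD(1)[OF Suc.prems(2)])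
  have *: "?f' (g x) (?g' x v) = (\<Sum>i\<in>Basis. (?g' x v \<bullet> i) *\<^sub>R ?f' (g x) i)" for x v
  proof -
    have lin: "linear (?f' (g x))"
      using f' has_derivative_linear by blast
    have "?f' (g x) (?g' x v) = ?f' (g x) (\<Sum>i\<in>Basis. (?g' x v \<bullet> i) *\<^sub>R i)"
      by (simp add: euclidean_representation)
    also have "\<dots> = (\<Sum>i\<in>Basis. (?g' x v \<bullet> i) *\<^sub>R ?f' (g x) i)"
      by (simp add: linear_sum[OF lin] linear_scale[OF lin])
    finally show ?thesis .
  qed
  show ?case
  proof (rule C_k_SucI[where f' = "\<lambda>x v. ?f' (g x) (?g' x v)"])
    show "((\<lambda>x. f (g x)) has_derivative (\<lambda>v. ?f' (g x) (?g' x v))) (at x)" for x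
      using has_derivative_compose[OF g' f'] .
    fix v
    have "C_k k (\<lambda>x. \<Sum>i\<in>Basis. (?g' x v \<bullet> i) *\<^sub>R ?f' (g x) i)"
    proof (rule C_k_sum, rule C_k_bilinear[OF bounded_bilinear_scaleR])
      fix i :: 'a
      show "C_k k (\<lambda>x. ?g' x v \<bullet> i)"
        by (rule C_k_bounded_linear_comp[OF bounded_linear_inner_left])
          (rule C_k_SucD(2)[OF Suc.prems(2)])
      show "C_k k (\<lambda>x. ?f' (g x) i)"
        by (rule Suc.IH[OF C_k_SucD(2)[OF Suc.prems(1)] C_k_Suc_imp[OF Suc.prems(2)]])
    qed
    then show "C_k k (\<lambda>x. ?f' (g x) (?g' x v))" by (simp add: *)
  qed
qed

lemma C_k_Pair: "C_k k f \<Longrightarrow> C_k k g \<Longrightarrow> C_k k (\<lambda>x. (f x, g x))"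
proof (induction k arbitrary: f g)
  case 0
  then show ?case by (auto intro: continuous_intros)
next
  case (Suc k)
  show ?case
    by (rule C_k_SucI[OF has_derivative_Pair[OF C_k_SucD(1)[OF Suc.prems(1)] C_k_SucD(1)[OF Suc.prems(2)]]])
      (intro Suc.IH C_k_SucD(2)[OF Suc.prems(1)] C_k_SucD(2)[OF Suc.prems(2)])
qed

section \<open>Smooth functions: closure properties and two criteria\<close>

lemma smooth_const: "smooth (\<lambda>x. c)"
  by (simp add: smooth_def C_k_const)

lemma smooth_bounded_linear: "bounded_linear f \<Longrightarrow> smooth f"
  by (simp add: smooth_def C_k_bounded_linear)

lemma smooth_id: "smooth (\<lambda>x. x)"
  by (simp add: smooth_bounded_linear bounded_linear_ident)

lemma smooth_add: "smooth f \<Longrightarrow> smooth g \<Longrightarrow> smooth (\<lambda>x. f x + g x)"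
  by (simp add: smooth_def C_k_add)

lemma smooth_mult:
  fixes f g :: "_ \<Rightarrow> 'a::real_normed_algebra"
  shows "smooth f \<Longrightarrow> smooth g \<Longrightarrow> smooth (\<lambda>x. f x * g x)"
  by (simp add: smooth_def C_k_bilinear[OF bounded_bilinear_mult])

lemma smooth_minus: "smooth f \<Longrightarrow> smooth (\<lambda>x. - f x)"
  by (simp add: smooth_def C_k_bounded_linear_comp[OF bounded_linear_minus[OF bounded_linear_ident]])

lemma smooth_diff: "smooth f \<Longrightarrow> smooth g \<Longrightarrow> smooth (\<lambda>x. f x - g x)"
  using smooth_add[OF _ smooth_minus] by force

lemma smooth_power:
  fixes f :: "_ \<Rightarrow> 'a::real_normed_algebra_1"
  shows "smooth f \<Longrightarrow> smooth (\<lambda>x. f x ^ n)"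
  by (induction n) (auto simp: smooth_const smooth_mult)

lemma smooth_prod:
  fixes f :: "_ \<Rightarrow> _ \<Rightarrow> real"
  shows "(\<And>i. i \<in> I \<Longrightarrow> smooth (f i)) \<Longrightarrow> smooth (\<lambda>x. \<Prod>i\<in>I. f i x)"
  by (induction I rule: infinite_finite_induct) (auto simp: smooth_const smooth_mult)

lemma smooth_compose:
  assumes "smooth f" "smooth g"
  shows "smooth (\<lambda>x. f (g x))"
  using assms by (simp add: smooth_def C_k_compose)

lemma smooth_Pair: "smooth f \<Longrightarrow> smooth g \<Longrightarrow> smooth (\<lambda>x. (f x, g x))"
  by (simp add: smooth_def C_k_Pair)

lemma smooth_fst: "smooth f \<Longrightarrow> smooth (\<lambda>x. fst (f x))"
  by (simp add: smooth_def C_k_bounded_linear_comp[OF bounded_linear_fst])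

lemma smooth_snd: "smooth f \<Longrightarrow> smooth (\<lambda>x. snd (f x))"
  by (simp add: smooth_def C_k_bounded_linear_comp[OF bounded_linear_snd])

lemmas smooth_intros = smooth_const smooth_id smooth_add smooth_mult smooth_minus smooth_diff
  smooth_power smooth_prod smooth_Pair smooth_fst smooth_snd

lemma smooth_has_derivative:
  "smooth f \<Longrightarrow> (f has_derivative frechet_derivative f (at x)) (at x)"
  unfolding smooth_def by (metis C_k_SucD(1))

lemma smooth_frechet_derivative: "smooth f \<Longrightarrow> smooth (\<lambda>x. frechet_derivative f (at x) v)"
  unfolding smooth_def by (metis C_k_SucD(2))

lemma smooth_continuous_on: "smooth f \<Longrightarrow> continuous_on S f"
  unfolding smooth_def using C_k_continuous continuous_on_subset by blast

text \<open>Induction on the order: closure of the family \<open>F\<close> under directional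
  derivatives replaces formulas for higher derivatives. Combinations of two members cover the
  product rule for \<open>flat\<close> and the two partial derivatives of
  \<open>tip\<close>.\<close>

lemma smoothI_class:
  assumes "f \<in> F"
    and "\<And>g. g \<in> F \<Longrightarrow> \<exists>g'. (\<forall>x. (g has_derivative g' x) (at x)) \<and>
           (\<forall>v. \<exists>c d p q. p \<in> F \<and> q \<in> F \<and> (\<lambda>x. g' x v) = (\<lambda>x. c *\<^sub>R p x + d *\<^sub>R q x))"
  shows "smooth f"
proof -
  have "g \<in> F \<Longrightarrow> C_k k g" for k g
  proof (induction k arbitrary: g)
    case 0
    then obtain g' where "\<forall>x. (g has_derivative g' x) (at x)" using assms(2) by blast
    then show ?case
      by (auto intro!: continuous_at_imp_continuous_on dest: has_derivative_continuous)
  next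
    case (Suc k)
    obtain g' where g': "\<forall>x. (g has_derivative g' x) (at x)"
      and v: "\<forall>v. \<exists>c d p q. p \<in> F \<and> q \<in> F \<and> (\<lambda>x. g' x v) = (\<lambda>x. c *\<^sub>R p x + d *\<^sub>R q x)"
      using assms(2)[OF Suc.prems] by blast
    show ?case
    proof (rule C_k_SucI)
      show "(g has_derivative g' x) (at x)" for x using g' by blast
      fix w
      obtain c d p q where "p \<in> F" "q \<in> F" and *: "(\<lambda>x. g' x w) = (\<lambda>x. c *\<^sub>R p x + d *\<^sub>R q x)"
        using v by metis
      then show "C_k k (\<lambda>x. g' x w)"
        unfolding * by (intro C_k_add C_k_bilinear[OF bounded_bilinear_scaleR] C_k_const Suc.IH)
    qed
  qed
  then show ?thesis using assms(1) by (simp add: smooth_def)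
qed

text \<open>\<open>D n\<close> stands for the \<open>n\<close>-th derivative of the outer function.
  It is required on \<open>S\<close> only, which covers functions such as \<open>powr\<close> on the
  positive axis.\<close>

lemma smooth_compose_seq:
  fixes D :: "nat \<Rightarrow> real \<Rightarrow> real"
  assumes D: "\<And>n x. x \<in> S \<Longrightarrow> (D n has_real_derivative D (Suc n) x) (at x)"
    and g: "smooth g" "\<And>x. g x \<in> S"
  shows "smooth (\<lambda>x. D 0 (g x))"
proof -
  have "C_k k (\<lambda>x. D n (g x))" for k n
  proof (induction k arbitrary: n)
    case 0
    have "isCont (D n) (g x)" for x using D g(2) DERIV_isCont by blast
    moreover have "isCont g x" for x
      using smooth_has_derivative[OF g(1)] has_derivative_continuous by blast
    ultimately have "isCont (\<lambda>x. D n (g x)) x" for x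
      by (metis isCont_o2)
    then show ?case by (simp add: continuous_at_imp_continuous_on)
  next
    case (Suc k)
    show ?case
    proof (rule C_k_SucI)
      show "((\<lambda>x. D n (g x)) has_derivative (\<lambda>v. D (Suc n) (g x) * frechet_derivative g (at x) v)) (at x)" for x
        using has_derivative_compose[OF smooth_has_derivative[OF g(1)]
            D[OF g(2), unfolded has_field_derivative_def]] .
      show "C_k k (\<lambda>x. D (Suc n) (g x) * frechet_derivative g (at x) v)" for v
        by (intro C_k_bilinear[OF bounded_bilinear_mult] Suc)
          (use smooth_frechet_derivative[OF g(1)] in \<open>auto simp: smooth_def\<close>)
    qed
  qed
  then show ?thesis by (simp add: smooth_def)
qed

lemma smooth_powr:
  fixes g :: "_ \<Rightarrow> real"
  assumes "smooth g" "\<And>x. g x > 0"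
  shows "smooth (\<lambda>x. g x powr a)"
proof -
  define D where "D n x = (\<Prod>i<n. a - real i) * x powr (a - real n)" for n x
  have "(D n has_real_derivative D (Suc n) x) (at x)" if "x \<in> {0<..}" for n x
    using that unfolding D_def by (auto intro!: derivative_eq_intros simp: algebra_simps)
  from smooth_compose_seq[of "{0<..}" D, OF this assms(1)] show ?thesis
    using assms(2) by (simp add: D_def)
qed

lemma smooth_inverse:
  fixes g :: "_ \<Rightarrow> real"
  assumes "smooth g" "\<And>x. g x > 0"
  shows "smooth (\<lambda>x. inverse (g x))"
  using smooth_powr[OF assms, of "-1"] assms(2) by (simp add: powr_minus less_imp_le)

lemma smooth_exp:
  fixes g :: "_ \<Rightarrow> real"
  assumes "smooth g"
  shows "smooth (\<lambda>x. exp (g x))"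
  using smooth_compose_seq[of UNIV "\<lambda>_. exp", OF DERIV_exp assms] by simp

subsection \<open>Flat functions\<close>

text \<open>The power factor makes the family closed under differentiation, which shifts
  \<open>m\<close>, and under products, which add both parameters; hence cube roots within the
  family just divide both by three.\<close>

definition flat :: "real \<Rightarrow> real \<Rightarrow> real \<Rightarrow> real" where
  "flat k m x = (if x > 0 then exp (- k / x) * x powr (- m) else 0)"

lemma flat_pos: "x > 0 \<Longrightarrow> flat k m x > 0"
  by (simp add: flat_def)

lemma flat_nonneg: "flat k m x \<ge> 0"
  by (simp add: flat_def)

lemma flat_nonpos: "x \<le> 0 \<Longrightarrow> flat k m x = 0"
  by (simp add: flat_def)

lemma flat_Suc: "flat k m x = x * flat k (m + 1) x"
  by (auto simp: flat_def powr_mult_base mult.left_commute)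

lemma flat_add: "flat k m x = x ^ n * flat k (m + real n) x"
proof (induction n)
  case (Suc n)
  show ?case using flat_Suc[of k "m + real n" x] Suc by (simp add: algebra_simps)
qed simp

lemma flat_mult: "flat k m x * flat k' m' x = flat (k + k') (m + m') x"
proof (cases "x > 0")
  case True
  have "exp (- k / x) * exp (- k' / x) = exp (- (k + k') / x)"
    by (simp add: exp_add[symmetric] add_divide_distrib diff_divide_distrib)
  moreover have "x powr (- m) * x powr (- m') = x powr (- (m + m'))"
    by (simp add: powr_add[symmetric])
  ultimately show ?thesis
    using True by (simp add: flat_def mult_ac)
qed (simp add: flat_nonpos)

lemma flat_tendsto_0:
  assumes "k > 0"
  shows "(flat k m \<longlongrightarrow> 0) (at 0)"
proof -
  have "((\<lambda>x. exp (- k / x) * x powr (- m)) \<longlongrightarrow> 0) (at_right 0)"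
    using assms by real_asymp
  then have "(flat k m \<longlongrightarrow> 0) (at_right 0)"
    by (rule Lim_transform_eventually) (rule eventually_at_rightI[of 0 1], auto simp: flat_def)
  moreover have "(flat k m \<longlongrightarrow> 0) (at_left 0)"
  proof (rule Lim_transform_eventually[OF tendsto_const])
    show "\<forall>\<^sub>F x in at_left 0. 0 = flat k m x"
      unfolding eventually_at_filter by (rule eventuallyI) (simp add: flat_def)
  qed
  ultimately show ?thesis by (simp add: filterlim_at_split)
qed

lemma DERIV_flat:
  assumes "k > 0"
  shows "(flat k m has_real_derivative k * flat k (m + 2) x - m * flat k (m + 1) x) (at x)"
proof -
  consider "x > 0" | "x = 0" | "x < 0" by linarith
  then show ?thesis
  proof cases
    case 1
    have p: "x powr (- m - 2) = x powr (- m) / x ^ 2" "x powr (- m - 1) = x powr (- m) / x"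
      using 1 by (simp_all add: powr_diff)
    have e: "- (m + 2) = - m - 2" "- (m + 1) = - m - 1" by simp_all
    have "((\<lambda>x. exp (- k / x) * x powr (- m)) has_real_derivative
        exp (- k / x) * (k / x ^ 2) * x powr (- m) + exp (- k / x) * (- m * x powr (- m - 1))) (at x)"
      using 1 by (auto intro!: derivative_eq_intros simp: power2_eq_square)
    also have "exp (- k / x) * (k / x ^ 2) * x powr (- m) + exp (- k / x) * (- m * x powr (- m - 1)) =
        k * flat k (m + 2) x - m * flat k (m + 1) x"
      unfolding flat_def e p using 1 by (simp add: mult_ac)
    finally have "((\<lambda>x. exp (- k / x) * x powr (- m)) has_real_derivative
        k * flat k (m + 2) x - m * flat k (m + 1) x) (at x)" .
    then show ?thesis
      by (rule has_field_derivative_transform_within_open[of _ _ _ "{0<..}"]) (use 1 in \<open>auto simp: flat_def\<close>)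
  next
    case 2
    \<comment> \<open>At the origin the difference quotient of \<open>flat k m\<close> is
      \<open>flat k (m + 1)\<close>, which tends to 0.\<close>
    have "((\<lambda>y. (flat k m y - flat k m 0) / (y - 0)) \<longlongrightarrow> 0) (at 0)"
      by (rule Lim_transform_eventually[OF flat_tendsto_0[OF assms, of "m + 1"]])
        (auto simp: flat_nonpos eventually_at_filter flat_Suc[of k m])
    then show ?thesis using 2 by (simp add: has_field_derivative_iff flat_nonpos)
  next
    case 3
    have "((\<lambda>x. 0) has_real_derivative k * flat k (m + 2) x - m * flat k (m + 1) x) (at x)"
      using 3 by (simp add: flat_nonpos)
    then show ?thesis
      by (rule has_field_derivative_transform_within_open[of _ _ _ "{..<0}"])
        (use 3 in \<open>auto simp: flat_nonpos\<close>)
  qed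
qed

lemma smooth_flat:
  assumes "k > 0"
  shows "smooth (flat k m)"
proof (rule smoothI_class[where F = "range (flat k)"])
  fix g assume "g \<in> range (flat k)"
  then obtain m where g: "g = flat k m" by blast
  show "\<exists>g'. (\<forall>x. (g has_derivative g' x) (at x)) \<and>
           (\<forall>v. \<exists>c d p q. p \<in> range (flat k) \<and> q \<in> range (flat k) \<and> (\<lambda>x. g' x v) = (\<lambda>x. c *\<^sub>R p x + d *\<^sub>R q x))"
  proof (intro exI conjI allI)
    show "(g has_derivative (\<lambda>v. (k * flat k (m + 2) x - m * flat k (m + 1) x) * v)) (at x)" for x
      using DERIV_flat[OF assms, of m x] by (simp add: g has_field_derivative_def)
    show "flat k (m + 2) \<in> range (flat k)" "flat k (m + 1) \<in> range (flat k)" by auto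
    show "(\<lambda>x. (k * flat k (m + 2) x - m * flat k (m + 1) x) * v)
        = (\<lambda>x. (k * v) *\<^sub>R flat k (m + 2) x + (- m * v) *\<^sub>R flat k (m + 1) x)" for v
      by (auto simp: algebra_simps)
  qed
qed auto

definition smooth_step :: "real \<Rightarrow> real" where
  "smooth_step x = flat 1 0 x / (flat 1 0 x + flat 1 0 (1 - x))"

lemma smooth_step_denom_pos: "flat 1 0 x + flat 1 0 (1 - x) > 0"
  using flat_pos[of x 1 0] flat_pos[of "1 - x" 1 0] flat_nonneg[of 1 0 x] flat_nonneg[of 1 0 "1 - x"]
  by (cases "x > 0") (auto intro: add_pos_nonneg add_nonneg_pos)

lemma smooth_smooth_step: "smooth smooth_step"
proof -
  have f: "smooth (flat 1 0)" by (simp add: smooth_flat)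
  have "smooth (\<lambda>x. flat 1 0 x * inverse (flat 1 0 x + flat 1 0 (1 - x)))"
    by (intro smooth_mult smooth_inverse smooth_add f smooth_compose[OF f] smooth_diff smooth_const
        smooth_id smooth_step_denom_pos)
  then show ?thesis
    unfolding smooth_step_def[abs_def] by (simp add: field_simps)
qed

lemma smooth_step_bounds: "0 \<le> smooth_step x" "smooth_step x \<le> 1"
  using smooth_step_denom_pos[of x] flat_nonneg[of 1 0 x] flat_nonneg[of 1 0 "1 - x"]
  by (auto simp: smooth_step_def divide_le_eq)

lemma smooth_step_pos: "x > 0 \<Longrightarrow> smooth_step x > 0"
  using smooth_step_denom_pos[of x] flat_pos[of x 1 0] by (simp add: smooth_step_def)

lemma smooth_step_0: "x \<le> 0 \<Longrightarrow> smooth_step x = 0"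
  by (simp add: smooth_step_def flat_nonpos)

lemma smooth_step_1: "x \<ge> 1 \<Longrightarrow> smooth_step x = 1"
  using flat_pos[of x 1 0] by (simp add: smooth_step_def flat_nonpos)

text \<open>For \<open>q > 0\<close> a positive smooth substitute for the identity, exact where
  \<open>x \<ge> q\<close>. Reciprocals and real powers composed with it are smooth everywhere,
  while they keep their values wherever the argument is at least \<open>q\<close>.\<close>

definition pos_ext :: "real \<Rightarrow> real \<Rightarrow> real" where
  "pos_ext q x = q + smooth_step (2 * x / q - 1) * (x - q)"

lemma smooth_pos_ext: "smooth f \<Longrightarrow> smooth (\<lambda>x. pos_ext q (f x))"
  unfolding pos_ext_def divide_inverse
  by (intro smooth_intros smooth_compose[OF smooth_smooth_step]) auto

lemma pos_ext_eq: "q > 0 \<Longrightarrow> x \<ge> q \<Longrightarrow> pos_ext q x = x"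
  using smooth_step_1[of "2 * x / q - 1"] by (simp add: pos_ext_def field_simps)

lemma pos_ext_pos:
  assumes "q > 0"
  shows "pos_ext q x > 0"
proof (cases "x > q / 2")
  case True
  show ?thesis
  proof (cases "x \<ge> q")
    case False
    have "smooth_step (2 * x / q - 1) * (q - x) \<le> 1 * (q - x)"
      by (rule mult_right_mono) (use False smooth_step_bounds in auto)
    then show ?thesis using True assms by (simp add: pos_ext_def algebra_simps)
  qed (use assms pos_ext_eq in auto)
next
  case False
  then have "smooth_step (2 * x / q - 1) = 0"
    using assms by (intro smooth_step_0) (simp add: field_simps)
  then show ?thesis using assms by (simp add: pos_ext_def)
qed

lemma powr_third_cube: "x > 0 \<Longrightarrow> (x powr (1/3)) ^ 3 = (x::real)"
  by (simp add: powr_powr flip: powr_realpow)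

subsection \<open>Hadamard quotients\<close>

text \<open>Differentiation under the integral sign: each directional derivative is again a
  parameter integral, of a function that is one order less regular, so the induction closes.\<close>

lemma C_k_integral:
  fixes f :: "'a::euclidean_space \<times> real \<Rightarrow> real"
  shows "C_k k f \<Longrightarrow> C_k k (\<lambda>x. integral {0..1} (\<lambda>s. f (x, s)))"
proof (induction k arbitrary: f)
  case 0
  then have "continuous_on (UNIV \<times> cbox 0 1) (\<lambda>(x, s). f (x, s))"
    by (auto intro: continuous_on_subset)
  then have "continuous_on UNIV (\<lambda>x. integral (cbox 0 1) (\<lambda>s. f (x, s)))"
    by (rule integral_continuous_on_param)
  then show ?case by simp
next
  case (Suc k)
  let ?f' = "\<lambda>x s v. frechet_derivative f (at (x, s)) (v, 0)"
  have f': "((\<lambda>x. f (x, s)) has_derivative ?f' x s) (at x)" for x s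
    by (rule has_derivative_compose[OF _ C_k_SucD(1)[OF Suc.prems], of "\<lambda>x. (x, s)"])
      (auto intro!: derivative_eq_intros)
  have bl: "bounded_linear (?f' x s)" for x s
    using f' by (rule has_derivative_bounded_linear)
  have cont: "continuous_on UNIV (\<lambda>y. ?f' (fst y) (snd y) v)" for v
    using C_k_continuous[OF C_k_SucD(2)[OF Suc.prems]] by simp
  \<comment> \<open>The derivative must be continuous as an operator-valued map; in finite dimension
    continuity in each basis direction is enough.\<close>
  have c: "continuous_on S (\<lambda>y. Blinfun (?f' (fst y) (snd y)))" for S
  proof (rule continuous_on_blinfun_componentwise)
    fix i :: 'a
    show "continuous_on S (\<lambda>y. blinfun_apply (Blinfun (?f' (fst y) (snd y))) i)"
      unfolding bounded_linear_Blinfun_apply[OF bl] using continuous_on_subset[OF cont] by simp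
  qed
  have fc: "continuous_on UNIV f" by (rule C_k_continuous[OF Suc.prems])
  have D: "((\<lambda>x. integral (cbox 0 1) (\<lambda>s. f (x, s))) has_derivative
      blinfun_apply (integral (cbox 0 1) (\<lambda>s. Blinfun (?f' x s)))) (at x within UNIV)" for x
  proof (rule leibniz_rule)
    show "((\<lambda>x. f (x, s)) has_derivative blinfun_apply (Blinfun (?f' x s))) (at x within UNIV)" for x s
      using f' by (simp add: bounded_linear_Blinfun_apply[OF bl])
    show "(\<lambda>s. f (x, s)) integrable_on cbox 0 1" for x
      by (rule integrable_continuous) (auto intro!: continuous_on_compose2[OF fc] continuous_intros)
    show "continuous_on (UNIV \<times> cbox 0 1) (\<lambda>(x, s). Blinfun (?f' x s))"
      using c by (simp add: split_beta)
  qed auto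
  have int: "(\<lambda>s. Blinfun (?f' x s)) integrable_on cbox 0 1" for x
  proof (rule integrable_continuous)
    have "continuous_on (cbox 0 1) (\<lambda>s. (x, s))" by (auto intro!: continuous_intros)
    from continuous_on_compose2[OF c[of UNIV] this]
    show "continuous_on (cbox 0 1) (\<lambda>s. Blinfun (?f' x s))" by simp
  qed
  have eq: "blinfun_apply (integral (cbox 0 1) (\<lambda>s. Blinfun (?f' x s))) v = integral {0..1} (\<lambda>s. ?f' x s v)" for x v
    using blinfun_apply_integral[OF int, of x v] by (simp add: bounded_linear_Blinfun_apply[OF bl])
  show ?case
  proof (rule C_k_SucI)
    show "((\<lambda>x. integral {0..1} (\<lambda>s. f (x, s))) has_derivative
      blinfun_apply (integral (cbox 0 1) (\<lambda>s. Blinfun (?f' x s)))) (at x)" for x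
      using D by simp
    show "C_k k (\<lambda>x. blinfun_apply (integral (cbox 0 1) (\<lambda>s. Blinfun (?f' x s))) v)" for v
      unfolding eq by (rule Suc.IH[OF C_k_SucD(2)[OF Suc.prems]])
  qed
qed

lemma smooth_integral:
  fixes f :: "'a::euclidean_space \<times> real \<Rightarrow> real"
  shows "smooth f \<Longrightarrow> smooth (\<lambda>x. integral {0..1} (\<lambda>s. f (x, s)))"
  by (simp add: smooth_def C_k_integral)

section \<open>Derivatives in the scaled coordinates \<open>(e, t, z)\<close> and division by roots
  in \<open>z\<close>\<close>

definition dz :: "(real \<times> real \<times> real \<Rightarrow> real) \<Rightarrow> real \<times> real \<times> real \<Rightarrow> real" where
  "dz F x = frechet_derivative F (at x) (0, 0, 1)"

definition dt :: "(real \<times> real \<times> real \<Rightarrow> real) \<Rightarrow> real \<times> real \<times> real \<Rightarrow> real" where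
  "dt F x = frechet_derivative F (at x) (0, 1, 0)"

lemma smooth_dz: "smooth F \<Longrightarrow> smooth (dz F)"
  and smooth_dt: "smooth F \<Longrightarrow> smooth (dt F)"
  unfolding dz_def[abs_def] dt_def[abs_def] by (rule smooth_frechet_derivative, assumption)+

lemma DERIV_dz:
  assumes "smooth F"
  shows "((\<lambda>z. F (e, t, z)) has_real_derivative dz F (e, t, z)) (at z)"
proof -
  have "((\<lambda>z. F (e, t, z)) has_derivative (\<lambda>v. frechet_derivative F (at (e, t, z)) (0, 0, v))) (at z)"
    by (rule has_derivative_compose[OF _ smooth_has_derivative[OF assms], of "\<lambda>z. (e, t, z)"])
      (auto intro!: derivative_eq_intros)
  moreover have "frechet_derivative F (at x) (0, 0, v) = dz F x * v" for x v
    using linear_scale[OF has_derivative_linear[OF smooth_has_derivative[OF assms]], of x v "(0, 0, 1)"]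
    by (simp add: dz_def)
  ultimately show ?thesis by (simp add: has_field_derivative_def)
qed

lemma DERIV_dt:
  assumes "smooth F"
  shows "((\<lambda>t. F (e, t, z)) has_real_derivative dt F (e, t, z)) (at t)"
proof -
  have "((\<lambda>t. F (e, t, z)) has_derivative (\<lambda>v. frechet_derivative F (at (e, t, z)) (0, v, 0))) (at t)"
    by (rule has_derivative_compose[OF _ smooth_has_derivative[OF assms], of "\<lambda>t. (e, t, z)"])
      (auto intro!: derivative_eq_intros)
  moreover have "frechet_derivative F (at x) (0, v, 0) = dt F x * v" for x v
    using linear_scale[OF has_derivative_linear[OF smooth_has_derivative[OF assms]], of x v "(0, 1, 0)"]
    by (simp add: dt_def)
  ultimately show ?thesis by (simp add: has_field_derivative_def)
qed

text \<open>\<open>R\<close> is the mean of \<open>dz F\<close> over the segment from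
  \<open>z0\<close> to \<open>z\<close>, by the fundamental theorem of calculus; as a parameter
  integral it is smooth across \<open>z = z0\<close>.\<close>

lemma hadamard:
  fixes F :: "real \<times> real \<times> real \<Rightarrow> real"
  assumes "smooth F" and F0: "\<And>e t. F (e, t, z0) = 0"
  obtains R where "smooth R" "\<And>e t z. F (e, t, z) = (z - z0) * R (e, t, z)"
proof
  let ?R = "\<lambda>x. integral {0..1} (\<lambda>s. dz F (fst x, fst (snd x), z0 + s * (snd (snd x) - z0)))"
  have "smooth (\<lambda>y :: (real \<times> real \<times> real) \<times> real.
      dz F (fst (fst y), fst (snd (fst y)), z0 + snd y * (snd (snd (fst y)) - z0)))"
    by (intro smooth_compose[OF smooth_dz[OF assms(1)]] smooth_intros)
  from smooth_integral[OF this] show "smooth ?R" by simp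
  fix e t z
  let ?g = "\<lambda>s. F (e, t, z0 + s * (z - z0))"
  have "(?g has_real_derivative dz F (e, t, z0 + s * (z - z0)) * (z - z0)) (at s)" for s
    by (rule DERIV_chain2[OF DERIV_dz[OF assms(1)]]) (auto intro!: derivative_eq_intros)
  then have "(?g has_vector_derivative dz F (e, t, z0 + s * (z - z0)) * (z - z0)) (at s within {0..1})" for s
    using has_real_derivative_iff_has_vector_derivative has_vector_derivative_at_within by blast
  then have "((\<lambda>s. dz F (e, t, z0 + s * (z - z0)) * (z - z0)) has_integral (?g 1 - ?g 0)) {0..1}"
    by (intro fundamental_theorem_of_calculus) auto
  then have "?g 1 - ?g 0 = integral {0..1} (\<lambda>s. dz F (e, t, z0 + s * (z - z0)) * (z - z0))"
    by (rule integral_unique[symmetric])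
  also have "\<dots> = (z - z0) * ?R (e, t, z)" by (simp add: mult.commute)
  finally show "F (e, t, z) = (z - z0) * ?R (e, t, z)" by (simp add: F0)
qed

text \<open>Roots are split off one at a time: the quotient by \<open>z - a\<close> still vanishes
  at the other roots, because \<open>z - a\<close> is nonzero there.\<close>

lemma hadamard_finite:
  fixes F :: "real \<times> real \<times> real \<Rightarrow> real"
  assumes "finite Z"
  shows "smooth F \<Longrightarrow> (\<And>e t z. z \<in> Z \<Longrightarrow> F (e, t, z) = 0) \<Longrightarrow>
    \<exists>R. smooth R \<and> (\<forall>e t z. F (e, t, z) = (\<Prod>i\<in>Z. z - i) * R (e, t, z))"
  using assms
proof (induction Z arbitrary: F rule: finite_induct)
  case (insert a Z)
  obtain R where R: "smooth R" "\<And>e t z. F (e, t, z) = (z - a) * R (e, t, z)"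
    using hadamard[of F a] insert.prems by blast
  have "R (e, t, z) = 0" if "z \<in> Z" for e t z
  proof -
    have "z \<noteq> a" using that insert.hyps(2) by blast
    then show ?thesis using R(2)[of e t z] insert.prems(2)[of z e t] that by auto
  qed
  then obtain R' where "smooth R'" "\<And>e t z. R (e, t, z) = (\<Prod>i\<in>Z. z - i) * R' (e, t, z)"
    using insert.IH[OF R(1)] by blast
  then show ?case using R(2) insert.hyps by (auto simp: mult.assoc)
qed auto

lemma dz_eqI:
  assumes "smooth F" "\<And>e t z. ((\<lambda>z. F (e, t, z)) has_real_derivative F' (e, t, z)) (at z)"
  shows "dz F = F'"
proof
  fix x show "dz F x = F' x"
    by (cases x) (metis DERIV_unique DERIV_dz[OF assms(1)] assms(2))
qed

lemma dt_eqI: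
  assumes "smooth F" "\<And>e t z. ((\<lambda>t. F (e, t, z)) has_real_derivative F' (e, t, z)) (at t)"
  shows "dt F = F'"
proof
  fix x show "dt F x = F' x"
    by (cases x) (metis DERIV_unique DERIV_dt[OF assms(1)] assms(2))
qed

lemma dz_add:
  assumes "smooth F" "smooth G"
  shows "dz (\<lambda>x. F x + G x) = (\<lambda>x. dz F x + dz G x)"
  by (rule dz_eqI) (auto intro!: smooth_add assms DERIV_add DERIV_dz)

lemma dt_add:
  assumes "smooth F" "smooth G"
  shows "dt (\<lambda>x. F x + G x) = (\<lambda>x. dt F x + dt G x)"
  by (rule dt_eqI) (auto intro!: smooth_add assms DERIV_add DERIV_dt)

lemma dz_mult:
  assumes "smooth F" "smooth G"
  shows "dz (\<lambda>x. F x * G x) = (\<lambda>x. dz F x * G x + F x * dz G x)"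
  by (rule dz_eqI) (auto intro!: smooth_mult assms derivative_eq_intros DERIV_dz)

lemma dt_mult:
  assumes "smooth F" "smooth G"
  shows "dt (\<lambda>x. F x * G x) = (\<lambda>x. dt F x * G x + F x * dt G x)"
  by (rule dt_eqI) (auto intro!: smooth_mult assms derivative_eq_intros DERIV_dt)

lemma dz_power:
  assumes "smooth F"
  shows "dz (\<lambda>x. F x ^ Suc n) = (\<lambda>x. real (Suc n) * F x ^ n * dz F x)"
proof (rule dz_eqI[OF smooth_power[OF assms]])
  show "((\<lambda>z. F (e, t, z) ^ Suc n) has_real_derivative real (Suc n) * F (e, t, z) ^ n * dz F (e, t, z)) (at z)" for e t z
    using DERIV_power_Suc[OF DERIV_dz[OF assms, of e t z], of n] by (simp add: mult_ac)
qed

section \<open>Second order operators in \<open>z\<close> and their action on powers\<close>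

definition zop where
  "zop A B C D u x = A x * dz (dz u) x + B x * dz u x + C x * u x + D x * dt u x"

lemma smooth_zop:
  assumes "smooth A" "smooth B" "smooth C" "smooth D" "smooth u"
  shows "smooth (zop A B C D u)"
  unfolding zop_def[abs_def] by (intro smooth_intros smooth_dz smooth_dt assms)

lemma zop_add:
  assumes "smooth u" "smooth v"
  shows "zop A B C D (\<lambda>x. u x + v x) x = zop A B C D u x + zop A B C D v x"
  by (simp add: zop_def dz_add assms smooth_dz dt_add algebra_simps)

text \<open>The order in \<open>P\<close> drops by two only when both \<open>z\<close>-derivatives
  fall on the power; this produces the factor \<open>(m + 2) (m + 1)\<close> and the square of
  \<open>dz P\<close>. All other terms keep a factor \<open>P^(m + 1)\<close> and are collected in
  \<open>T\<close>; the time derivative does not touch \<open>P\<close>.\<close>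

lemma zop_power_mult:
  assumes smooth: "smooth A" "smooth B" "smooth C" "smooth D" "smooth P" "smooth S"
    and P: "dt P = (\<lambda>_. 0)"
  shows "\<exists>T. smooth T \<and> (\<forall>x. zop A B C D (\<lambda>x. P x ^ (m + 2) * S x) x =
    P x ^ m * (real ((m + 2) * (m + 1)) * A x * dz P x ^ 2 * S x + P x * T x))"
proof (intro exI conjI allI)
  let ?n = "real (m + 2)"
  let ?T = "\<lambda>x. A x * (?n * dz (dz P) x * S x + 2 * ?n * dz P x * dz S x + P x * dz (dz S) x)
     + B x * (?n * dz P x * S x + P x * dz S x) + C x * P x * S x + D x * P x * dt S x"
  show "smooth ?T" by (intro smooth_intros smooth_dz smooth_dt smooth)
  fix x
  have d1: "dz (\<lambda>x. P x ^ (m + 2) * S x) = (\<lambda>x. ?n * P x ^ (m + 1) * dz P x * S x + P x ^ (m + 2) * dz S x)"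
    using dz_power[OF smooth(5), of "m + 1"] by (simp add: dz_mult smooth smooth_power del: power_Suc)
  have t1: "dt (\<lambda>x. P x ^ k) = (\<lambda>_. 0)" for k
  proof (rule dt_eqI[OF smooth_power[OF smooth(5)]])
    show "((\<lambda>t. P (e, t, z) ^ k) has_real_derivative 0) (at t)" for e t z
      using DERIV_power[OF DERIV_dt[OF smooth(5), of e z t], of k] by (simp add: P)
  qed
  have t: "dt (\<lambda>x. P x ^ (m + 2) * S x) = (\<lambda>x. P x ^ (m + 2) * dt S x)"
    using t1[of "m + 2"] by (simp add: dt_mult smooth smooth_power del: power_Suc)
  have d2: "dz (dz (\<lambda>x. P x ^ (m + 2) * S x)) = (\<lambda>x.
      ?n * ((real (m + 1) * P x ^ m * dz P x) * dz P x * S x + P x ^ (m + 1) * dz (dz P) x * S x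
        + P x ^ (m + 1) * dz P x * dz S x)
      + (?n * P x ^ (m + 1) * dz P x * dz S x + P x ^ (m + 2) * dz (dz S) x))"
    unfolding d1
  proof (rule dz_eqI)
    show "smooth (\<lambda>x. ?n * P x ^ (m + 1) * dz P x * S x + P x ^ (m + 2) * dz S x)"
      by (intro smooth_intros smooth_dz smooth)
    note D = DERIV_dz[OF smooth(5)] DERIV_dz[OF smooth(6)] DERIV_dz[OF smooth_dz[OF smooth(5)]]
      DERIV_dz[OF smooth_dz[OF smooth(6)]]
    show "((\<lambda>z. ?n * P (e, t, z) ^ (m + 1) * dz P (e, t, z) * S (e, t, z) + P (e, t, z) ^ (m + 2) * dz S (e, t, z)) has_real_derivative
      ?n * ((real (m + 1) * P (e, t, z) ^ m * dz P (e, t, z)) * dz P (e, t, z) * S (e, t, z)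
        + P (e, t, z) ^ (m + 1) * dz (dz P) (e, t, z) * S (e, t, z)
        + P (e, t, z) ^ (m + 1) * dz P (e, t, z) * dz S (e, t, z))
      + (?n * P (e, t, z) ^ (m + 1) * dz P (e, t, z) * dz S (e, t, z) + P (e, t, z) ^ (m + 2) * dz (dz S) (e, t, z))) (at z)" for e t z
      by (rule derivative_eq_intros D refl)+ (simp add: algebra_simps)
  qed
  show "zop A B C D (\<lambda>x. P x ^ (m + 2) * S x) x =
    P x ^ m * (real ((m + 2) * (m + 1)) * A x * dz P x ^ 2 * S x + P x * ?T x)"
    unfolding zop_def d2 unfolding d1 t by (simp add: power_add power2_eq_square algebra_simps)
qed

lemma closure_interval_minus_finite:
  assumes "finite Z"
  shows "closure ({-1<..<1} - Z) = {-1..1::real}"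
proof -
  have "closure ({-1<..<1} - Z) = closure {-1<..<1::real}"
  proof (rule antisym[OF closure_mono])
    have "x islimpt ({-1<..<1} - Z)" if "x \<in> {-1<..<1}" for x
    proof -
      have "x islimpt {-1<..<1}"
        using that interior_limit_point[of x "{-1<..<1}"] interior_open by (simp add: interior_open)
      then have "x islimpt (({-1<..<1} - Z) \<union> Z)"
        by (rule islimpt_subset) auto
      then show ?thesis
        using islimpt_finite[OF assms] unfolding islimpt_Un by blast
    qed
    then have "{-1<..<1} \<subseteq> closure ({-1<..<1} - Z)"
      by (auto simp: closure_def)
    then show "closure {-1<..<1} \<subseteq> closure ({-1<..<1} - Z)"
      by (rule closure_minimal) simp
  qed auto
  then show ?thesis by simp
qed

text \<open>Identities obtained by cancelling a root polynomial hold off its roots only; continuity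
  extends them to the roots and to the endpoints.\<close>

lemma vanish_dense:
  fixes f :: "real \<times> real \<times> real \<Rightarrow> real"
  assumes "finite Z" "smooth f" "\<And>z. \<bar>z\<bar> < 1 \<Longrightarrow> z \<notin> Z \<Longrightarrow> f (e, t, z) = 0" "\<bar>z\<bar> \<le> 1"
  shows "f (e, t, z) = 0"
proof (rule continuous_constant_on_closure[of "{-1<..<1} - Z" "\<lambda>z. f (e, t, z)"])
  show "continuous_on (closure ({-1<..<1} - Z)) (\<lambda>z. f (e, t, z))"
    by (rule smooth_continuous_on, rule smooth_compose[OF assms(2)]) (intro smooth_intros)
  show "z \<in> closure ({-1<..<1} - Z)"
    using assms by (auto simp: closure_interval_minus_finite abs_le_iff)
qed (use assms in \<open>auto simp: abs_less_iff\<close>)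

lemma dz_vanish:
  assumes "smooth w" "\<And>t z. \<bar>z\<bar> < 1 \<Longrightarrow> w (e, t, z) = 0" "\<bar>z\<bar> < 1"
  shows "dz w (e, t, z) = 0"
proof (rule DERIV_unique[OF DERIV_dz[OF assms(1)]])
  show "((\<lambda>z. w (e, t, z)) has_real_derivative 0) (at z)"
    by (rule has_field_derivative_transform_within_open[OF DERIV_const[of 0], of "{-1<..<1}"])
      (use assms in \<open>auto simp: abs_less_iff\<close>)
qed

lemma dt_vanish:
  assumes "smooth w" "\<And>t z. \<bar>z\<bar> < 1 \<Longrightarrow> w (e, t, z) = 0" "\<bar>z\<bar> < 1"
  shows "dt w (e, t, z) = 0"
  by (rule DERIV_unique[OF DERIV_dt[OF assms(1)]]) (simp add: assms)

text \<open>The operator contains no derivative in \<open>e\<close>, so vanishing on a single slice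
  of constant \<open>e\<close> is inherited by the image.\<close>

lemma zop_vanish:
  assumes "smooth w" "\<And>t z. \<bar>z\<bar> < 1 \<Longrightarrow> w (e, t, z) = 0" "\<bar>z\<bar> < 1"
  shows "zop A B C D w (e, t, z) = 0"
  using dz_vanish[OF assms(1,2)] dt_vanish[OF assms(1,2)] dz_vanish[OF smooth_dz[OF assms(1)], of e z t] assms(2,3)
  by (simp add: zop_def)

section \<open>Correction of Taylor coefficients at finitely many roots\<close>

definition rootpoly :: "real set \<Rightarrow> real \<times> real \<times> real \<Rightarrow> real" where
  "rootpoly Z x = (\<Prod>i\<in>Z. snd (snd x) - i)"

lemma smooth_rootpoly: "smooth (rootpoly Z)"
  unfolding rootpoly_def[abs_def] by (intro smooth_intros)

lemma dt_rootpoly: "dt (rootpoly Z) = (\<lambda>_. 0)"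
  by (rule dt_eqI[OF smooth_rootpoly]) (simp add: rootpoly_def)

lemma dz_rootpoly_nz:
  assumes "finite Z" "a \<in> Z"
  shows "dz (rootpoly Z) (e, t, a) \<noteq> 0"
proof -
  have "rootpoly Z (e, t, z) = (z - a) * rootpoly (Z - {a}) (e, t, z)" for z
    using assms by (simp add: rootpoly_def prod.remove)
  then have eq: "(\<lambda>z. rootpoly Z (e, t, z)) = (\<lambda>z. (z - a) * rootpoly (Z - {a}) (e, t, z))" by blast
  have "((\<lambda>z. rootpoly Z (e, t, z)) has_real_derivative rootpoly (Z - {a}) (e, t, a)) (at a)"
    unfolding eq by (auto intro!: derivative_eq_intros DERIV_dz[OF smooth_rootpoly])
  then have "dz (rootpoly Z) (e, t, a) = rootpoly (Z - {a}) (e, t, a)"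
    using DERIV_unique DERIV_dz[OF smooth_rootpoly] by blast
  then show ?thesis using assms by (simp add: rootpoly_def)
qed

lemma rootpoly_eq_0_iff: "finite Z \<Longrightarrow> rootpoly Z (e, t, z) = 0 \<longleftrightarrow> z \<in> Z"
  by (auto simp: rootpoly_def)

lemma finite_lower_bound:
  fixes g :: "'a \<Rightarrow> real"
  assumes "finite Z" "\<And>z. z \<in> Z \<Longrightarrow> g z > 0"
  shows "\<exists>q>0. \<forall>z\<in>Z. q \<le> g z"
  using assms
proof (induction Z rule: finite_induct)
  case empty
  show ?case by (intro exI[of _ 1]) auto
next
  case (insert a Z)
  then obtain q where "q > 0" "\<forall>z\<in>Z. q \<le> g z" by auto
  then show ?case using insert.prems by (intro exI[of _ "min q (g a)"]) auto
qed

text \<open>A formal Cauchy problem at finitely many points: each step cancels one more Taylor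
  coefficient of the residual at the zeros of \<open>P\<close>, with a correction that vanishes for \<open>e = 0\<close>.\<close>

lemma jet_correction:
  assumes smooth: "smooth A" "smooth B" "smooth C" "smooth D" "smooth u" "smooth F"
    and Z: "finite Z" "Z \<subseteq> {-1<..<1}"
    and A: "\<And>e t z. A (e, t, z) = A (0, 0, z)" "\<And>z. z \<in> Z \<Longrightarrow> A (0, 0, z) < 0"
    and eq0: "\<And>t z. \<bar>z\<bar> < 1 \<Longrightarrow> zop A B C D u (0, t, z) = F (0, t, z)"
  defines "P \<equiv> rootpoly Z"
  shows "\<exists>H R. smooth H \<and> smooth R \<and> (\<forall>t z. \<bar>z\<bar> \<le> 1 \<longrightarrow> H (0, t, z) = 0 \<and> R (0, t, z) = 0) \<and>
    (\<forall>x. zop A B C D (\<lambda>x. u x + P x ^ 2 * H x) x = F x + P x ^ m * R x)"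
proof (induction m)
  case 0
  have "smooth (\<lambda>x. zop A B C D u x - F x)"
    by (intro smooth_diff smooth_zop smooth)
  moreover have "zop A B C D u (0, t, z) - F (0, t, z) = 0" if "\<bar>z\<bar> \<le> 1" for t z
    by (rule vanish_dense[OF _ calculation _ that, of "{}"]) (auto simp: eq0)
  ultimately show ?case
    by (intro exI[of _ "\<lambda>_. 0"] exI[of _ "\<lambda>x. zop A B C D u x - F x"]) (auto simp: smooth_const)
next
  case (Suc m)
  have sP: "smooth P" and tP: "dt P = (\<lambda>_. 0)"
    by (simp_all add: P_def smooth_rootpoly dt_rootpoly)
  obtain H R where H: "smooth H" "smooth R" "\<And>t z. \<bar>z\<bar> \<le> 1 \<Longrightarrow> H (0, t, z) = 0"
      "\<And>t z. \<bar>z\<bar> \<le> 1 \<Longrightarrow> R (0, t, z) = 0"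
    and HR: "\<And>x. zop A B C D (\<lambda>x. u x + P x ^ 2 * H x) x = F x + P x ^ m * R x"
    using Suc.IH by blast
  define c where "c = real ((m + 2) * (m + 1))"
  have c: "c > 0" unfolding c_def of_nat_0_less_iff by simp
  \<comment> \<open>A correction \<open>P^(m + 2) S\<close> contributes \<open>- c g S\<close> to
    the coefficient of \<open>P^m\<close>. At the roots \<open>g\<close> is positive, since they are
    simple and \<open>A < 0\<close> there; it depends on \<open>z\<close> alone, so finitely many
    values give a common bound \<open>q\<close>.\<close>
  define g where "g x = - (A (0, 0, snd (snd x)) * dz P (0, 0, snd (snd x)) ^ 2)" for x :: "real \<times> real \<times> real"
  have sg: "smooth g"
    unfolding g_def[abs_def]
    by (intro smooth_intros smooth_compose[OF smooth(1)] smooth_compose[OF smooth_dz[OF sP]])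
  have dzP: "dz P (e, t, z) = dz P (0, 0, z)" for e t z
    by (rule DERIV_unique[OF DERIV_dz[OF sP]])
      (use DERIV_dz[OF sP, of 0 0 z] in \<open>simp add: P_def rootpoly_def\<close>)
  have "g (0, 0, z) > 0" if "z \<in> Z" for z
    using A(2)[OF that] dz_rootpoly_nz[OF Z(1) that, of 0 0] by (simp add: g_def P_def mult_less_0_iff)
  then obtain q where q: "q > 0" "\<And>z. z \<in> Z \<Longrightarrow> q \<le> g (0, 0, z)"
    using finite_lower_bound[OF Z(1), of "\<lambda>z. g (0, 0, z)"] by blast
  \<comment> \<open>This is the reciprocal of \<open>c g\<close> wherever \<open>g \<ge> q\<close>,
    in particular at the roots, which are the only places where its value counts.\<close>
  define V where "V x = inverse (c * pos_ext q (g x))" for x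
  have sV: "smooth V"
    unfolding V_def[abs_def]
    by (intro smooth_inverse smooth_intros smooth_pos_ext sg mult_pos_pos c pos_ext_pos q(1))
  define S where "S x = R x * V x" for x
  have sS: "smooth S" unfolding S_def[abs_def] by (intro smooth_mult H(2) sV)
  obtain T where T: "smooth T" "\<And>x. zop A B C D (\<lambda>x. P x ^ (m + 2) * S x) x =
    P x ^ m * (c * A x * dz P x ^ 2 * S x + P x * T x)"
    using zop_power_mult[OF smooth(1-4) sP sS tP, of m] unfolding c_def by blast
  have sG: "smooth (\<lambda>x. R x + c * A x * dz P x ^ 2 * S x)"
    by (intro smooth_intros smooth sS smooth_dz sP H(2))
  have "R (e, t, z) + c * A (e, t, z) * dz P (e, t, z) ^ 2 * S (e, t, z) = 0" if "z \<in> Z" for e t z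
  proof -
    have "g (e, t, z) = g (0, 0, z)" by (simp add: g_def)
    then have p: "pos_ext q (g (e, t, z)) = - (A (e, t, z) * dz P (e, t, z) ^ 2)" "pos_ext q (g (e, t, z)) > 0"
      using pos_ext_eq[OF q(1) q(2)[OF that]] pos_ext_pos[OF q(1), of "g (e, t, z)"]
      by (simp add: g_def A(1)[of e t] dzP[of e t], simp)
    have "A (e, t, z) * dz P (e, t, z) ^ 2 = - pos_ext q (g (e, t, z))" using p(1) by simp
    then have "c * A (e, t, z) * dz P (e, t, z) ^ 2 * S (e, t, z)
        = - (c * pos_ext q (g (e, t, z))) * inverse (c * pos_ext q (g (e, t, z))) * R (e, t, z)"
      by (simp add: S_def V_def mult.assoc)
    also have "\<dots> = - R (e, t, z)" using p(2) c by (simp add: field_simps)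
    finally show ?thesis by simp
  qed
  \<comment> \<open>The coefficient of \<open>P^m\<close> now vanishes at all roots, so that one
    more factor \<open>P\<close> splits off from the residual.\<close>
  from hadamard_finite[OF Z(1) sG this] obtain Q where Q1: "smooth Q"
    "\<And>e t z. R (e, t, z) + c * A (e, t, z) * dz P (e, t, z) ^ 2 * S (e, t, z) = (\<Prod>i\<in>Z. z - i) * Q (e, t, z)"
    by blast
  have "P (e, t, z) = (\<Prod>i\<in>Z. z - i)" for e t z by (simp add: P_def rootpoly_def)
  then have Q: "smooth Q" "\<And>x. R x + c * A x * dz P x ^ 2 * S x = P x * Q x"
    using Q1 by (auto simp: split_paired_all)
  let ?H = "\<lambda>x. H x + P x ^ m * S x" and ?R = "\<lambda>x. Q x + T x"
  have sH: "smooth ?H" by (intro smooth_intros H sP sS)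
  have sR: "smooth ?R" by (intro smooth_intros Q T)
  have split: "(\<lambda>x. u x + P x ^ 2 * ?H x) = (\<lambda>x. (u x + P x ^ 2 * H x) + P x ^ (m + 2) * S x)"
    by (auto simp: algebra_simps power_add power2_eq_square)
  have eq: "zop A B C D (\<lambda>x. u x + P x ^ 2 * ?H x) x = F x + P x ^ Suc m * ?R x" for x
  proof -
    have "zop A B C D (\<lambda>x. u x + P x ^ 2 * ?H x) x = (F x + P x ^ m * R x) + P x ^ m * (c * A x * dz P x ^ 2 * S x + P x * T x)"
      unfolding split HR[symmetric] T(2)[symmetric]
      by (rule zop_add) (intro smooth_intros smooth sP sS H)+
    also have "\<dots> = F x + P x ^ m * ((R x + c * A x * dz P x ^ 2 * S x) + P x * T x)"
      by (simp add: algebra_simps)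
    also have "\<dots> = F x + P x ^ Suc m * ?R x"
      unfolding Q(2) by (simp add: algebra_simps)
    finally show ?thesis .
  qed
  have H0: "?H (0, t, z) = 0" if "\<bar>z\<bar> \<le> 1" for t z
    using H(3,4)[OF that] by (simp add: S_def)
  \<comment> \<open>For \<open>e = 0\<close> the correction vanishes and the equation is already
    exact, so the new residual is zero; cancelling the power of \<open>P\<close> is possible off the
    roots, and density handles the rest.\<close>
  have "P (0, t, z) ^ Suc m * ?R (0, t, z) = 0" if "\<bar>z\<bar> < 1" for t z
  proof -
    have "zop A B C D (\<lambda>x. P x ^ 2 * ?H x) (0, t, z) = 0"
      by (rule zop_vanish[OF _ _ that]) (auto intro!: smooth_intros sP sH simp: H0)
    then show ?thesis
      using eq[of "(0, t, z)"] eq0[OF that, of t]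
      by (subst (asm) zop_add) (auto intro!: smooth_intros smooth sP sH)
  qed
  then have "?R (0, t, z) = 0" if "\<bar>z\<bar> < 1" "z \<notin> Z" for t z
    using that Z(1) rootpoly_eq_0_iff[OF Z(1), of 0 t z] unfolding P_def by fastforce
  then have R0: "?R (0, t, z) = 0" if "\<bar>z\<bar> \<le> 1" for t z
    using vanish_dense[OF Z(1) sR _ that] by blast
  show ?case
    by (intro exI[of _ ?H] exI[of _ ?R]) (use sH sR eq H0 R0 in blast)
qed

section \<open>Antiderivatives and sign patterns in one variable\<close>

lemma smooth_DERIV:
  fixes f :: "real \<Rightarrow> real"
  assumes "smooth f"
  shows "(f has_real_derivative deriv f x) (at x)"
proof -
  have "frechet_derivative f (at x) v = v * frechet_derivative f (at x) 1" for v
    using linear_scale[OF has_derivative_linear[OF smooth_has_derivative[OF assms]], of x v 1] by simp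
  then have "(f has_real_derivative frechet_derivative f (at x) 1) (at x)"
    using smooth_has_derivative[OF assms, of x]
    unfolding has_field_derivative_def by (metis (no_types, lifting) ext mult.commute)
  then show ?thesis by (simp add: DERIV_imp_deriv)
qed

lemma smooth_deriv:
  fixes f :: "real \<Rightarrow> real"
  assumes "smooth f"
  shows "smooth (deriv f)"
proof -
  have "deriv f = (\<lambda>x. frechet_derivative f (at x) 1)"
  proof
    fix x
    have "frechet_derivative f (at x) = (\<lambda>v. deriv f x * v)"
      using frechet_derivative_at smooth_DERIV[OF assms, of x] unfolding has_field_derivative_def by metis
    then show "deriv f x = frechet_derivative f (at x) 1" by simp
  qed
  then show ?thesis using smooth_frechet_derivative[OF assms] by metis
qed

lemma smooth_antiderivative:
  fixes f :: "real \<Rightarrow> real"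
  assumes "smooth f" "\<And>x. (F has_real_derivative f x) (at x)"
  shows "smooth F"
proof -
  have "C_k (Suc k) F" for k
  proof (rule C_k_SucI)
    show "(F has_derivative (\<lambda>v. f x * v)) (at x)" for x
      using assms(2) by (simp add: has_field_derivative_def)
    show "C_k k (\<lambda>x. f x * v)" for v
      using smooth_mult[OF assms(1) smooth_const[of v]] by (simp add: smooth_def)
  qed
  then show ?thesis
    unfolding smooth_def by (metis C_k_Suc_imp)
qed

lemma ex_antiderivative:
  fixes f :: "real \<Rightarrow> real"
  assumes "smooth f"
  shows "\<exists>F. F a = 0 \<and> smooth F \<and> (\<forall>x. (F has_real_derivative f x) (at x))"
proof -
  have "isCont f x" for x by (rule DERIV_isCont[OF smooth_DERIV[OF assms]])
  then obtain F where "\<And>x. (F has_vector_derivative f x) (at x)"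
    using einterval_antiderivative[of "-\<infinity>" \<infinity> f] by auto
  then have F: "((\<lambda>x. F x - F a) has_real_derivative f x) (at x)" for x
    by (auto intro!: derivative_eq_intros simp: has_real_derivative_iff_has_vector_derivative)
  then show ?thesis
    using smooth_antiderivative[OF assms F] by (intro exI[of _ "\<lambda>x. F x - F a"]) auto
qed

lemma DERIV_zero_eq:
  fixes F :: "real \<Rightarrow> real"
  assumes "\<And>x. x \<in> S \<Longrightarrow> (F has_real_derivative 0) (at x)" "convex S" "x \<in> S" "y \<in> S"
  shows "F x = F y"
proof -
  obtain c where "\<And>x. x \<in> S \<Longrightarrow> F x = c"
    using has_field_derivative_zero_constant[OF assms(2), of F] assms(1) has_field_derivative_at_within by blast
  then show ?thesis using assms(3,4) by simp
qed

lemma integral_eq_diff: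
  fixes F f :: "real \<Rightarrow> real"
  assumes "\<And>x. (F has_real_derivative f x) (at x)"
  shows "integral {0..1} f = F 1 - F 0"
  by (rule integral_unique, rule fundamental_theorem_of_calculus)
    (auto simp: assms has_field_derivative_at_within simp flip: has_real_derivative_iff_has_vector_derivative)

text \<open>The antiderivative \<open>F'\<close> normalised at 0 is odd, and the vanishing integral
  makes it zero beyond 1, hence also beyond -1. Then \<open>F\<close> is even, so the normalisation
  \<open>F 1 = 0\<close> makes it vanish on both sides.\<close>

lemma second_antiderivative:
  fixes f :: "real \<Rightarrow> real"
  assumes "smooth f" "\<And>x. f (- x) = f x" "\<And>x. \<bar>x\<bar> \<ge> 1 \<Longrightarrow> f x = 0" "integral {0..1} f = 0"
  obtains F F' where "smooth F" "smooth F'" "\<And>x. F (- x) = F x" "\<And>x. \<bar>x\<bar> \<ge> 1 \<Longrightarrow> F x = 0"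
    "\<And>x. (F has_real_derivative F' x) (at x)" "\<And>x. (F' has_real_derivative f x) (at x)"
    "F' 0 = 0" "F' 1 = 0"
proof -
  obtain F' where F': "F' 0 = 0" "smooth F'" "\<And>x. (F' has_real_derivative f x) (at x)"
    using ex_antiderivative[OF assms(1)] by blast
  obtain F where F: "F 1 = 0" "smooth F" "\<And>x. (F has_real_derivative F' x) (at x)"
    using ex_antiderivative[OF F'(2)] by blast
  have odd: "F' (- x) = - F' x" for x
  proof -
    have "((\<lambda>x. F' x + F' (- x)) has_real_derivative 0) (at x)" for x
      using DERIV_add[OF F'(3) DERIV_mirror[THEN iffD1, OF F'(3)], of x] assms(2)[of x] by simp
    then have "F' x + F' (- x) = F' 0 + F' (- 0)"
      by (intro DERIV_zero_eq[of UNIV "\<lambda>x. F' x + F' (- x)"]) auto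
    then show ?thesis using F'(1) by simp
  qed
  have even: "F (- x) = F x" for x
  proof -
    have "((\<lambda>x. F x - F (- x)) has_real_derivative 0) (at x)" for x
      using DERIV_diff[OF F(3) DERIV_mirror[THEN iffD1, OF F(3)], of x] odd[of x] by simp
    then have "F x - F (- x) = F 0 - F (- 0)"
      by (intro DERIV_zero_eq[of UNIV "\<lambda>x. F x - F (- x)"]) auto
    then show ?thesis by simp
  qed
  have F'1: "F' 1 = 0"
    using integral_eq_diff[of F' f] F' assms(4) by simp
  have F'ge: "F' x = 0" if "x \<ge> 1" for x
  proof -
    have "(F' has_real_derivative 0) (at y)" if "y \<in> {1..}" for y
      using F'(3)[of y] assms(3)[of y] that by simp
    then have "F' x = F' 1" by (intro DERIV_zero_eq[where S = "{1..}"]) (use that in auto)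
    then show ?thesis using F'1 by simp
  qed
  have Fge: "F x = 0" if "x \<ge> 1" for x
  proof -
    have "(F has_real_derivative 0) (at y)" if "y \<in> {1..}" for y
      using F(3)[of y] F'ge[of y] that by simp
    then have "F x = F 1" by (intro DERIV_zero_eq[where S = "{1..}"]) (use that in auto)
    then show ?thesis using F(1) by simp
  qed
  have "F x = 0" if "\<bar>x\<bar> \<ge> 1" for x
    using Fge[of x] Fge[of "- x"] even[of x] that by (cases "x \<ge> 0") auto
  then show ?thesis by (rule that[OF F(2) F'(2) even _ F(3) F'(3) F'(1) F'1])
qed

lemma integral_pos:
  fixes f :: "real \<Rightarrow> real"
  assumes "continuous_on UNIV f" "\<And>x. x \<in> {0..1} \<Longrightarrow> f x \<ge> 0" "x0 \<in> {0..1}" "f x0 > 0"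
  shows "integral {0..1} f > 0"
proof -
  have c: "continuous_on {0..1} f" using assms(1) continuous_on_subset by blast
  have "integral {0..1} f \<ge> 0" using assms(2) by (intro integral_nonneg integrable_continuous_real c) auto
  moreover have "integral {0..1} f \<noteq> 0"
    using integral_eq_0_iff[OF c] assms by force
  ultimately show ?thesis by linarith
qed

text \<open>\<open>F'\<close> rises from 0 up to \<open>c\<close> and then falls back to 0, so it is
  nonnegative, and \<open>F\<close> increases towards \<open>F 1 = 0\<close>.\<close>

lemma shape_nonpos:
  fixes F F' f :: "real \<Rightarrow> real"
  assumes D: "\<And>x. (F has_real_derivative F' x) (at x)" "\<And>x. (F' has_real_derivative f x) (at x)"
    and z: "F' 0 = 0" "F' 1 = 0" "F 1 = 0" and c: "0 \<le> c" "c \<le> 1"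
    and s: "\<And>x. 0 \<le> x \<Longrightarrow> x \<le> c \<Longrightarrow> f x \<ge> 0" "\<And>x. c \<le> x \<Longrightarrow> x \<le> 1 \<Longrightarrow> f x \<le> 0"
    and x: "0 \<le> x" "x \<le> 1"
  shows "F x \<le> 0"
proof -
  have "F' y \<ge> 0" if "0 \<le> y" "y \<le> 1" for y
  proof (cases "y \<le> c")
    case True
    have "F' 0 \<le> F' y"
      by (rule DERIV_nonneg_imp_nondecreasing[OF that(1)]) (use D(2) s(1) True in force)
    then show ?thesis using z by simp
  next
    case False
    have "F' y \<ge> F' 1"
      by (rule DERIV_nonpos_imp_nonincreasing[OF that(2)]) (use D(2) s(2) False in force)
    then show ?thesis using z by simp
  qed
  then have "F x \<le> F 1"
    by (intro DERIV_nonneg_imp_nondecreasing[OF x(2)]) (use D(1) x in force)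
  then show ?thesis using z by simp
qed

text \<open>Strictness: if \<open>F\<close> were zero on the open interval, so would be its second
  derivative \<open>f\<close>, against \<open>f x0 \<noteq> 0\<close>.\<close>

lemma shape_cube_integral_neg:
  fixes F F' f :: "real \<Rightarrow> real"
  assumes D: "\<And>x. (F has_real_derivative F' x) (at x)" "\<And>x. (F' has_real_derivative f x) (at x)"
    and z: "F' 0 = 0" "F' 1 = 0" "F 1 = 0" and c: "0 \<le> c" "c \<le> 1"
    and s: "\<And>x. 0 \<le> x \<Longrightarrow> x \<le> c \<Longrightarrow> f x \<ge> 0" "\<And>x. c \<le> x \<Longrightarrow> x \<le> 1 \<Longrightarrow> f x \<le> 0"
    and x0: "0 < x0" "x0 < 1" "f x0 \<noteq> 0"
  shows "integral {0..1} (\<lambda>x. F x ^ 3) < 0"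
proof -
  note np = shape_nonpos[OF D z c s]
  have cont: "continuous_on UNIV F"
    by (rule continuous_at_imp_continuous_on) (use D(1) DERIV_isCont in fast)
  have "\<exists>x\<in>{0..1}. F x \<noteq> 0"
  proof (rule ccontr)
    assume "\<not> ?thesis"
    then have F0: "F x = 0" if "x \<in> {0<..<1}" for x using that by auto
    have d: "(H has_real_derivative 0) (at x)" if "\<And>y. y \<in> {0<..<1} \<Longrightarrow> H y = 0" "x \<in> {0<..<1}" for H :: "real \<Rightarrow> real" and x
      by (rule has_field_derivative_transform_within_open[OF DERIV_const[of 0], of "{0<..<1}"]) (use that in auto)
    have "F' x = 0" if "x \<in> {0<..<1}" for x using DERIV_unique[OF D(1) d[OF F0 that]] by simp
    from DERIV_unique[OF D(2) d[OF this]] show False using x0 by auto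
  qed
  then obtain y where y: "y \<in> {0..1}" "F y \<noteq> 0" by blast
  have "integral {0..1} (\<lambda>x. - (F x ^ 3)) > 0"
  proof (rule integral_pos[OF _ _ y(1)])
    show "continuous_on UNIV (\<lambda>x. - (F x ^ 3))" by (intro continuous_intros cont)
    show "- (F x ^ 3) \<ge> 0" if "x \<in> {0..1}" for x
      using np that by (simp add: power_less_zero_eq_numeral power3_eq_cube mult_nonpos_nonpos mult_nonneg_nonpos)
    show "- (F y ^ 3) > 0"
      using np[of y] y by (simp add: power_less_zero_eq_numeral)
  qed
  then show ?thesis by simp
qed

subsection \<open>The weighted second derivative\<close>

definition om :: "real \<Rightarrow> real" where "om z = 1 - z ^ 2"

definition wt :: "real \<Rightarrow> real \<Rightarrow> real \<Rightarrow> real" where "wt k m z = flat k m (om z)"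

text \<open>Zeroth order coefficient of one conjugated derivative: the derivative of
  \<open>wt k m * U\<close> is \<open>wt k (m + 2) * (om^2 * U' + c1 k m * U)\<close>.\<close>

definition c1 :: "real \<Rightarrow> real \<Rightarrow> real \<Rightarrow> real" where
  "c1 k m z = 2 * m * z * om z - 2 * k * z"

definition cB :: "real \<Rightarrow> real \<Rightarrow> real \<Rightarrow> real" where
  "cB k m z = om z ^ 2 * (c1 k m z + c1 k (m + 2) z - 4 * z * om z)"

definition cC :: "real \<Rightarrow> real \<Rightarrow> real \<Rightarrow> real" where
  "cC k m z = om z ^ 2 * (2 * m * om z - 4 * m * z ^ 2 - 2 * k) + c1 k (m + 2) z * c1 k m z"

text \<open>Conjugated second derivative: \<open>wt k m * U\<close> has second derivative
  \<open>wt k (m + 4) * H2 k m U\<close>. It degenerates at \<open>z = +-1\<close>, where only the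
  term with \<open>cC\<close>, equal to \<open>4 k^2\<close>, survives.\<close>

definition H2 :: "real \<Rightarrow> real \<Rightarrow> (real \<Rightarrow> real) \<Rightarrow> real \<Rightarrow> real" where
  "H2 k m U z = om z ^ 4 * deriv (deriv U) z + cB k m z * deriv U z + cC k m z * U z"

lemma smooth_om: "smooth om"
  unfolding om_def[abs_def] by (intro smooth_intros)

lemma smooth_wt: "k > 0 \<Longrightarrow> smooth (wt k m)"
  unfolding wt_def[abs_def] by (rule smooth_compose[OF smooth_flat smooth_om])

lemma smooth_coeffs: "smooth (c1 k m)" "smooth (cB k m)" "smooth (cC k m)"
  unfolding c1_def[abs_def] cB_def[abs_def] cC_def[abs_def]
  by (intro smooth_intros smooth_om)+

lemma smooth_H2: "smooth U \<Longrightarrow> smooth (H2 k m U)"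
  unfolding H2_def[abs_def] by (intro smooth_intros smooth_om smooth_coeffs smooth_deriv)

lemma om_pos_iff: "om z > 0 \<longleftrightarrow> \<bar>z\<bar> < 1"
  by (simp add: om_def abs_square_less_1)

lemma wt_pos: "\<bar>z\<bar> < 1 \<Longrightarrow> wt k m z > 0"
  by (simp add: wt_def flat_pos om_pos_iff)

lemma wt_nonneg: "wt k m z \<ge> 0"
  by (simp add: wt_def flat_nonneg)

lemma wt_zero: "\<bar>z\<bar> \<ge> 1 \<Longrightarrow> wt k m z = 0"
  using om_pos_iff[of z] by (simp add: wt_def flat_nonpos)

lemma wt_power:
  assumes "\<bar>z\<bar> < 1"
  shows "wt k m z ^ n = wt (real n * k) (real n * m) z"
proof -
  have "om z > 0" using assms om_pos_iff by blast
  then show ?thesis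
    by (simp add: wt_def flat_def power_mult_distrib powr_power flip: exp_of_nat_mult)
qed

lemma DERIV_wt:
  assumes "k > 0" "(U has_real_derivative U') (at z)"
  shows "((\<lambda>z. wt k m z * U z) has_real_derivative
    wt k (m + 2) z * (om z ^ 2 * U' + c1 k m z * U z)) (at z)"
proof -
  have "((\<lambda>z. wt k m z * U z) has_real_derivative
     (k * flat k (m + 2) (om z) - m * flat k (m + 1) (om z)) * (- 2 * z) * U z + wt k m z * U') (at z)"
    unfolding wt_def[abs_def]
    by (rule DERIV_cong[OF DERIV_mult[OF DERIV_chain2[OF DERIV_flat[OF assms(1)]] assms(2)]])
      (auto intro!: derivative_eq_intros simp: om_def[abs_def])
  moreover have "flat k (m + 1) (om z) = om z * wt k (m + 2) z" "wt k m z = om z ^ 2 * wt k (m + 2) z"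
    using flat_Suc[of k "m + 1" "om z"] flat_add[of k m "om z" 2] by (simp_all add: wt_def add.assoc)
  ultimately show ?thesis by (simp add: wt_def c1_def algebra_simps)
qed

lemma DERIV_wt_2:
  assumes "k > 0" "smooth U"
  shows "((\<lambda>z. wt k (m + 2) z * (om z ^ 2 * deriv U z + c1 k m z * U z)) has_real_derivative
    wt k (m + 4) z * H2 k m U z) (at z)"
proof -
  have "((\<lambda>z. om z ^ 2 * deriv U z + c1 k m z * U z) has_real_derivative
     2 * om z * (- 2 * z) * deriv U z + om z ^ 2 * deriv (deriv U) z
     + (2 * m * om z - 4 * m * z ^ 2 - 2 * k) * U z + c1 k m z * deriv U z) (at z)"
    unfolding om_def c1_def
    by (auto intro!: derivative_eq_intros smooth_DERIV smooth_deriv assms simp: power2_eq_square algebra_simps)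
  from DERIV_wt[OF assms(1) this, of "m + 2"] show ?thesis
    by (rule DERIV_cong) (simp add: H2_def cB_def cC_def algebra_simps power2_eq_square power4_eq_xxxx)
qed

section \<open>Prescribed second derivatives and their moments\<close>

definition bump :: "real \<Rightarrow> real \<Rightarrow> real \<Rightarrow> real" where
  "bump a b z = flat 1 0 (z ^ 2 - a) * flat 1 0 (b - z ^ 2)"

lemma smooth_bump: "smooth (bump a b)"
  unfolding bump_def[abs_def] by (intro smooth_intros smooth_compose[OF smooth_flat]) auto

lemma bump_nonneg: "bump a b z \<ge> 0"
  by (simp add: bump_def flat_nonneg)

lemma bump_pos: "a < z ^ 2 \<Longrightarrow> z ^ 2 < b \<Longrightarrow> bump a b z > 0"
  by (simp add: bump_def flat_pos)

lemma bump_zero: "z ^ 2 \<le> a \<or> b \<le> z ^ 2 \<Longrightarrow> bump a b z = 0"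
  by (auto simp: bump_def flat_nonpos)

lemma bump_minus: "bump a b (- z) = bump a b z"
  by (simp add: bump_def)

text \<open>Two sign changes on \<open>(0, 1)\<close> are chosen because a second derivative with
  only one would give \<open>B\<close> a constant sign, as in \<open>shape_nonpos\<close>, and then
  the moment of \<open>B^3\<close> could not vanish.\<close>

definition p2 :: "real \<Rightarrow> real" where "p2 z = (z ^ 2 - 1/4) * (z ^ 2 - 1/16)"

lemma smooth_p2: "smooth p2"
  unfolding p2_def[abs_def] by (intro smooth_intros)

text \<open>The second derivative of the profile \<open>b\<close> is prescribed as \<open>rhs g\<close> with a positive \<open>g\<close>,
  so that it is a cube with simple roots \<open>\<plusminus>1/2\<close>, \<open>\<plusminus>1/4\<close>.\<close>

definition rhs :: "(real \<Rightarrow> real) \<Rightarrow> real \<Rightarrow> real" where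
  "rhs g z = - (wt (1/3) (16/3) z * p2 z ^ 3 * g z)"

lemma smooth_rhs: "smooth g \<Longrightarrow> smooth (rhs g)"
  unfolding rhs_def[abs_def] by (intro smooth_intros smooth_wt smooth_p2) auto

lemma rhs_integrable: "smooth g \<Longrightarrow> rhs g integrable_on {0..1}"
  by (intro integrable_continuous_real smooth_continuous_on smooth_rhs)

lemma rhs_zero: "\<bar>z\<bar> \<ge> 1 \<Longrightarrow> rhs g z = 0"
  by (simp add: rhs_def wt_zero)

lemma om_minus: "om (- z) = om z" by (simp add: om_def)

lemma rhs_minus: "g (- z) = g z \<Longrightarrow> rhs g (- z) = rhs g z"
  by (simp add: rhs_def wt_def om_minus p2_def)

lemma rhs_lincomb: "rhs (\<lambda>z. g z + m * h z) z = rhs g z + m * rhs h z"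
  by (simp add: rhs_def algebra_simps)

lemma p2_neg: "1/16 < z ^ 2 \<Longrightarrow> z ^ 2 < 1/4 \<Longrightarrow> p2 z < 0"
  by (simp add: p2_def mult_neg_pos)

lemma p2_pos1: "z ^ 2 < 1/16 \<Longrightarrow> p2 z > 0"
  by (simp add: p2_def mult_neg_neg)

lemma p2_pos2: "z ^ 2 > 1/4 \<Longrightarrow> p2 z > 0"
  by (simp add: p2_def)

lemma cube_neg: "x < 0 \<Longrightarrow> x ^ 3 < (0::real)"
  by (simp add: power_less_zero_eq_numeral)

lemma cube_nonpos: "x \<le> 0 \<Longrightarrow> x ^ 3 \<le> (0::real)"
  by (cases "x = 0") (auto intro: less_imp_le cube_neg)

lemma rhs_nonneg:
  assumes "p2 z \<le> 0" "g z \<ge> 0"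
  shows "rhs g z \<ge> 0"
  unfolding rhs_def using assms cube_nonpos[OF assms(1)]
  by (metis mult_nonneg_nonpos mult_nonpos_nonneg neg_0_le_iff_le wt_nonneg)

lemma rhs_nonpos:
  assumes "p2 z \<ge> 0" "g z \<ge> 0"
  shows "rhs g z \<le> 0"
  unfolding rhs_def using assms by (simp add: wt_nonneg)

lemma rhs_pos:
  assumes "p2 z < 0" "g z > 0" "\<bar>z\<bar> < 1"
  shows "rhs g z > 0"
  unfolding rhs_def using assms cube_neg[OF assms(1)]
  by (simp add: mult_less_0_iff wt_pos mult_pos_neg)

lemma rhs_neg:
  assumes "p2 z > 0" "g z > 0" "\<bar>z\<bar> < 1"
  shows "rhs g z < 0"
  unfolding rhs_def using assms by (simp add: wt_pos)

text \<open>The sign of \<open>rhs\<close> is opposite to that of \<open>p2\<close>, so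
  \<open>u\<close> pushes the integral up and \<open>v\<close> pushes it down; suitable positive
  amounts of both cancel whatever \<open>g\<close> contributes.\<close>

lemma balance:
  assumes s: "smooth g" "smooth u" "smooth v"
    and u: "\<And>z. u z \<ge> 0" "\<And>z. u z \<noteq> 0 \<Longrightarrow> p2 z < 0" "z1 \<in> {0..<1}" "u z1 > 0"
    and v: "\<And>z. v z \<ge> 0" "\<And>z. v z \<noteq> 0 \<Longrightarrow> p2 z > 0" "z2 \<in> {0..<1}" "v z2 > 0"
  obtains m n where "m > 0" "n > 0" "integral {0..1} (rhs (\<lambda>z. g z + m * u z + n * v z)) = 0"
proof -
  let ?I = "\<lambda>g. integral {0..1} (rhs g)"
  have "?I u > 0"
  proof (rule integral_pos[of _ z1])
    show "rhs u z \<ge> 0" for z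
    proof (cases "u z = 0")
      case False
      then show ?thesis using rhs_nonneg[of z u] u(1,2)[of z] by simp
    qed (simp add: rhs_def)
  qed (use u s in \<open>auto intro!: rhs_pos smooth_continuous_on smooth_rhs\<close>)
  moreover have "integral {0..1} (\<lambda>z. - rhs v z) > 0"
  proof (rule integral_pos[of _ z2])
    show "- rhs v z \<ge> 0" for z
    proof (cases "v z = 0")
      case False
      then show ?thesis using rhs_nonpos[of z v] v(1,2)[of z] by simp
    qed (simp add: rhs_def)
    show "continuous_on UNIV (\<lambda>z. - rhs v z)"
      by (intro smooth_continuous_on smooth_minus smooth_rhs s)
    show "- rhs v z2 > 0" using rhs_neg[of z2 v] v by auto
  qed (use v in auto)
  ultimately have I: "?I u > 0" "?I v < 0" by simp_all
  \<comment> \<open>The \<open>v\<close> term contributes \<open>- (\<bar>?I g\<bar> + 1)\<close>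
    and the \<open>u\<close> term the remaining amount; the \<open>+ 1\<close> keeps both
    multipliers strictly positive.\<close>
  define n where "n = (\<bar>?I g\<bar> + 1) / (- ?I v)"
  define m where "m = (\<bar>?I g\<bar> + 1 - ?I g) / ?I u"
  have "m > 0" "n > 0" using I by (auto simp: m_def n_def divide_less_0_iff zero_less_divide_iff)
  have "?I (\<lambda>z. g z + m * u z + n * v z) = integral {0..1} (\<lambda>z. (rhs g z + m * rhs u z) + n * rhs v z)"
    unfolding rhs_lincomb ..
  also have "\<dots> = ?I g + m * ?I u + n * ?I v"
    by (intro integral_unique has_integral_add has_integral_mult_right integrable_integral rhs_integrable s)
  also have "\<dots> = 0" using I by (simp add: m_def n_def)
  finally show ?thesis using that \<open>m > 0\<close> \<open>n > 0\<close> by blast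
qed

text \<open>The factor \<open>c\<close> is 1 for even and -1 for odd functions, so the rule can be
  iterated.\<close>

lemma deriv_even:
  fixes f :: "real \<Rightarrow> real"
  assumes "smooth f" "\<And>x. f (- x) = c * f x"
  shows "deriv f (- x) = - c * deriv f x"
proof -
  have "((\<lambda>x. f (- x)) has_real_derivative - deriv f (- x)) (at x)"
    using DERIV_mirror[THEN iffD1, OF smooth_DERIV[OF assms(1)]] .
  moreover have "((\<lambda>x. f (- x)) has_real_derivative c * deriv f x) (at x)"
    unfolding assms(2) by (auto intro!: derivative_eq_intros smooth_DERIV assms)
  ultimately show ?thesis using DERIV_unique by fastforce
qed

lemma H2_even:
  assumes "smooth U" "\<And>z. U (- z) = U z"
  shows "H2 k m U (- z) = H2 k m U z"
proof -
  have d: "deriv U (- z) = - deriv U z" for z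
    using deriv_even[OF assms(1), of 1] assms(2) by simp
  have "deriv (deriv U) (- z) = deriv (deriv U) z"
    using deriv_even[OF smooth_deriv[OF assms(1)], of "-1"] d by simp
  then show ?thesis using d[of z] assms(2)[of z]
    by (simp add: H2_def om_minus cB_def cC_def c1_def algebra_simps)
qed

text \<open>Near \<open>z = \<plusminus>1\<close> the profile \<open>b\<close> will be a multiple of \<open>- wt (1/3) (4/3) * K3\<close>, the cube root of
  the second derivative of \<open>- wt 1 0\<close>, so that \<open>a\<close> is there a multiple of \<open>wt 1 0\<close> itself.\<close>

definition K3 :: "real \<Rightarrow> real" where "K3 z = pos_ext 1 (cC 1 0 z) powr (1/3)"

lemma smooth_K3: "smooth K3"
  unfolding K3_def[abs_def] by (intro smooth_powr smooth_pos_ext smooth_coeffs pos_ext_pos) auto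

lemma K3_pos: "K3 z > 0"
  using pos_ext_pos[of 1 "cC 1 0 z"] by (simp add: K3_def)

lemma K3_cube: "cC 1 0 z \<ge> 1 \<Longrightarrow> K3 z ^ 3 = cC 1 0 z"
  by (simp add: K3_def pos_ext_eq powr_third_cube)

lemma cC_minus: "cC k m (- z) = cC k m z"
  by (simp add: cC_def om_minus c1_def algebra_simps)

lemma K3_minus: "K3 (- z) = K3 z"
  by (simp add: K3_def cC_minus)

text \<open>If \<open>b\<close> is \<open>- wt (1/3) (4/3) * K3\<close> near the boundary, then
  \<open>- b''\<close> is \<open>wt (1/3) (16/3) * ell\<close> there; positivity of
  \<open>ell\<close> is what keeps \<open>c\<close> divided by its weight away from zero.\<close>

definition ell :: "real \<Rightarrow> real" where "ell = H2 (1/3) (4/3) K3"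

lemma smooth_ell: "smooth ell"
  unfolding ell_def by (rule smooth_H2[OF smooth_K3])

lemma ell_minus: "ell (- z) = ell z"
  unfolding ell_def by (rule H2_even[OF smooth_K3 K3_minus])

text \<open>At \<open>z = 1\<close> all terms with \<open>om\<close> drop out, so that
  \<open>cC 1 0\<close> is 4 and \<open>ell\<close> is a positive multiple of \<open>K3\<close>.
  Continuity gives a neighbourhood, and evenness transfers it to \<open>z = -1\<close>.\<close>

lemma near_boundary:
  obtains nu where "1/2 \<le> nu" "nu < 1" "\<And>z. nu \<le> z ^ 2 \<Longrightarrow> \<bar>z\<bar> \<le> 1 \<Longrightarrow> cC 1 0 z \<ge> 1 \<and> ell z > 0"
proof -
  have "isCont (cC 1 0) 1" "isCont ell 1"
    using smooth_DERIV[OF smooth_coeffs(3)] smooth_DERIV[OF smooth_ell] DERIV_isCont by blast+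
  moreover have "cC 1 0 1 = 4" by (simp add: cC_def c1_def om_def)
  moreover have "ell 1 > 0"
    using K3_pos[of 1] by (simp add: ell_def H2_def om_def cB_def cC_def c1_def)
  moreover have *: "(f \<longlongrightarrow> f 1) (nhds 1)" if "isCont f 1" for f :: "real \<Rightarrow> real"
    using that by (simp add: isCont_def tendsto_at_iff_tendsto_nhds)
  ultimately have "\<forall>\<^sub>F z in nhds 1. cC 1 0 z > 1" "\<forall>\<^sub>F z in nhds 1. ell z > 0"
    using order_tendstoD(1)[OF *[of "cC 1 0"], of 1] order_tendstoD(1)[OF *[of ell], of 0]
    by simp_all
  then have "\<forall>\<^sub>F z in nhds 1. cC 1 0 z > 1 \<and> ell z > 0" by (rule eventually_conj)
  then obtain d where d: "d > 0" "\<And>z. \<bar>z - 1\<bar> < d \<Longrightarrow> cC 1 0 z > 1 \<and> ell z > 0"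
    unfolding eventually_nhds_metric dist_real_def by blast
  define s where "s = max (3/4) (1 - d/2)"
  have s: "3/4 \<le> s" "s < 1" "1 - d < s" using d(1) by (auto simp: s_def)
  show ?thesis
  proof (rule that[of "s ^ 2"])
    have "(3/4)^2 \<le> s^2" using s by (intro power_mono) auto
    then show "1/2 \<le> s ^ 2" by (simp add: power2_eq_square)
    show "s ^ 2 < 1" using s by (simp add: abs_square_less_1)
    fix z :: real assume z: "s ^ 2 \<le> z ^ 2" "\<bar>z\<bar> \<le> 1"
    then have "s \<le> \<bar>z\<bar>" using s by (metis abs_le_square_iff abs_of_nonneg order_trans zero_le_divide_iff zero_le_numeral)
    then have "cC 1 0 \<bar>z\<bar> > 1 \<and> ell \<bar>z\<bar> > 0" using d(2)[of "\<bar>z\<bar>"] s z by auto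
    moreover have "cC 1 0 \<bar>z\<bar> = cC 1 0 z" "ell \<bar>z\<bar> = ell z"
      using ell_minus[of z] by (auto simp: abs_if cC_minus)
    ultimately show "cC 1 0 z \<ge> 1 \<and> ell z > 0" by auto
  qed
qed

lemma DERIV_zero_backward:
  fixes D D' :: "real \<Rightarrow> real"
  assumes "\<And>x. (D has_real_derivative D' x) (at x)" "\<And>x. (D' has_real_derivative D'' x) (at x)"
    "\<And>x. s \<le> x \<Longrightarrow> x \<le> 1 \<Longrightarrow> D'' x = 0" "D 1 = 0" "D' 1 = 0" "s \<le> x" "x \<le> 1"
  shows "D x = 0"
proof -
  have D': "D' y = 0" if "y \<in> {s..1}" for y
  proof -
    have "(D' has_real_derivative 0) (at u)" if "u \<in> {s..1}" for u
      using assms(2)[of u] assms(3)[of u] that by simp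
    then have "D' y = D' 1" by (intro DERIV_zero_eq[where S = "{s..1}"]) (use that in auto)
    then show ?thesis using assms by simp
  qed
  have "(D has_real_derivative 0) (at u)" if "u \<in> {s..1}" for u
    using assms(1)[of u] D'[OF that] by simp
  then have "D x = D 1" by (intro DERIV_zero_eq[where S = "{s..1}"]) (use assms in auto)
  then show ?thesis using assms by simp
qed

text \<open>\<open>B'\<close> falls, rises and falls again, and vanishes at 0 and 1, so it changes
  sign exactly once, at \<open>\<zeta>\<close>: \<open>B\<close> decreases up to
  \<open>\<zeta>\<close> and then increases to 0. If \<open>B 0 \<le> 0\<close>, then
  \<open>B\<close> would be nonpositive and the integral of its cube negative. So \<open>B\<close>
  has exactly one zero in \<open>(0, 1)\<close>; it lies left of \<open>\<zeta>\<close>, where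
  \<open>B' < 0\<close>.\<close>

lemma profile_zero:
  fixes B B' f :: "real \<Rightarrow> real"
  assumes D: "\<And>x. (B has_real_derivative B' x) (at x)" "\<And>x. (B' has_real_derivative f x) (at x)"
    and z: "B' 0 = 0" "B' 1 = 0" "B 1 = 0"
    and f: "\<And>x. 0 < x \<Longrightarrow> x < 1/4 \<Longrightarrow> f x < 0" "\<And>x. 1/4 < x \<Longrightarrow> x < 1/2 \<Longrightarrow> f x > 0"
      "\<And>x. 1/2 < x \<Longrightarrow> x < 1 \<Longrightarrow> f x < 0"
    and I: "integral {0..1} (\<lambda>x. B x ^ 3) = 0"
  obtains z1 where "0 < z1" "z1 < 1" "B z1 = 0" "B' z1 < 0"
    "\<And>x. 0 \<le> x \<Longrightarrow> x < z1 \<Longrightarrow> B x > 0" "\<And>x. z1 < x \<Longrightarrow> x < 1 \<Longrightarrow> B x < 0"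
proof -
  have contB': "continuous_on S B'" for S
    by (rule continuous_at_imp_continuous_on) (use D(2) DERIV_isCont in fast)
  have contB: "continuous_on S B" for S
    by (rule continuous_at_imp_continuous_on) (use D(1) DERIV_isCont in fast)
  have decB': "B' y < B' x" if "x < y" "\<And>u. x < u \<Longrightarrow> u < y \<Longrightarrow> f u < 0" for x y
    by (rule DERIV_neg_imp_decreasing_open[OF that(1) _ contB']) (use D(2) that(2) in blast)
  have a: "B' y < 0" if "0 < y" "y \<le> 1/4" for y
    using decB'[OF that(1)] f(1) that z by simp
  have b: "B' y > 0" if "1/2 \<le> y" "y < 1" for y
    using decB'[OF that(2)] f(3) that z by simp
  have mono: "B' x < B' y" if "1/4 \<le> x" "x < y" "y \<le> 1/2" for x y
  proof (rule DERIV_pos_imp_increasing_open[OF that(2) _ contB'])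
    fix u assume "x < u" "u < y"
    then have "f u > 0" using f(2) that by simp
    then show "\<exists>d. (B' has_real_derivative d) (at u) \<and> d > 0" using D(2) by blast
  qed
  obtain \<zeta> where \<zeta>: "1/4 \<le> \<zeta>" "\<zeta> \<le> 1/2" "B' \<zeta> = 0"
    using IVT'[of B' "1/4" 0 "1/2", OF _ _ _ contB'] a[of "1/4"] b[of "1/2"] by auto
  have neg: "B' y < 0" if "0 < y" "y < \<zeta>" for y
    using a[of y] mono[of y \<zeta>] that \<zeta> by (cases "y \<le> 1/4") auto
  have pos: "B' y > 0" if "\<zeta> < y" "y < 1" for y
    using b[of y] mono[of \<zeta> y] that \<zeta> by (cases "y \<ge> 1/2") auto
  have dec: "B y < B x" if "0 \<le> x" "x < y" "y \<le> \<zeta>" for x y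
  proof (rule DERIV_neg_imp_decreasing_open[OF that(2) _ contB])
    fix u assume "x < u" "u < y"
    then have "B' u < 0" using neg that by simp
    then show "\<exists>d. (B has_real_derivative d) (at u) \<and> d < 0" using D(1) by blast
  qed
  have inc: "B x < B y" if "\<zeta> \<le> x" "x < y" "y \<le> 1" for x y
  proof (rule DERIV_pos_imp_increasing_open[OF that(2) _ contB])
    fix u assume "x < u" "u < y"
    then have "B' u > 0" using pos that by simp
    then show "\<exists>d. (B has_real_derivative d) (at u) \<and> d > 0" using D(1) by blast
  qed
  have Bneg: "B x < 0" if "\<zeta> \<le> x" "x < 1" for x
    using inc[of x 1] that z by auto
  have B0: "B 0 > 0"
  proof (rule ccontr)
    assume "\<not> B 0 > 0"
    then have "B x \<le> 0" if "x \<in> {0..1}" for x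
      using dec[of 0 x] Bneg[of x] z that
      by (cases "x = 0"; cases "x \<le> \<zeta>"; cases "x = 1"; simp)
    then have "integral {0..1} (\<lambda>x. - (B x ^ 3)) > 0"
      using Bneg[of \<zeta>] \<zeta> contB by (intro integral_pos[of _ \<zeta>]) (auto intro!: continuous_intros simp: cube_nonpos cube_neg)
    then show False using I by simp
  qed
  obtain z1 where z1: "0 \<le> z1" "z1 \<le> \<zeta>" "B z1 = 0"
    using IVT2'[of B \<zeta> 0 0, OF _ _ _ contB] B0 Bneg[of \<zeta>] \<zeta> by auto
  have "z1 \<noteq> 0" "z1 \<noteq> \<zeta>" using z1 B0 Bneg[of \<zeta>] \<zeta> by auto
  show ?thesis
  proof (rule that[of z1])
    show "B x > 0" if "0 \<le> x" "x < z1" for x using dec[of x z1] that z1 by auto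
    show "B x < 0" if "z1 < x" "x < 1" for x
      using dec[of z1 x] Bneg[of x] that z1 by (cases "x \<le> \<zeta>") auto
  qed (use z1 \<zeta> \<open>z1 \<noteq> 0\<close> \<open>z1 \<noteq> \<zeta>\<close> neg[of z1] in auto)
qed

text \<open>Uniqueness of derivatives on the open interval, applied twice, turns an equation for the
  second derivative of \<open>F\<close> into one for its quotient by the weight.\<close>

lemma wt_H2_eq:
  assumes "k > 0" "smooth U" and eq: "\<And>z. \<bar>z\<bar> < 1 \<Longrightarrow> wt k m z * U z = F z"
    and D: "\<And>x. (F has_real_derivative F' x) (at x)" "\<And>x. (F' has_real_derivative f x) (at x)"
    and z: "\<bar>z\<bar> < 1"
  shows "wt k (m + 4) z * H2 k m U z = f z"
proof -
  have tr: "(Q has_real_derivative d) (at z)" if "(P has_real_derivative d) (at z)" "\<And>z. \<bar>z\<bar> < 1 \<Longrightarrow> P z = Q z" "\<bar>z\<bar> < 1"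
    for P Q :: "real \<Rightarrow> real" and d z
    by (rule has_field_derivative_transform_within_open[OF that(1), of "{-1<..<1}"]) (use that in auto)
  have "wt k (m + 2) z * (om z ^ 2 * deriv U z + c1 k m z * U z) = F' z" if "\<bar>z\<bar> < 1" for z
    using DERIV_unique[OF tr[OF DERIV_wt[OF assms(1) smooth_DERIV[OF assms(2)]] eq that] D(1)] by simp
  from DERIV_unique[OF tr[OF DERIV_wt_2[OF assms(1,2)] this z] D(2)] show ?thesis by simp
qed

section \<open>Stationary profiles\<close>

text \<open>Both cuts \<open>1/8\<close> and \<open>3/16\<close> lie between the squared roots
  \<open>1/16\<close> and \<open>1/4\<close>. So each of the two densities meets both signs of
  \<open>p2\<close> and can be balanced on its own, and since their supports overlap every positive
  combination is positive on the closed interval. Only \<open>gX\<close> reaches the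
  boundary.\<close>

lemma balanced_profiles:
  obtains nu gX gY where "1/2 \<le> nu" "nu < 1" "smooth gX" "smooth gY"
    "\<And>z. gX (- z) = gX z" "\<And>z. gY (- z) = gY z"
    "\<And>z. \<bar>z\<bar> \<le> 1 \<Longrightarrow> gX z \<ge> 0" "\<And>z. \<bar>z\<bar> \<le> 1 \<Longrightarrow> gY z \<ge> 0"
    "\<And>z. z ^ 2 \<le> 1/8 \<Longrightarrow> gX z = 0" "\<And>z. 3/16 \<le> z ^ 2 \<Longrightarrow> gY z = 0"
    "\<And>z. 1/8 < z ^ 2 \<Longrightarrow> \<bar>z\<bar> \<le> 1 \<Longrightarrow> gX z > 0" "\<And>z. z ^ 2 < 3/16 \<Longrightarrow> gY z > 0"
    "\<And>z. nu \<le> z ^ 2 \<Longrightarrow> p2 z ^ 3 * gX z = ell z" "\<And>z. nu \<le> z ^ 2 \<Longrightarrow> \<bar>z\<bar> \<le> 1 \<Longrightarrow> cC 1 0 z \<ge> 1"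
    "integral {0..1} (rhs gX) = 0" "integral {0..1} (rhs gY) = 0"
proof -
  obtain mu where mu: "1/2 \<le> mu" "mu < 1" "\<And>z. mu \<le> z ^ 2 \<Longrightarrow> \<bar>z\<bar> \<le> 1 \<Longrightarrow> cC 1 0 z \<ge> 1 \<and> ell z > 0"
    using near_boundary by blast
  define nu where "nu = (1 + mu) / 2"
  have nu: "mu < nu" "nu < 1" "3/4 \<le> nu" using mu by (auto simp: nu_def)
  \<comment> \<open>For \<open>z^2 \<ge> 1/2\<close> the factors of \<open>p2\<close> are at least
    \<open>1/4\<close> and \<open>7/16\<close>, with product \<open>7/64\<close>.\<close>
  define q0 :: real where "q0 = (7/64) ^ 3"
  have q0: "q0 > 0" by (simp add: q0_def)
  have p2q: "pos_ext q0 (p2 z ^ 3) = p2 z ^ 3 \<and> p2 z > 0" if "mu \<le> z ^ 2" for z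
  proof -
    have "1/4 * (7/16) \<le> (z ^ 2 - 1/4) * (z ^ 2 - 1/16)"
      using that mu(1) by (intro mult_mono) auto
    then have "7/64 \<le> p2 z" by (simp add: p2_def)
    then show ?thesis using power_mono[of "7/64" "p2 z" 3] by (simp add: pos_ext_eq q0 q0_def)
  qed
  \<comment> \<open>Switches on from 0 at \<open>z^2 = mu\<close> to the exact boundary density
    \<open>ell / p2^3\<close> at \<open>z^2 = nu\<close>, inside the range where
    \<open>ell > 0\<close> is known.\<close>
  define gn where "gn z = smooth_step ((z ^ 2 - mu) * inverse (nu - mu)) * ell z * inverse (pos_ext q0 (p2 z ^ 3))" for z
  have sgn: "smooth gn"
    unfolding gn_def[abs_def]
    by (intro smooth_intros smooth_compose[OF smooth_smooth_step] smooth_ell smooth_inverse smooth_pos_ext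
        smooth_p2 pos_ext_pos q0)
  have gn_even: "gn (- z) = gn z" for z by (simp add: gn_def ell_minus p2_def)
  have gn0: "gn z = 0" if "z ^ 2 \<le> mu" for z
    using that nu by (simp add: gn_def smooth_step_0 mult_nonpos_nonneg)
  have gn_pos: "gn z > 0" if "mu < z ^ 2" "\<bar>z\<bar> \<le> 1" for z
    using that nu mu(3)[of z] smooth_step_pos[of "(z ^ 2 - mu) * inverse (nu - mu)"] pos_ext_pos[OF q0]
    by (auto simp: gn_def intro!: mult_pos_pos)
  have gn_nonneg: "gn z \<ge> 0" if "\<bar>z\<bar> \<le> 1" for z
    using gn0[of z] gn_pos[of z] that by (cases "mu < z ^ 2") auto
  have gn_eq: "p2 z ^ 3 * gn z = ell z" if "nu \<le> z ^ 2" for z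
  proof -
    have "(z ^ 2 - mu) * inverse (nu - mu) \<ge> 1" using that nu by (simp add: field_simps)
    then show ?thesis using that nu p2q[of z] by (simp add: gn_def smooth_step_1)
  qed
  \<comment> \<open>The bump secures positivity below \<open>nu\<close>. Like the two balancing
    bumps it vanishes for \<open>z^2 \<ge> nu\<close>, so the boundary density stays exact.\<close>
  define g1 where "g1 z = gn z + bump (1/8) nu z" for z
  have s1: "smooth g1" unfolding g1_def[abs_def] by (intro smooth_add sgn smooth_bump)
  obtain m n where mn: "m > 0" "n > 0"
    "integral {0..1} (rhs (\<lambda>z. g1 z + m * bump (1/8) (1/4) z + n * bump (1/4) nu z)) = 0"
  proof (rule balance[OF s1 smooth_bump[of "1/8" "1/4"] smooth_bump[of "1/4" nu], of "2/5" "3/5"])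
    show "p2 z < 0" if "bump (1/8) (1/4) z \<noteq> 0" for z
      by (rule p2_neg) (use that bump_zero[of z "1/8" "1/4"] in fastforce)+
    show "p2 z > 0" if "bump (1/4) nu z \<noteq> 0" for z
      by (rule p2_pos2) (use that bump_zero[of z "1/4" nu] in fastforce)
    show "bump (1/8) (1/4) (2/5) > 0" by (rule bump_pos) (simp_all add: power2_eq_square)
    show "bump (1/4) nu (3/5) > 0" by (rule bump_pos) (use nu in \<open>simp_all add: power2_eq_square\<close>)
  qed (auto simp: bump_nonneg)
  define gX where "gX z = g1 z + m * bump (1/8) (1/4) z + n * bump (1/4) nu z" for z
  define g2 where "g2 z = flat 1 0 (3/16 - z ^ 2)" for z
  define g3 where "g3 z = flat 1 0 (1/16 - z ^ 2)" for z
  have s2: "smooth g2" "smooth g3"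
    unfolding g2_def[abs_def] g3_def[abs_def] by (intro smooth_compose[OF smooth_flat] smooth_intros; simp)+
  obtain m' n' where mn': "m' > 0" "n' > 0"
    "integral {0..1} (rhs (\<lambda>z. g2 z + m' * bump (1/16) (3/16) z + n' * g3 z)) = 0"
  proof (rule balance[OF s2(1) smooth_bump[of "1/16" "3/16"] s2(2), of "2/5" 0])
    show "p2 z < 0" if "bump (1/16) (3/16) z \<noteq> 0" for z
      by (rule p2_neg) (use that bump_zero[of z "1/16" "3/16"] in fastforce)+
    show "p2 z > 0" if "g3 z \<noteq> 0" for z
      by (rule p2_pos1) (use that flat_nonpos[of "1/16 - z ^ 2" 1 0] in \<open>force simp: g3_def\<close>)
    show "bump (1/16) (3/16) (2/5) > 0" by (rule bump_pos) (simp_all add: power2_eq_square)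
  qed (auto simp: bump_nonneg g3_def flat_nonneg flat_pos)
  define gY where "gY z = g2 z + m' * bump (1/16) (3/16) z + n' * g3 z" for z
  show ?thesis
  proof (rule that[of nu gX gY])
    show "smooth gX" "smooth gY"
      unfolding gX_def[abs_def] gY_def[abs_def] by (intro smooth_intros s1 s2 smooth_bump)+
    show "gX (- z) = gX z" "gY (- z) = gY z" for z
      by (simp_all add: gX_def gY_def g1_def g2_def g3_def gn_even bump_minus)
    show "gX z \<ge> 0" if "\<bar>z\<bar> \<le> 1" for z
      using gn_nonneg[OF that] mn by (simp add: gX_def g1_def bump_nonneg)
    show "gY z \<ge> 0" for z
      using mn' by (simp add: gY_def g2_def g3_def flat_nonneg bump_nonneg)
    show "gX z = 0" if "z ^ 2 \<le> 1/8" for z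
      using that mu by (simp add: gX_def g1_def gn0 bump_zero)
    show "gY z = 0" if "3/16 \<le> z ^ 2" for z
      using that by (simp add: gY_def g2_def g3_def flat_nonpos bump_zero)
    show "gX z > 0" if z: "1/8 < z ^ 2" "\<bar>z\<bar> \<le> 1" for z
    proof -
      have "g1 z > 0"
        using bump_pos[OF z(1), of nu] gn_pos[of z] gn_nonneg[of z] bump_nonneg[of "1/8" nu z] z nu
        by (cases "z ^ 2 < nu") (auto simp: g1_def intro: add_nonneg_pos add_pos_nonneg)
      then show ?thesis
        using mn by (auto simp: gX_def bump_nonneg intro!: add_pos_nonneg)
    qed
    show "gY z > 0" if "z ^ 2 < 3/16" for z
      using that mn' by (auto simp: gY_def g2_def g3_def flat_pos flat_nonneg bump_nonneg intro!: add_pos_nonneg)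
    show "p2 z ^ 3 * gX z = ell z" if "nu \<le> z ^ 2" for z
      using gn_eq[OF that] that nu by (simp add: gX_def g1_def bump_zero)
    show "cC 1 0 z \<ge> 1" if "nu \<le> z ^ 2" "\<bar>z\<bar> \<le> 1" for z
      using mu(3)[of z] that nu by simp
    show "integral {0..1} (rhs gX) = 0" "integral {0..1} (rhs gY) = 0"
      using mn(3) mn'(3) by (simp_all add: gX_def[abs_def] gY_def[abs_def])
  qed (use nu in auto)
qed

text \<open>By the single sign change of its second derivative, the profile \<open>X\<close> of
  \<open>gX\<close> is nonpositive and the profile \<open>Y\<close> of \<open>gY\<close> is
  nonnegative. Hence the integral of the cube of \<open>(1 - q) X + q Y\<close> passes from negative
  to positive, and vanishes for some \<open>q\<close> strictly between 0 and 1. Near the boundary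
  only \<open>gX\<close> counts, which gives the factor \<open>1 - q\<close>.\<close>

lemma stationary_profile:
  obtains nu q g B B' where "1/2 \<le> nu" "nu < 1" "0 < q" "q < 1" "smooth g" "smooth B"
    "\<And>z. \<bar>z\<bar> \<le> 1 \<Longrightarrow> g z > 0" "\<And>z. B (- z) = B z" "\<And>z. \<bar>z\<bar> \<ge> 1 \<Longrightarrow> B z = 0"
    "\<And>z. (B has_real_derivative B' z) (at z)" "\<And>z. (B' has_real_derivative rhs g z) (at z)"
    "B' 0 = 0" "B' 1 = 0" "integral {0..1} (\<lambda>z. B z ^ 3) = 0"
    "\<And>z. nu \<le> z ^ 2 \<Longrightarrow> \<bar>z\<bar> \<le> 1 \<Longrightarrow> p2 z ^ 3 * g z = (1 - q) * ell z \<and> cC 1 0 z \<ge> 1"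
proof -
  obtain nu gX gY where nu: "1/2 \<le> nu" "nu < 1" and s: "smooth gX" "smooth gY"
    and even: "\<And>z. gX (- z) = gX z" "\<And>z. gY (- z) = gY z"
    and nonneg: "\<And>z. \<bar>z\<bar> \<le> 1 \<Longrightarrow> gX z \<ge> 0" "\<And>z. \<bar>z\<bar> \<le> 1 \<Longrightarrow> gY z \<ge> 0"
    and zero: "\<And>z. z ^ 2 \<le> 1/8 \<Longrightarrow> gX z = 0" "\<And>z. 3/16 \<le> z ^ 2 \<Longrightarrow> gY z = 0"
    and pos: "\<And>z. 1/8 < z ^ 2 \<Longrightarrow> \<bar>z\<bar> \<le> 1 \<Longrightarrow> gX z > 0" "\<And>z. z ^ 2 < 3/16 \<Longrightarrow> gY z > 0"
    and near: "\<And>z. nu \<le> z ^ 2 \<Longrightarrow> p2 z ^ 3 * gX z = ell z" "\<And>z. nu \<le> z ^ 2 \<Longrightarrow> \<bar>z\<bar> \<le> 1 \<Longrightarrow> cC 1 0 z \<ge> 1"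
    and int: "integral {0..1} (rhs gX) = 0" "integral {0..1} (rhs gY) = 0"
    by (rule balanced_profiles) ((assumption | rule that)+)
  have re: "rhs gX (- z) = rhs gX z" "rhs gY (- z) = rhs gY z" for z
    by (intro rhs_minus even)+
  obtain X X' where X: "smooth X" "smooth X'" "\<And>x. X (- x) = X x" "\<And>x. \<bar>x\<bar> \<ge> 1 \<Longrightarrow> X x = 0"
    "\<And>x. (X has_real_derivative X' x) (at x)" "\<And>x. (X' has_real_derivative rhs gX x) (at x)"
    "X' 0 = 0" "X' 1 = 0"
    by (rule second_antiderivative[OF smooth_rhs[OF s(1)] re(1) rhs_zero int(1)]) ((assumption | rule that)+)
  obtain Y Y' where Y: "smooth Y" "smooth Y'" "\<And>x. Y (- x) = Y x" "\<And>x. \<bar>x\<bar> \<ge> 1 \<Longrightarrow> Y x = 0"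
    "\<And>x. (Y has_real_derivative Y' x) (at x)" "\<And>x. (Y' has_real_derivative rhs gY x) (at x)"
    "Y' 0 = 0" "Y' 1 = 0"
    by (rule second_antiderivative[OF smooth_rhs[OF s(2)] re(2) rhs_zero int(2)]) ((assumption | rule that)+)
  have sq: "x ^ 2 \<le> y ^ 2" if "0 \<le> x" "x \<le> y" for x y :: real
    using that by (intro power_mono) auto
  have p2_le: "p2 z \<le> 0" if "1/16 \<le> z ^ 2" "z ^ 2 \<le> 1/4" for z
    using that by (simp add: p2_def mult_nonpos_nonneg)
  have p2_ge: "p2 z \<ge> 0" if "1/4 \<le> z ^ 2" for z
    using that by (simp add: p2_def)
  have p2_ge': "p2 z \<ge> 0" if "z ^ 2 \<le> 1/16" for z
    using that by (simp add: p2_def mult_nonpos_nonpos)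
  have IX: "integral {0..1} (\<lambda>x. X x ^ 3) < 0"
  proof (rule shape_cube_integral_neg[OF X(5,6,7,8), of "1/2" "2/5"])
    show "rhs gX x \<ge> 0" if "0 \<le> x" "x \<le> 1/2" for x
    proof (cases "x ^ 2 \<le> 1/8")
      case False
      then show ?thesis using that sq[of x "1/2"] nonneg(1)[of x] by (intro rhs_nonneg p2_le) (auto simp: power2_eq_square)
    qed (simp add: zero rhs_def)
    show "rhs gX x \<le> 0" if "1/2 \<le> x" "x \<le> 1" for x
      using that sq[of "1/2" x] nonneg(1)[of x] by (intro rhs_nonpos p2_ge) (auto simp: power2_eq_square)
    show "rhs gX (2/5) \<noteq> 0"
      using rhs_pos[of "2/5" gX] p2_neg[of "2/5"] pos(1)[of "2/5"] by (simp add: power2_eq_square)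
  qed (use X in auto)
  have IY: "integral {0..1} (\<lambda>x. (- Y x) ^ 3) < 0"
  proof (rule shape_cube_integral_neg[OF DERIV_minus[OF Y(5)] DERIV_minus[OF Y(6)], of "1/4" "1/8"])
    show "- rhs gY x \<ge> 0" if "0 \<le> x" "x \<le> 1/4" for x
      using that sq[of x "1/4"] nonneg(2)[of x] rhs_nonpos[OF p2_ge', of x gY] by (auto simp: power2_eq_square)
    show "- rhs gY x \<le> 0" if "1/4 \<le> x" "x \<le> 1" for x
    proof (cases "3/16 \<le> x ^ 2")
      case False
      then show ?thesis using that sq[of "1/4" x] nonneg(2)[of x] rhs_nonneg[OF p2_le, of x gY] by (auto simp: power2_eq_square)
    qed (simp add: zero rhs_def)
    show "- rhs gY (1/8) \<noteq> 0"
      using rhs_neg[of "1/8" gY] p2_pos1[of "1/8"] pos(2)[of "1/8"] by (simp add: power2_eq_square)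
  qed (use Y in auto)
  define J where "J q = integral {0..1} (\<lambda>x. ((1 - q) * X x + q * Y x) ^ 3)" for q
  have cX: "continuous_on {0..1} X" and cY: "continuous_on {0..1} Y"
    using X(1) Y(1) by (auto intro: smooth_continuous_on)
  \<comment> \<open>Expanding the cube shows that \<open>J\<close> is a cubic polynomial in
    \<open>q\<close>, hence continuous.\<close>
  have J: "J q = (1 - q) ^ 3 * integral {0..1} (\<lambda>x. X x ^ 3) + (3 * (1 - q) ^ 2 * q) * integral {0..1} (\<lambda>x. X x ^ 2 * Y x)
      + (3 * (1 - q) * q ^ 2) * integral {0..1} (\<lambda>x. X x * Y x ^ 2) + q ^ 3 * integral {0..1} (\<lambda>x. Y x ^ 3)" for q
  proof -
    have "((\<lambda>x. (1 - q) ^ 3 * X x ^ 3 + (3 * (1 - q) ^ 2 * q) * (X x ^ 2 * Y x) + (3 * (1 - q) * q ^ 2) * (X x * Y x ^ 2) + q ^ 3 * Y x ^ 3)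
      has_integral ((1 - q) ^ 3 * integral {0..1} (\<lambda>x. X x ^ 3) + (3 * (1 - q) ^ 2 * q) * integral {0..1} (\<lambda>x. X x ^ 2 * Y x)
      + (3 * (1 - q) * q ^ 2) * integral {0..1} (\<lambda>x. X x * Y x ^ 2) + q ^ 3 * integral {0..1} (\<lambda>x. Y x ^ 3))) {0..1}"
      by (intro has_integral_add has_integral_mult_right integrable_integral integrable_continuous_real
          continuous_intros cX cY)
    moreover have "(\<lambda>x. (1 - q) ^ 3 * X x ^ 3 + (3 * (1 - q) ^ 2 * q) * (X x ^ 2 * Y x) + (3 * (1 - q) * q ^ 2) * (X x * Y x ^ 2) + q ^ 3 * Y x ^ 3)
       = (\<lambda>x. ((1 - q) * X x + q * Y x) ^ 3)"
      by (rule ext) (simp add: power3_eq_cube power2_eq_square algebra_simps)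
    ultimately show ?thesis unfolding J_def by (simp add: integral_unique)
  qed
  have "continuous_on {0..1} J"
    unfolding J[abs_def] by (intro continuous_intros)
  moreover have "J 0 < 0" "J 1 > 0" using IX IY by (simp_all add: J_def)
  ultimately obtain q where q: "0 \<le> q" "q \<le> 1" "J q = 0"
    using IVT'[of J 0 0 1] by auto
  have q01: "0 < q" "q < 1" using q \<open>J 0 < 0\<close> \<open>J 1 > 0\<close> by (auto simp: less_le)
  define g where "g z = (1 - q) * gX z + q * gY z" for z
  define B where "B z = (1 - q) * X z + q * Y z" for z
  define B' where "B' z = (1 - q) * X' z + q * Y' z" for z
  have rhs: "rhs g z = (1 - q) * rhs gX z + q * rhs gY z" for z
    by (simp add: rhs_def g_def algebra_simps)
  show ?thesis
  proof (rule that[of nu q g B B'])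
    show "smooth g" "smooth B" unfolding g_def[abs_def] B_def[abs_def] by (intro smooth_intros s X(1) Y(1))+
    show "g z > 0" if "\<bar>z\<bar> \<le> 1" for z
    proof (cases "z ^ 2 < 3/16")
      case True
      then show ?thesis
        using nonneg(1)[OF that] pos(2)[of z] q01 unfolding g_def by (intro add_nonneg_pos) auto
    next
      case False
      then show ?thesis
        using nonneg(2)[OF that] pos(1)[OF _ that] q01 unfolding g_def by (intro add_pos_nonneg) auto
    qed
    show "B (- z) = B z" for z by (simp add: B_def X(3) Y(3))
    show "B z = 0" if "\<bar>z\<bar> \<ge> 1" for z by (simp add: B_def X(4) Y(4) that)
    show "(B has_real_derivative B' z) (at z)" for z
      unfolding B_def[abs_def] B'_def by (intro DERIV_add DERIV_cmult X(5) Y(5))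
    show "(B' has_real_derivative rhs g z) (at z)" for z
      unfolding B'_def[abs_def] rhs by (intro DERIV_add DERIV_cmult X(6) Y(6))
    show "integral {0..1} (\<lambda>z. B z ^ 3) = 0" using q by (simp add: J_def B_def)
    show "p2 z ^ 3 * g z = (1 - q) * ell z \<and> cC 1 0 z \<ge> 1" if "nu \<le> z ^ 2" "\<bar>z\<bar> \<le> 1" for z
      using near(1)[OF that(1)] near(2)[OF that] zero(2)[of z] that nu by (simp add: g_def algebra_simps)
  qed (use nu q01 in \<open>simp_all add: X(7,8) Y(7,8) B'_def\<close>)
qed

text \<open>Where \<open>D\<close> is nonzero, \<open>om\<close> exceeds \<open>1 - nu\<close>; the
  reciprocal weight may therefore be written with \<open>pos_ext (1 - nu) (om z)\<close> in place of
  \<open>om z\<close>, which is smooth on the whole line.\<close>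

lemma divide_by_weight:
  assumes "smooth D" "nu < 1" "\<And>z. nu \<le> z ^ 2 \<Longrightarrow> D z = 0"
  obtains U where "smooth U" "\<And>z. wt k m z * U z = D z" "\<And>z. nu \<le> z ^ 2 \<Longrightarrow> U z = 0"
proof
  let ?p = "\<lambda>z. pos_ext (1 - nu) (om z)"
  let ?U = "\<lambda>z. D z * (exp (k * inverse (?p z)) * ?p z powr m)"
  have p: "?p z > 0" for z using pos_ext_pos assms(2) by simp
  show "smooth ?U"
    by (intro smooth_mult assms smooth_exp smooth_powr smooth_inverse smooth_const smooth_pos_ext smooth_om p)
  show "wt k m z * ?U z = D z" for z
  proof (cases "nu \<le> z ^ 2")
    case False
    then have "om z > 1 - nu" by (simp add: om_def)
    then have "?p z = om z" "om z > 0" using pos_ext_eq[of "1 - nu" "om z"] assms(2) by auto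
    moreover have "exp (- k / om z) * exp (k * inverse (om z)) = 1"
      by (simp add: exp_add[symmetric] divide_inverse)
    moreover have "om z powr (- m) * om z powr m = 1"
      using \<open>om z > 0\<close> by (simp add: powr_add[symmetric])
    moreover have "wt k m z * ?U z = D z * ((exp (- k / om z) * exp (k * inverse (om z))) * (om z powr (- m) * om z powr m))"
      using \<open>om z > 0\<close> \<open>?p z = om z\<close> by (simp add: wt_def flat_def mult_ac)
    ultimately show ?thesis by simp
  qed (simp add: assms)
  show "?U z = 0" if "nu \<le> z ^ 2" for z using assms(3)[OF that] by simp
qed

text \<open>Division by the weights is explicit near the boundary: there \<open>B\<close> is
  \<open>- (1 - q) K3\<close> and \<open>G\<close> is \<open>(1 - q)^3\<close> times its weight. The
  deviations from these forms vanish near the boundary, where the weights decay, and so can be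
  divided as well.\<close>

theorem stationary:
  obtains G0 B0 \<beta> \<gamma> :: "real \<Rightarrow> real" and Z1 Z2 where
    "smooth G0" "smooth B0" "smooth \<beta>" "smooth \<gamma>" "finite Z1" "finite Z2" "Z1 \<subseteq> {-1<..<1}" "Z2 \<subseteq> {-1<..<1}"
    "\<And>z. \<bar>z\<bar> < 1 \<Longrightarrow> - H2 1 0 G0 z = B0 z ^ 3" "\<And>z. B0 z = (\<Prod>i\<in>Z1. z - i) * \<beta> z"
    "\<And>z. \<bar>z\<bar> < 1 \<Longrightarrow> - H2 (1/3) (4/3) B0 z = (\<Prod>i\<in>Z2. z - i) ^ 3 * \<gamma> z"
    "\<And>z. \<bar>z\<bar> \<le> 1 \<Longrightarrow> \<beta> z < 0" "\<And>z. \<bar>z\<bar> \<le> 1 \<Longrightarrow> \<gamma> z > 0"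
proof -
  obtain nu q g B B' where nu: "1/2 \<le> nu" "nu < 1" and q: "0 < q" "q < 1" and sg: "smooth g" and sB: "smooth B"
    and g: "\<And>z. \<bar>z\<bar> \<le> 1 \<Longrightarrow> g z > 0" and Beven: "\<And>z. B (- z) = B z" and B0: "\<And>z. \<bar>z\<bar> \<ge> 1 \<Longrightarrow> B z = 0"
    and DB: "\<And>z. (B has_real_derivative B' z) (at z)" "\<And>z. (B' has_real_derivative rhs g z) (at z)"
    and B'0: "B' 0 = 0" "B' 1 = 0" and int: "integral {0..1} (\<lambda>z. B z ^ 3) = 0"
    and near: "\<And>z. nu \<le> z ^ 2 \<Longrightarrow> \<bar>z\<bar> \<le> 1 \<Longrightarrow> p2 z ^ 3 * g z = (1 - q) * ell z \<and> cC 1 0 z \<ge> 1"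
    by (rule stationary_profile) ((assumption | rule that)+)
  \<comment> \<open>A function with zero second derivative near 1 and zero value and slope at 1
    vanishes there; evenness gives the other end.\<close>
  have near_zero: "D z = 0" if D: "\<And>z. D (- z) = D z" "\<And>x. \<bar>x\<bar> \<ge> 1 \<Longrightarrow> D x = 0" and D': "\<And>x. (D has_real_derivative D' x) (at x)"
      "\<And>x. (D' has_real_derivative D'' x) (at x)" "D' 1 = 0"
      and D'': "\<And>x. nu \<le> x ^ 2 \<Longrightarrow> \<bar>x\<bar> \<le> 1 \<Longrightarrow> D'' x = 0" and z: "nu \<le> z ^ 2" for D D' D'' :: "real \<Rightarrow> real" and z
  proof (cases "\<bar>z\<bar> \<le> 1")
    case True
    have "D \<bar>z\<bar> = 0"
    proof (rule DERIV_zero_backward[OF D'(1,2), of "\<bar>z\<bar>"])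
      show "D'' x = 0" if "\<bar>z\<bar> \<le> x" "x \<le> 1" for x
      proof (rule D'')
        have "\<bar>z\<bar> ^ 2 \<le> x ^ 2" using that by (intro power_mono) auto
        then show "nu \<le> x ^ 2" using z by simp
      qed (use that in auto)
    qed (use True D' D(2)[of 1] in auto)
    then show ?thesis using D(1)[of z] by (auto simp: abs_if split: if_splits)
  qed (use D in auto)
  \<comment> \<open>Deviation of \<open>B\<close> from its intended boundary form
    \<open>- (1 - q) * wt (1/3) (4/3) * K3\<close>.\<close>
  define D where "D z = B z + (1 - q) * (wt (1/3) (4/3) z * K3 z)" for z
  have sD: "smooth D" unfolding D_def[abs_def] by (intro smooth_intros sB smooth_wt smooth_K3) auto
  have Deven: "D (- z) = D z" for z by (simp add: D_def Beven wt_def om_minus K3_minus)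
  have Dnear: "D z = 0" if "nu \<le> z ^ 2" for z
  proof (rule near_zero[OF _ _ _ _ _ _ that])
    let ?W = "\<lambda>z. wt (1/3) (4/3 + 2) z * (om z ^ 2 * deriv K3 z + c1 (1/3) (4/3) z * K3 z)"
    show "(D has_real_derivative B' x + (1 - q) * ?W x) (at x)" for x
      unfolding D_def[abs_def]
      by (intro DERIV_add DERIV_cmult DB DERIV_wt smooth_DERIV smooth_K3) simp
    show "((\<lambda>x. B' x + (1 - q) * ?W x) has_real_derivative
        rhs g x + (1 - q) * (wt (1/3) (4/3 + 4) x * H2 (1/3) (4/3) K3 x)) (at x)" for x
      by (intro DERIV_add DERIV_cmult DB DERIV_wt_2 smooth_K3) simp
    show "rhs g x + (1 - q) * (wt (1/3) (4/3 + 4) x * H2 (1/3) (4/3) K3 x) = 0" if "nu \<le> x ^ 2" "\<bar>x\<bar> \<le> 1" for x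
      using near[OF that] by (simp add: rhs_def ell_def mult.assoc)
  qed (simp_all add: Deven B'0 wt_zero, simp add: D_def B0 wt_zero)
  obtain U where U: "smooth U" "\<And>z. wt (1/3) (4/3) z * U z = D z" "\<And>z. nu \<le> z ^ 2 \<Longrightarrow> U z = 0"
    by (rule divide_by_weight[OF sD nu(2) Dnear, of "1/3" "4/3"]) ((assumption | rule that)+)
  define Bh where "Bh z = U z - (1 - q) * K3 z" for z
  have sBh: "smooth Bh" unfolding Bh_def[abs_def] by (intro smooth_intros U(1) smooth_K3)
  have wBh: "wt (1/3) (4/3) z * Bh z = B z" for z
    using U(2)[of z] by (simp add: Bh_def D_def algebra_simps)
  have Bh_end: "Bh z < 0" if "\<bar>z\<bar> = 1" for z
  proof -
    have "z ^ 2 = 1" using that by (simp add: abs_square_eq_1)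
    then show ?thesis using U(3)[of z] nu q K3_pos[of z] by (simp add: Bh_def)
  qed
  have Beq: "rhs g z = - (wt (1/3) (16/3) z * (p2 z ^ 3 * g z))" for z by (simp add: rhs_def)
  have eq2: "- H2 (1/3) (4/3) Bh z = p2 z ^ 3 * g z" if "\<bar>z\<bar> < 1" for z
  proof -
    have "wt (1/3) (4/3 + 4) z * H2 (1/3) (4/3) Bh z = rhs g z"
      by (rule wt_H2_eq[OF _ sBh _ DB that]) (simp_all add: wBh)
    then have "wt (1/3) (16/3) z * (- H2 (1/3) (4/3) Bh z) = wt (1/3) (16/3) z * (p2 z ^ 3 * g z)"
      by (simp add: Beq)
    then show ?thesis using wt_pos[OF that, of "1/3" "16/3"] unfolding mult_cancel_left by simp
  qed
  have sB3: "smooth (\<lambda>z. - (B z ^ 3))" by (intro smooth_intros sB)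
  obtain G G' where G: "smooth G" "smooth G'" "\<And>x. G (- x) = G x" "\<And>x. \<bar>x\<bar> \<ge> 1 \<Longrightarrow> G x = 0"
    "\<And>x. (G has_real_derivative G' x) (at x)" "\<And>x. (G' has_real_derivative - (B x ^ 3)) (at x)"
    "G' 0 = 0" "G' 1 = 0"
    by (rule second_antiderivative[OF sB3]) ((assumption | rule that | simp add: Beven B0 int)+)
  \<comment> \<open>Deviation of \<open>G\<close> from \<open>(1 - q)^3 * wt 1 0\<close>, whose
    second derivative near the boundary is exactly \<open>- B^3\<close> by the choice of
    \<open>K3\<close>. The factor 1 plays the part of \<open>U\<close> in
    \<open>DERIV_wt\<close>.\<close>
  define E where "E z = G z - (1 - q) ^ 3 * (wt 1 0 z * 1)" for z
  have sE: "smooth E" unfolding E_def[abs_def] by (intro smooth_intros G(1) smooth_wt) auto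
  have Enear: "E z = 0" if "nu \<le> z ^ 2" for z
  proof (rule near_zero[OF _ _ _ _ _ _ that])
    let ?W = "\<lambda>z. wt 1 (0 + 2) z * (om z ^ 2 * deriv (\<lambda>_. 1) z + c1 1 0 z * 1)"
    show "(E has_real_derivative G' x - (1 - q) ^ 3 * ?W x) (at x)" for x
      unfolding E_def[abs_def]
      by (intro DERIV_diff DERIV_cmult G(5,6) DERIV_wt smooth_DERIV smooth_const) simp
    show "((\<lambda>x. G' x - (1 - q) ^ 3 * ?W x) has_real_derivative
        - (B x ^ 3) - (1 - q) ^ 3 * (wt 1 (0 + 4) x * H2 1 0 (\<lambda>_. 1) x)) (at x)" for x
      by (intro DERIV_diff DERIV_cmult G(5,6) DERIV_wt_2 smooth_const) simp
    show "- (B x ^ 3) - (1 - q) ^ 3 * (wt 1 (0 + 4) x * H2 1 0 (\<lambda>_. 1) x) = 0" if x: "nu \<le> x ^ 2" "\<bar>x\<bar> \<le> 1" for x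
    proof (cases "\<bar>x\<bar> < 1")
      case True
      have "B x = - ((1 - q) * (wt (1/3) (4/3) x * K3 x))" using Dnear[OF x(1)] by (simp add: D_def)
      then have "B x ^ 3 = - ((1 - q) ^ 3 * (wt (1/3) (4/3) x ^ 3 * K3 x ^ 3))"
        by (simp add: power_mult_distrib)
      also have "wt (1/3) (4/3) x ^ 3 = wt 1 4 x" using wt_power[OF True, of "1/3" "4/3" 3] by simp
      also have "K3 x ^ 3 = cC 1 0 x" using near[OF x] K3_cube by blast
      finally show ?thesis by (simp add: H2_def)
    qed (use x B0 in \<open>simp add: wt_zero\<close>)
  qed (simp_all add: E_def G(3,4,8) wt_zero, simp add: wt_def om_minus)
  obtain V where V: "smooth V" "\<And>z. wt 1 0 z * V z = E z"
    by (rule divide_by_weight[OF sE nu(2) Enear, of 1 0]) ((assumption | rule that)+)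
  define Gh where "Gh z = V z + (1 - q) ^ 3" for z
  have sGh: "smooth Gh" unfolding Gh_def[abs_def] by (intro smooth_intros V(1))
  have wGh: "wt 1 0 z * Gh z = G z" for z
    using V(2)[of z] by (simp add: Gh_def E_def algebra_simps)
  have eq1: "- H2 1 0 Gh z = Bh z ^ 3" if "\<bar>z\<bar> < 1" for z
  proof -
    have "wt 1 (0 + 4) z * H2 1 0 Gh z = - (B z ^ 3)"
      by (rule wt_H2_eq[OF _ sGh _ G(5,6) that]) (simp_all add: wGh)
    also have "B z ^ 3 = wt 1 4 z * Bh z ^ 3"
      using wt_power[OF that, of "1/3" "4/3" 3] by (simp add: power_mult_distrib flip: wBh)
    finally have "wt 1 4 z * (- H2 1 0 Gh z) = wt 1 4 z * Bh z ^ 3" by simp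
    then show ?thesis using wt_pos[OF that, of 1 4] unfolding mult_cancel_left by simp
  qed
  have sgn: "rhs g x < 0" if "0 < x" "x < 1/4" for x
    using that g[of x] power_strict_mono[of x "1/4" 2] by (intro rhs_neg p2_pos1) (auto simp: power2_eq_square)
  have sgn': "rhs g x > 0" if "1/4 < x" "x < 1/2" for x
    using that g[of x] power_strict_mono[of x "1/2" 2] power_strict_mono[of "1/4" x 2] by (intro rhs_pos p2_neg) (auto simp: power2_eq_square)
  have sgn'': "rhs g x < 0" if "1/2 < x" "x < 1" for x
    using that g[of x] power_strict_mono[of "1/2" x 2] by (intro rhs_neg p2_pos2) (auto simp: power2_eq_square)
  have "B 1 = 0" using B0 by simp
  obtain z1 where z1: "0 < z1" "z1 < 1" "B z1 = 0" "B' z1 < 0"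
    and Bpos: "\<And>x. 0 \<le> x \<Longrightarrow> x < z1 \<Longrightarrow> B x > 0" and Bneg: "\<And>x. z1 < x \<Longrightarrow> x < 1 \<Longrightarrow> B x < 0"
    by (rule profile_zero[OF DB B'0 \<open>B 1 = 0\<close> sgn sgn' sgn'' int]) ((assumption | rule that)+)
  have Bhz: "Bh z1 = 0" "Bh (- z1) = 0"
    using wBh[of z1] wBh[of "- z1"] z1 wt_pos[of z1 "1/3" "4/3"] wt_pos[of "- z1" "1/3" "4/3"] Beven[of z1] by auto
  \<comment> \<open>The division lemma is stated in three variables; \<open>Bh\<close> is viewed as
    constant in the first two.\<close>
  have "smooth (\<lambda>x :: real \<times> real \<times> real. Bh (snd (snd x)))" by (intro smooth_compose[OF sBh] smooth_intros)
  then have "\<exists>R. smooth R \<and> (\<forall>e t z. Bh (snd (snd (e :: real, t :: real, z))) = (\<Prod>i\<in>{z1, - z1}. z - i) * R (e, t, z))"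
    by (intro hadamard_finite) (use Bhz in auto)
  then obtain R :: "real \<times> real \<times> real \<Rightarrow> real" where R: "smooth R \<and> (\<forall>e t z. Bh z = (\<Prod>i\<in>{z1, - z1}. z - i) * R (e, t, z))"
    unfolding snd_conv by blast
  define \<beta> where "\<beta> z = R (0, 0, z)" for z
  have s\<beta>: "smooth \<beta>" unfolding \<beta>_def[abs_def] by (intro smooth_compose[OF conjunct1[OF R]] smooth_intros)
  have Bh\<beta>: "Bh z = (\<Prod>i\<in>{z1, - z1}. z - i) * \<beta> z" for z unfolding \<beta>_def using R by blast
  have Bh\<beta>': "Bh z = (z ^ 2 - z1 ^ 2) * \<beta> z" for z
    using Bh\<beta>[of z] z1 by (simp add: power2_eq_square algebra_simps)
  have \<beta>neg: "\<beta> z < 0" if z: "\<bar>z\<bar> \<le> 1" for z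
  proof -
    have Bh_sgn: "Bh z < 0 \<longleftrightarrow> B z < 0" "Bh z > 0 \<longleftrightarrow> B z > 0" if "\<bar>z\<bar> < 1"
      using wt_pos[OF that, of "1/3" "4/3"] by (simp_all add: mult_less_0_iff zero_less_mult_iff flip: wBh)
    have Babs: "B \<bar>z\<bar> = B z" using Beven[of z] by (simp add: abs_if)
    consider "\<bar>z\<bar> > z1" | "\<bar>z\<bar> < z1" | "\<bar>z\<bar> = z1" by linarith
    then show ?thesis
    proof cases
      case 1
      then have "Bh z < 0" using Bh_end[of z] Bh_sgn Bneg[of "\<bar>z\<bar>"] Babs z by (cases "\<bar>z\<bar> = 1") auto
      moreover have "z ^ 2 > z1 ^ 2" using 1 z1 by (metis abs_le_square_iff abs_of_pos not_le)
      ultimately show ?thesis by (simp add: Bh\<beta>' mult_less_0_iff)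
    next
      case 2
      then have "Bh z > 0" using Bh_sgn Bpos[of "\<bar>z\<bar>"] Babs z1 by auto
      moreover have "z ^ 2 < z1 ^ 2" using 2 z1 by (metis abs_le_square_iff abs_of_pos not_le)
      ultimately show ?thesis by (simp add: Bh\<beta>' zero_less_mult_iff)
    next
      case 3
      \<comment> \<open>At a root the sign comes from the slope: \<open>Bh' = 2 z \<beta>\<close>,
        and \<open>z * B' z < 0\<close> at both roots because \<open>B'\<close> is odd.\<close>
      have zz: "\<bar>z\<bar> < 1" "z ^ 2 = z1 ^ 2" using 3 z1 by auto
      have "(Bh has_real_derivative 2 * z * \<beta> z) (at z)"
        unfolding Bh\<beta>'[abs_def] by (rule DERIV_cong, (rule derivative_eq_intros smooth_DERIV[OF s\<beta>] refl)+) (use zz in simp)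
      from DERIV_wt[OF _ this, of "1/3" "4/3"]
      have "((\<lambda>z. wt (1/3) (4/3) z * Bh z) has_real_derivative wt (1/3) (10/3) z * (om z ^ 2 * (2 * z * \<beta> z) + c1 (1/3) (4/3) z * Bh z)) (at z)"
        by simp
      then have "(B has_real_derivative wt (1/3) (10/3) z * (om z ^ 2 * (2 * z * \<beta> z))) (at z)"
        unfolding wBh using zz Bh\<beta>'[of z] by simp
      then have B'z: "B' z = wt (1/3) (10/3) z * om z ^ 2 * 2 * (z * \<beta> z)"
        using DERIV_unique[OF DB(1)] by (simp add: mult_ac)
      have "z * B' z < 0"
      proof (cases "z = z1")
        case False
        then have "z = - z1" using 3 by auto
        moreover have "((\<lambda>x. B (- x)) has_real_derivative - B' (- z1)) (at z1)"
          using DERIV_mirror[THEN iffD1, OF DB(1)] .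
        then have "B' z1 = - B' (- z1)" unfolding Beven using DERIV_unique[OF DB(1)] by blast
        ultimately show ?thesis using z1 by (simp add: mult_pos_neg)
      qed (use z1 in \<open>simp add: mult_pos_neg\<close>)
      then have "(wt (1/3) (10/3) z * om z ^ 2 * 2 * z ^ 2) * \<beta> z < 0"
        unfolding B'z by (simp add: power2_eq_square mult_ac)
      moreover have "wt (1/3) (10/3) z * om z ^ 2 * 2 * z ^ 2 \<ge> 0" by (simp add: wt_nonneg)
      ultimately show ?thesis by (metis mult_nonneg_nonneg not_le)
    qed
  qed
  have Z2: "(\<Prod>i\<in>{1/2, -1/2, 1/4, -1/4}. z - i) = p2 z" for z :: real
    by (simp add: p2_def power2_eq_square field_simps)
  show ?thesis
    by (rule that[OF sGh sBh s\<beta> sg _ _ _ _ eq1 Bh\<beta> eq2[folded Z2] \<beta>neg g]) (use z1 in auto)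
qed

section \<open>The conjugated heat operator in scaled coordinates\<close>

definition lam :: "real \<times> real \<times> real \<Rightarrow> real" where
  "lam x = fst x * (1 - fst (snd x) ^ 2)"

text \<open>\<open>lam\<close> times its \<open>t\<close>-derivative.\<close>

definition ll :: "real \<times> real \<times> real \<Rightarrow> real" where
  "ll x = - 2 * fst (snd x) * fst x ^ 2 * (1 - fst (snd x) ^ 2)"

text \<open>The coefficient of the first order term of the radial Laplacian in the scaled variable
  \<open>z = (r - 1/2) / lam\<close>, extended smoothly to all \<open>z\<close>.\<close>

definition pcoef :: "real \<Rightarrow> real \<times> real \<times> real \<Rightarrow> real" where
  "pcoef c x = c * lam x * inverse (pos_ext (1/4) (1/2 + lam x * snd (snd x)))"

text \<open>The heat operator, conjugated with the weights
  \<open>flat k n (1 - t^2) * flat k m (1 - z^2)\<close> and multiplied by \<open>lam^2\<close>.\<close>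

definition LL :: "real \<Rightarrow> real \<Rightarrow> real \<Rightarrow> real \<Rightarrow> (real \<times> real \<times> real \<Rightarrow> real) \<Rightarrow> real \<times> real \<times> real \<Rightarrow> real" where
  "LL c k m n = zop (\<lambda>x. - (om (snd (snd x)) ^ 4))
     (\<lambda>x. - cB k m (snd (snd x)) - om (snd (snd x)) ^ 4 * (pcoef c x + ll x * snd (snd x)))
     (\<lambda>x. - cC k m (snd (snd x)) - om (snd (snd x)) ^ 2 * (pcoef c x + ll x * snd (snd x)) * c1 k m (snd (snd x))
        + om (snd (snd x)) ^ 4 * (- 2 * fst (snd x) * fst x ^ 2 * (k - n * (1 - fst (snd x) ^ 2))))
     (\<lambda>x. om (snd (snd x)) ^ 4 * lam x ^ 2)"

lemma smooth_lam: "smooth lam" and smooth_ll: "smooth ll"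
  unfolding lam_def[abs_def] ll_def[abs_def] by (intro smooth_intros)+

lemma smooth_pcoef: "smooth (pcoef c)"
  unfolding pcoef_def[abs_def]
  by (intro smooth_intros smooth_inverse smooth_pos_ext smooth_lam pos_ext_pos) auto

lemma smooth_lift: "smooth f \<Longrightarrow> smooth (\<lambda>x :: real \<times> real \<times> real. f (snd (snd x)))"
  by (rule smooth_compose, assumption, intro smooth_intros)

lemma LL_coeffs:
  "smooth (\<lambda>x :: real \<times> real \<times> real. - (om (snd (snd x)) ^ 4))"
  "smooth (\<lambda>x. - cB k m (snd (snd x)) - om (snd (snd x)) ^ 4 * (pcoef c x + ll x * snd (snd x)))"
  "smooth (\<lambda>x. - cC k m (snd (snd x)) - om (snd (snd x)) ^ 2 * (pcoef c x + ll x * snd (snd x)) * c1 k m (snd (snd x))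
        + om (snd (snd x)) ^ 4 * (- 2 * fst (snd x) * fst x ^ 2 * (k - n * (1 - fst (snd x) ^ 2))))"
  "smooth (\<lambda>x. om (snd (snd x)) ^ 4 * lam x ^ 2)"
  by (intro smooth_intros smooth_lift smooth_om smooth_coeffs smooth_pcoef smooth_ll smooth_lam)+

lemma dz_lift:
  assumes "smooth U"
  shows "dz (\<lambda>x. U (snd (snd x))) = (\<lambda>x. deriv U (snd (snd x)))"
  by (rule dz_eqI[OF smooth_lift[OF assms]]) (simp add: smooth_DERIV assms)

text \<open>Every term beyond the conjugated second derivative carries a factor \<open>e\<close>, so
  the slice \<open>e = 0\<close> is the stationary problem for each \<open>t\<close>.\<close>

lemma LL_lift:
  assumes "smooth U"
  shows "LL c k m n (\<lambda>x. U (snd (snd x))) (0, t, z) = - H2 k m U z"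
  by (simp add: LL_def zop_def dz_lift assms smooth_deriv H2_def pcoef_def lam_def ll_def)

text \<open>On the compact slice \<open>e = 0\<close> the minimum is positive; uniform continuity
  carries half of it to small \<open>e\<close>.\<close>

lemma positive_near:
  fixes Q :: "real \<times> real \<times> real \<Rightarrow> real"
  assumes "smooth Q" "\<And>t z. \<bar>t\<bar> \<le> 1 \<Longrightarrow> \<bar>z\<bar> \<le> 1 \<Longrightarrow> Q (0, t, z) > 0"
  obtains e0 q where "e0 > 0" "q > 0" "\<And>e t z. \<bar>e\<bar> \<le> e0 \<Longrightarrow> \<bar>t\<bar> \<le> 1 \<Longrightarrow> \<bar>z\<bar> \<le> 1 \<Longrightarrow> Q (e, t, z) \<ge> q"
proof -
  let ?S = "{-1..1::real} \<times> {-1..1::real} \<times> {-1..1::real}"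
  let ?T = "{0::real} \<times> {-1..1::real} \<times> {-1..1::real}"
  have comp: "compact ?S" "compact ?T" by (intro compact_Times compact_Icc compact_sing)+
  have cont: "continuous_on S Q" for S by (rule smooth_continuous_on[OF assms(1)])
  obtain x0 where x0: "x0 \<in> ?T" "\<And>y. y \<in> ?T \<Longrightarrow> Q x0 \<le> Q y"
    using continuous_attains_inf[OF comp(2) _ cont] by auto
  have pos: "Q x0 > 0" using x0(1) assms(2) by (auto simp: abs_le_iff)
  have "uniformly_continuous_on ?S Q" by (rule compact_uniformly_continuous[OF cont comp(1)])
  then obtain d where d: "d > 0" "\<And>x y. x \<in> ?S \<Longrightarrow> y \<in> ?S \<Longrightarrow> dist y x < d \<Longrightarrow> dist (Q y) (Q x) < Q x0 / 2"
    unfolding uniformly_continuous_on_def using pos by (metis half_gt_zero)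
  show ?thesis
  proof (rule that[of "min 1 (d/2)" "Q x0 / 2"])
    fix e t z :: real assume *: "\<bar>e\<bar> \<le> min 1 (d/2)" "\<bar>t\<bar> \<le> 1" "\<bar>z\<bar> \<le> 1"
    have "dist (e, t, z) (0, t, z) < d" using * d(1) by (simp add: dist_Pair_Pair dist_real_def)
    moreover have "(0, t, z) \<in> ?S" "(e, t, z) \<in> ?S" "(0, t, z) \<in> ?T" using * by auto
    ultimately have "dist (Q (e, t, z)) (Q (0, t, z)) < Q x0 / 2" "Q x0 \<le> Q (0, t, z)"
      using d(2) x0(2) by blast+
    then show "Q (e, t, z) \<ge> Q x0 / 2" unfolding dist_real_def by linarith
  qed (use d pos in auto)
qed

lemma rootpoly_split: "finite Z \<Longrightarrow> W \<subseteq> Z \<Longrightarrow> rootpoly Z x = rootpoly W x * rootpoly (Z - W) x"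
  unfolding rootpoly_def by (metis mult.commute prod.subset_diff)

section \<open>Exact solution of the scaled system for small \<open>e\<close>\<close>

text \<open>The image of \<open>G\<close> determines \<open>B\<close> as an exact cube root, while
  the image of that same \<open>B\<close> has to be a cube again. The approximation
  \<open>Bt\<close> settles the second requirement up to order three at the roots; \<open>G\<close>
  is then corrected so far that passing from \<open>Bt\<close> to the exact root changes
  \<open>B\<close> by order five only, and its image by order three.\<close>

lemma scaled_solution:
  obtains e0 G B C Z1 Z2 where "e0 > 0" "smooth G" "smooth B" "smooth C" "finite Z1" "finite Z2"
    "\<And>e t z. \<bar>e\<bar> \<le> e0 \<Longrightarrow> \<bar>t\<bar> \<le> 1 \<Longrightarrow> \<bar>z\<bar> \<le> 1 \<Longrightarrow> LL c 1 0 0 G (e, t, z) = B (e, t, z) ^ 3"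
    "\<And>e t z. \<bar>e\<bar> \<le> e0 \<Longrightarrow> \<bar>t\<bar> \<le> 1 \<Longrightarrow> \<bar>z\<bar> \<le> 1 \<Longrightarrow> LL c (1/3) (4/3) (2/3) B (e, t, z) = C (e, t, z) ^ 3"
    "\<And>e t z. \<bar>e\<bar> \<le> e0 \<Longrightarrow> \<bar>t\<bar> \<le> 1 \<Longrightarrow> \<bar>z\<bar> \<le> 1 \<Longrightarrow> z \<notin> Z1 \<Longrightarrow> B (e, t, z) \<noteq> 0"
    "\<And>e t z. z \<notin> Z2 \<Longrightarrow> C (e, t, z) \<noteq> 0"
proof -
  obtain G0 B0 \<beta>0 \<gamma>0 :: "real \<Rightarrow> real" and Z1 Z2 where
    s0: "smooth G0" "smooth B0" "smooth \<beta>0" "smooth \<gamma>0" and Z: "finite Z1" "finite Z2" "Z1 \<subseteq> {-1<..<1}" "Z2 \<subseteq> {-1<..<1}"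
    and st1: "\<And>z. \<bar>z\<bar> < 1 \<Longrightarrow> - H2 1 0 G0 z = B0 z ^ 3" and B0: "\<And>z. B0 z = (\<Prod>i\<in>Z1. z - i) * \<beta>0 z"
    and st2: "\<And>z. \<bar>z\<bar> < 1 \<Longrightarrow> - H2 (1/3) (4/3) B0 z = (\<Prod>i\<in>Z2. z - i) ^ 3 * \<gamma>0 z"
    and sgn: "\<And>z. \<bar>z\<bar> \<le> 1 \<Longrightarrow> \<beta>0 z < 0" "\<And>z. \<bar>z\<bar> \<le> 1 \<Longrightarrow> \<gamma>0 z > 0"
    by (rule stationary) ((assumption | rule that)+)
  let ?P = "rootpoly (Z1 \<union> Z2)" and ?P1 = "rootpoly Z1" and ?P2 = "rootpoly Z2"
  \<comment> \<open>One polynomial \<open>?P\<close> serves both corrections; these are its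
    cofactors for the roots of \<open>B\<close> and of \<open>C\<close>.\<close>
  let ?D1 = "rootpoly (Z1 \<union> Z2 - Z1)" and ?D2 = "rootpoly (Z1 \<union> Z2 - Z2)"
  have P1: "?P x = ?P1 x * ?D1 x" and P2: "?P x = ?P2 x * ?D2 x" for x
    using Z by (intro rootpoly_split; simp)+
  have ZZ: "finite (Z1 \<union> Z2)" "Z1 \<union> Z2 \<subseteq> {-1<..<1}" using Z by auto
  have A: "- (om (snd (snd (0 :: real, 0 :: real, z))) ^ 4) < 0" if "z \<in> Z1 \<union> Z2" for z
  proof -
    have "z \<in> {-1<..<1}" using that ZZ(2) by blast
    then have "\<bar>z\<bar> < 1" by auto
    then show ?thesis using om_pos_iff[of z] by simp
  qed
  let ?LB = "LL c (1/3) (4/3) (2/3)" and ?LG = "LL c 1 0 0"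
  let ?F = "\<lambda>x. ?P2 x ^ 3 * \<gamma>0 (snd (snd x))"
  note sm = smooth_intros smooth_rootpoly smooth_lift[OF s0(1)] smooth_lift[OF s0(2)] smooth_lift[OF s0(3)] smooth_lift[OF s0(4)]
  have sF: "smooth ?F" by (intro sm)
  \<comment> \<open>Order three is enough, since \<open>?P^3\<close> is divisible by
    \<open>?P2^3\<close>.\<close>
  have "\<exists>H R. smooth H \<and> smooth R \<and> (\<forall>t z. \<bar>z\<bar> \<le> 1 \<longrightarrow> H (0, t, z) = 0 \<and> R (0, t, z) = 0) \<and>
    (\<forall>x. ?LB (\<lambda>x. B0 (snd (snd x)) + ?P x ^ 2 * H x) x = ?F x + ?P x ^ 3 * R x)"
    unfolding LL_def
  proof (rule jet_correction[OF LL_coeffs smooth_lift[OF s0(2)] sF ZZ _ A])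
    show "zop (\<lambda>x. - (om (snd (snd x)) ^ 4))
     (\<lambda>x. - cB (1/3) (4/3) (snd (snd x)) - om (snd (snd x)) ^ 4 * (pcoef c x + ll x * snd (snd x)))
     (\<lambda>x. - cC (1/3) (4/3) (snd (snd x)) - om (snd (snd x)) ^ 2 * (pcoef c x + ll x * snd (snd x)) * c1 (1/3) (4/3) (snd (snd x))
        + om (snd (snd x)) ^ 4 * (- 2 * fst (snd x) * fst x ^ 2 * (1/3 - 2/3 * (1 - fst (snd x) ^ 2))))
     (\<lambda>x. om (snd (snd x)) ^ 4 * lam x ^ 2) (\<lambda>x. B0 (snd (snd x))) (0, t, z) = ?F (0, t, z)" if "\<bar>z\<bar> < 1" for t z
      using LL_lift[OF s0(2), of c "1/3" "4/3" "2/3" t z] st2[OF that] by (simp add: LL_def rootpoly_def)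
  qed simp_all
  then obtain H R where HRR: "smooth H \<and> smooth R \<and> (\<forall>t z. \<bar>z\<bar> \<le> 1 \<longrightarrow> H (0, t, z) = 0 \<and> R (0, t, z) = 0) \<and>
    (\<forall>x. ?LB (\<lambda>x. B0 (snd (snd x)) + ?P x ^ 2 * H x) x = ?F x + ?P x ^ 3 * R x)" by (elim exE) (rule that)
  then have H: "smooth H" "smooth R" "\<And>t z. \<bar>z\<bar> \<le> 1 \<Longrightarrow> H (0, t, z) = 0 \<and> R (0, t, z) = 0"
    by (elim conjE; fast)+
  from HRR have HR: "?LB (\<lambda>x. B0 (snd (snd x)) + ?P x ^ 2 * H x) x = ?F x + ?P x ^ 3 * R x" for x
    by (elim conjE allE)
  define Bt where "Bt x = B0 (snd (snd x)) + ?P x ^ 2 * H x" for x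
  \<comment> \<open>The correction is divisible by \<open>?P^2\<close>, so the factor
    \<open>?P1\<close> of \<open>B0\<close> survives in \<open>Bt\<close>, with cofactor
    \<open>bt\<close>.\<close>
  define bt where "bt x = \<beta>0 (snd (snd x)) + ?P x * ?D1 x * H x" for x
  have sBt: "smooth Bt" "smooth bt" unfolding Bt_def[abs_def] bt_def[abs_def] by (intro sm H)+
  have Bt: "Bt x = ?P1 x * bt x" for x
    unfolding Bt_def bt_def P1 B0 by (simp add: rootpoly_def power2_eq_square algebra_simps)
  have sBt3: "smooth (\<lambda>x. Bt x ^ 3)" by (intro sm sBt)
  \<comment> \<open>The exponent is \<open>8 = 3 + 5\<close>: three powers supply the factor
    \<open>?P1^3\<close>, and the other five leave \<open>?P^3\<close> after an operator of order
    two.\<close>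
  have "\<exists>H R. smooth H \<and> smooth R \<and> (\<forall>t z. \<bar>z\<bar> \<le> 1 \<longrightarrow> H (0, t, z) = 0 \<and> R (0, t, z) = 0) \<and>
    (\<forall>x. ?LG (\<lambda>x. G0 (snd (snd x)) + ?P x ^ 2 * H x) x = Bt x ^ 3 + ?P x ^ 8 * R x)"
    unfolding LL_def
  proof (rule jet_correction[OF LL_coeffs smooth_lift[OF s0(1)] sBt3 ZZ _ A])
    show "zop (\<lambda>x. - (om (snd (snd x)) ^ 4))
     (\<lambda>x. - cB 1 0 (snd (snd x)) - om (snd (snd x)) ^ 4 * (pcoef c x + ll x * snd (snd x)))
     (\<lambda>x. - cC 1 0 (snd (snd x)) - om (snd (snd x)) ^ 2 * (pcoef c x + ll x * snd (snd x)) * c1 1 0 (snd (snd x))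
        + om (snd (snd x)) ^ 4 * (- 2 * fst (snd x) * fst x ^ 2 * (1 - 0 * (1 - fst (snd x) ^ 2))))
     (\<lambda>x. om (snd (snd x)) ^ 4 * lam x ^ 2) (\<lambda>x. G0 (snd (snd x))) (0, t, z) = Bt (0, t, z) ^ 3" if "\<bar>z\<bar> < 1" for t z
      using LL_lift[OF s0(1), of c 1 0 0 t z] st1[OF that] that H(3)[of z t] by (simp add: LL_def Bt_def)
  qed simp_all
  then obtain HG RG where HRR: "smooth HG \<and> smooth RG \<and> (\<forall>t z. \<bar>z\<bar> \<le> 1 \<longrightarrow> HG (0, t, z) = 0 \<and> RG (0, t, z) = 0) \<and>
    (\<forall>x. ?LG (\<lambda>x. G0 (snd (snd x)) + ?P x ^ 2 * HG x) x = Bt x ^ 3 + ?P x ^ 8 * RG x)" by (elim exE) (rule that)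
  then have HG: "smooth HG" "smooth RG" "\<And>t z. \<bar>z\<bar> \<le> 1 \<Longrightarrow> RG (0, t, z) = 0"
    by (elim conjE; fast)+
  from HRR have HRG: "?LG (\<lambda>x. G0 (snd (snd x)) + ?P x ^ 2 * HG x) x = Bt x ^ 3 + ?P x ^ 8 * RG x" for x
    by (elim conjE allE)
  define G where "G x = G0 (snd (snd x)) + ?P x ^ 2 * HG x" for x
  have sG: "smooth G" unfolding G_def[abs_def] by (intro sm HG)
  define Q1 where "Q1 x = bt x ^ 3 + ?P x ^ 5 * ?D1 x ^ 3 * RG x" for x
  have sQ1: "smooth (\<lambda>x. - Q1 x)" unfolding Q1_def[abs_def] by (intro sm sBt HG)
  have LG: "?LG G x = ?P1 x ^ 3 * Q1 x" for x
  proof -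
    have "?P x ^ 8 = ?P x ^ 5 * (?P1 x * ?D1 x) ^ 3" unfolding P1[of x, symmetric] by (simp flip: power_add)
    then show ?thesis
      using HRG[of x] unfolding G_def[symmetric, abs_def] Q1_def Bt by (simp add: power_mult_distrib algebra_simps)
  qed
  have "- Q1 (0, t, z) > 0" if "\<bar>t\<bar> \<le> 1" "\<bar>z\<bar> \<le> 1" for t z
    using sgn(1)[OF that(2)] H(3)[OF that(2)] HG(3)[OF that(2)] cube_neg[of "\<beta>0 z"] by (simp add: Q1_def bt_def)
  then obtain e1 q1 where e1: "e1 > 0" "q1 > 0" "\<And>e t z. \<bar>e\<bar> \<le> e1 \<Longrightarrow> \<bar>t\<bar> \<le> 1 \<Longrightarrow> \<bar>z\<bar> \<le> 1 \<Longrightarrow> - Q1 (e, t, z) \<ge> q1"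
    by (rule positive_near[OF sQ1]) ((assumption | rule that)+)
  \<comment> \<open>The root is taken of \<open>- Q1\<close>, which is positive because
    \<open>bt\<close> is close to the negative \<open>\<beta>0\<close>.\<close>
  define b where "b x = - (pos_ext q1 (- Q1 x) powr (1/3))" for x
  have sb: "smooth b"
    unfolding b_def[abs_def] by (intro smooth_minus smooth_powr smooth_pos_ext sQ1 pos_ext_pos e1)
  have b_neg: "b x < 0" for x using pos_ext_pos[OF e1(2), of "- Q1 x"] by (simp add: b_def)
  have b3: "b (e, t, z) ^ 3 = Q1 (e, t, z)" if "\<bar>e\<bar> \<le> e1" "\<bar>t\<bar> \<le> 1" "\<bar>z\<bar> \<le> 1" for e t z
    using powr_third_cube[of "- Q1 (e, t, z)"] e1(3)[OF that] e1(2) by (simp add: b_def pos_ext_eq)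
  \<comment> \<open>Since \<open>b^3 - bt^3 = (b - bt) * den\<close>, dividing by this positive
    quadratic form passes the factor \<open>?P^5\<close> of \<open>Q1 - bt^3\<close> on to
    \<open>b - bt\<close>.\<close>
  define den where "den x = b x ^ 2 + b x * bt x + bt x ^ 2" for x
  have den_pos: "den x > 0" for x
  proof -
    have "den x = (bt x + b x / 2) ^ 2 + 3/4 * b x ^ 2" by (simp add: den_def power2_eq_square field_simps)
    moreover have "b x ^ 2 > 0" using b_neg[of x] by simp
    ultimately show ?thesis by (simp add: add_nonneg_pos)
  qed
  define S where "S x = RG x * ?D1 x ^ 3 * inverse (den x)" for x
  have sS: "smooth S"
    unfolding S_def[abs_def]
    by (intro sm smooth_inverse HG den_pos) (unfold den_def[abs_def], intro sm sb sBt)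
  have b_eq: "b (e, t, z) = bt (e, t, z) + ?P (e, t, z) ^ 5 * S (e, t, z)" if "\<bar>e\<bar> \<le> e1" "\<bar>t\<bar> \<le> 1" "\<bar>z\<bar> \<le> 1" for e t z
  proof -
    let ?x = "(e, t, z)"
    have "(b ?x - bt ?x) * den ?x = b ?x ^ 3 - bt ?x ^ 3"
      by (simp add: den_def power2_eq_square power3_eq_cube algebra_simps)
    also have "\<dots> = ?P ?x ^ 5 * S ?x * den ?x"
      using b3[OF that] den_pos[of ?x] by (simp add: Q1_def S_def)
    finally show ?thesis using den_pos[of ?x] by simp
  qed
  \<comment> \<open>In this form the image of \<open>B\<close> factorises at every point; the
    identity with \<open>?P1 * b\<close> holds for small \<open>e\<close> on the region of
    interest.\<close>
  define B where "B x = Bt x + ?P x ^ (3 + 2) * (?P1 x * S x)" for x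
  have sB: "smooth B" unfolding B_def[abs_def] by (intro sm sBt sS)
  have B: "B x = ?P1 x * (bt x + ?P x ^ 5 * S x)" for x
    by (simp add: B_def Bt algebra_simps)
  obtain T where T: "smooth T" "\<And>x. ?LB (\<lambda>x. ?P x ^ (3 + 2) * (?P1 x * S x)) x = ?P x ^ 3 * T x"
  proof -
    have s1: "smooth (\<lambda>x. ?P1 x * S x)" by (intro sm sS)
    obtain T where T: "smooth T" "\<And>x. ?LB (\<lambda>x. ?P x ^ (3 + 2) * (?P1 x * S x)) x =
        ?P x ^ 3 * (real ((3 + 2) * (3 + 1)) * - (om (snd (snd x)) ^ 4) * dz ?P x ^ 2 * (?P1 x * S x) + ?P x * T x)"
      using zop_power_mult[OF LL_coeffs smooth_rootpoly s1 dt_rootpoly, where m = 3] unfolding LL_def by blast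
    show ?thesis
      by (rule that[OF _ T(2)]) (intro sm smooth_dz smooth_lift[OF smooth_om] sS T(1))
  qed
  define Q2 where "Q2 x = \<gamma>0 (snd (snd x)) + ?D2 x ^ 3 * (R x + T x)" for x
  have sQ2: "smooth Q2" unfolding Q2_def[abs_def] by (intro sm H T)
  have LB: "?LB B x = ?P2 x ^ 3 * Q2 x" for x
  proof -
    have "?LB B x = ?LB Bt x + ?LB (\<lambda>x. ?P x ^ (3 + 2) * (?P1 x * S x)) x"
      unfolding B_def[abs_def] LL_def by (rule zop_add) (intro sm sBt sS)+
    also have "\<dots> = ?F x + ?P x ^ 3 * (R x + T x)"
      unfolding T(2) Bt_def[abs_def] HR by (simp add: algebra_simps)
    also have "\<dots> = ?P2 x ^ 3 * Q2 x"
      unfolding P2 Q2_def by (simp add: power_mult_distrib algebra_simps)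
    finally show ?thesis .
  qed
  \<comment> \<open>On the slice \<open>e = 0\<close> all corrections vanish for
    \<open>\<bar>z\<bar> \<le> 1\<close>, so \<open>B\<close> is \<open>B0\<close> there and the
    stationary equation identifies \<open>Q2\<close> off the roots.\<close>
  have Q20: "Q2 (0, t, z) = \<gamma>0 z" if "\<bar>z\<bar> \<le> 1" for t z
  proof -
    have "Q2 (0, t, z) - \<gamma>0 z = 0" if "\<bar>z\<bar> < 1" "z \<notin> Z2" for z
    proof -
      let ?w = "\<lambda>x. Bt x - B0 (snd (snd x)) + ?P x ^ (3 + 2) * (?P1 x * S x)"
      have sw: "smooth ?w" by (intro sm sBt sS)
      have w0: "?w (0, t, z) = 0" if "\<bar>z\<bar> < 1" for t z
        using H(3)[of z t] HG(3)[of z t] that by (simp add: Bt_def S_def)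
      have "?LB ?w (0, t, z) = 0" unfolding LL_def by (rule zop_vanish[OF sw w0 that(1)])
      moreover have "B = (\<lambda>x. B0 (snd (snd x)) + ?w x)" by (auto simp: B_def)
      then have "?LB B (0, t, z) = ?LB (\<lambda>x. B0 (snd (snd x))) (0, t, z) + ?LB ?w (0, t, z)"
        unfolding LL_def using zop_add[OF smooth_lift[OF s0(2)] sw] by metis
      ultimately have "?P2 (0, t, z) ^ 3 * Q2 (0, t, z) = ?P2 (0, t, z) ^ 3 * \<gamma>0 z"
        using LB[of "(0, t, z)"] LL_lift[OF s0(2), of c "1/3" "4/3" "2/3" t z] st2[OF that(1)] by (simp add: rootpoly_def)
      then show ?thesis using rootpoly_eq_0_iff[OF Z(2), of 0 t z] that by simp
    qed
    then show ?thesis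
      using vanish_dense[OF Z(2), of "\<lambda>x. Q2 x - \<gamma>0 (snd (snd x))" 0 t z] that by (simp add: smooth_diff sQ2 smooth_lift s0)
  qed
  have "Q2 (0, t, z) > 0" if "\<bar>t\<bar> \<le> 1" "\<bar>z\<bar> \<le> 1" for t z using Q20 sgn(2) that by simp
  then obtain e2 q2 where e2: "e2 > 0" "q2 > 0" "\<And>e t z. \<bar>e\<bar> \<le> e2 \<Longrightarrow> \<bar>t\<bar> \<le> 1 \<Longrightarrow> \<bar>z\<bar> \<le> 1 \<Longrightarrow> Q2 (e, t, z) \<ge> q2"
    by (rule positive_near[OF sQ2]) ((assumption | rule that)+)
  define C where "C x = ?P2 x * pos_ext q2 (Q2 x) powr (1/3)" for x
  have sC: "smooth C" unfolding C_def[abs_def] by (intro sm smooth_powr smooth_pos_ext sQ2 pos_ext_pos e2)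
  show ?thesis
  proof (rule that[of "min e1 e2" G B C Z1 Z2])
    fix e t z :: real assume *: "\<bar>e\<bar> \<le> min e1 e2" "\<bar>t\<bar> \<le> 1" "\<bar>z\<bar> \<le> 1"
    have be: "B (e, t, z) = ?P1 (e, t, z) * b (e, t, z)" unfolding B using b_eq * by simp
    then show "LL c 1 0 0 G (e, t, z) = B (e, t, z) ^ 3" using * b3 by (simp add: LG power_mult_distrib)
    show "LL c (1/3) (4/3) (2/3) B (e, t, z) = C (e, t, z) ^ 3"
      using e2(3)[of e t z] e2(2) * powr_third_cube[of "Q2 (e, t, z)"] by (simp add: LB C_def power_mult_distrib pos_ext_eq)
    show "B (e, t, z) \<noteq> 0" if "z \<notin> Z1"
      using be b_neg[of "(e, t, z)"] rootpoly_eq_0_iff[OF Z(1), of e t z] that by simp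
  next
    fix e t z :: real assume "z \<notin> Z2"
    then show "C (e, t, z) \<noteq> 0"
      using rootpoly_eq_0_iff[OF Z(2), of e t z] pos_ext_pos[OF e2(2), of "Q2 (e, t, z)"] by (simp add: C_def)
  qed (use e1 e2 sG sB sC Z in auto)
qed

section \<open>Partial derivatives in \<open>(t, r)\<close> and functions on the scaled
  region\<close>

lemma smooth_partials:
  fixes F :: "real \<times> real \<Rightarrow> real"
  assumes "smooth F"
  shows "(F has_derivative (\<lambda>v. fst v * partial_t F x + snd v * partial_r F x)) (at x)"
    and "smooth (partial_t F)" and "smooth (partial_r F)"
    and "((\<lambda>s. F (s, r)) has_real_derivative partial_t F (t, r)) (at t)"
    and "((\<lambda>s. F (t, s)) has_real_derivative partial_r F (t, r)) (at r)"
proof -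
  let ?A = "\<lambda>x. frechet_derivative F (at x)"
  have lin: "linear (?A x)" for x
    by (rule has_derivative_linear[OF smooth_has_derivative[OF assms]])
  have A: "?A x v = fst v * ?A x (1, 0) + snd v * ?A x (0, 1)" for x v
  proof -
    have "v = fst v *\<^sub>R (1, 0) + snd v *\<^sub>R (0, 1)" by (simp add: prod_eq_iff)
    then have "?A x v = ?A x (fst v *\<^sub>R (1, 0) + snd v *\<^sub>R (0, 1))" by (rule arg_cong)
    then show ?thesis by (simp only: linear_add[OF lin] linear_scale[OF lin] real_scaleR_def)
  qed
  have t: "((\<lambda>s. F (s, r)) has_real_derivative ?A (t, r) (1, 0)) (at t)" for t r
  proof -
    have "((\<lambda>s. F (s, r)) has_derivative (\<lambda>v. ?A (t, r) (v, 0))) (at t)"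
      by (rule has_derivative_compose[OF _ smooth_has_derivative[OF assms], of "\<lambda>s. (s, r)"])
        (auto intro!: derivative_eq_intros)
    moreover have "(\<lambda>v. ?A (t, r) (v, 0)) = (\<lambda>v. ?A (t, r) (1, 0) * v)"
    proof
      show "?A (t, r) (v, 0) = ?A (t, r) (1, 0) * v" for v using A[of "(t, r)" "(v, 0)"] by simp
    qed
    ultimately show ?thesis unfolding has_field_derivative_def by (rule subst[rotated])
  qed
  have r: "((\<lambda>s. F (t, s)) has_real_derivative ?A (t, r) (0, 1)) (at r)" for t r
  proof -
    have "((\<lambda>s. F (t, s)) has_derivative (\<lambda>v. ?A (t, r) (0, v))) (at r)"
      by (rule has_derivative_compose[OF _ smooth_has_derivative[OF assms], of "\<lambda>s. (t, s)"])
        (auto intro!: derivative_eq_intros)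
    moreover have "(\<lambda>v. ?A (t, r) (0, v)) = (\<lambda>v. ?A (t, r) (0, 1) * v)"
    proof
      show "?A (t, r) (0, v) = ?A (t, r) (0, 1) * v" for v using A[of "(t, r)" "(0, v)"] by simp
    qed
    ultimately show ?thesis unfolding has_field_derivative_def by (rule subst[rotated])
  qed
  have pt: "partial_t F = (\<lambda>x. ?A x (1, 0))"
  proof
    show "partial_t F x = ?A x (1, 0)" for x
      by (cases x) (simp add: partial_t_def DERIV_imp_deriv[OF t])
  qed
  have pr: "partial_r F = (\<lambda>x. ?A x (0, 1))"
  proof
    show "partial_r F x = ?A x (0, 1)" for x
      by (cases x) (simp add: partial_r_def DERIV_imp_deriv[OF r])
  qed
  have "?A x = (\<lambda>v. fst v * partial_t F x + snd v * partial_r F x)"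
    unfolding pt pr by (rule ext) (rule A)
  then show "(F has_derivative (\<lambda>v. fst v * partial_t F x + snd v * partial_r F x)) (at x)"
    by (rule has_derivative_eq_rhs[OF smooth_has_derivative[OF assms]])
  show "smooth (partial_t F)" "smooth (partial_r F)"
    unfolding pt pr by (rule smooth_frechet_derivative[OF assms])+
  show "((\<lambda>s. F (s, r)) has_real_derivative partial_t F (t, r)) (at t)"
    "((\<lambda>s. F (t, s)) has_real_derivative partial_r F (t, r)) (at r)"
    using t r by (simp_all add: pt pr)
qed

text \<open>Squeezing yields differentiability where \<open>1 - t^2 \<le> 0\<close>, out of reach of
  the chain rule for the scaled coordinate.\<close>

lemma has_derivative_zero_bound:
  fixes f g :: "'a::real_normed_vector \<Rightarrow> real"
  assumes "\<And>y. \<bar>f y\<bar> \<le> g y" "g x = 0" "(g has_derivative (\<lambda>_. 0)) (at x)"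
  shows "(f has_derivative (\<lambda>_. 0)) (at x)"
proof -
  have "f x = 0" using assms(1)[of x] assms(2) by simp
  have g: "((\<lambda>v. norm (g (x + v) - g x - 0) / norm v) \<longlongrightarrow> 0) (at 0)"
    using assms(3) unfolding has_derivative_at by blast
  have "((\<lambda>v. norm (f (x + v) - f x - 0) / norm v) \<longlongrightarrow> 0) (at 0)"
  proof (rule Lim_null_comparison[OF always_eventually g], rule allI)
    fix v
    show "norm (norm (f (x + v) - f x - 0) / norm v) \<le> norm (g (x + v) - g x - 0) / norm v"
      using assms(1)[of "x + v"] assms(2) \<open>f x = 0\<close> by (simp add: divide_right_mono)
  qed
  then show ?thesis unfolding has_derivative_at by simp
qed

text \<open>Functions living on the region \<open>\<bar>t\<bar> < 1\<close>, \<open>\<bar>r - 1/2\<bar> < e (1 - t^2)\<close>, flat at its boundary.\<close>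

definition tip :: "real \<Rightarrow> real \<Rightarrow> real \<Rightarrow> real \<Rightarrow> (real \<times> real \<times> real \<Rightarrow> real) \<Rightarrow> real \<times> real \<Rightarrow> real" where
  "tip e k n m U x = flat k n (1 - fst x ^ 2) *
     (wt k m ((snd x - 1/2) / (e * (1 - fst x ^ 2))) * U (e, fst x, (snd x - 1/2) / (e * (1 - fst x ^ 2))))"

text \<open>Profile of the \<open>r\<close>-derivative of \<open>tip e k n m U\<close>, which is
  \<open>inverse e * tip e k (n + 1) (m + 2) (Uz k m U)\<close>.\<close>

definition Uz :: "real \<Rightarrow> real \<Rightarrow> (real \<times> real \<times> real \<Rightarrow> real) \<Rightarrow> real \<times> real \<times> real \<Rightarrow> real" where
  "Uz k m U x = om (snd (snd x)) ^ 2 * dz U x + c1 k m (snd (snd x)) * U x"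

text \<open>Profile of the \<open>t\<close>-derivative, with weights \<open>n + 2\<close> and
  \<open>m + 2\<close>. The last term comes from the moving coordinate,
  \<open>z_t = 2 t z / (1 - t^2)\<close>.\<close>

definition Ut :: "real \<Rightarrow> real \<Rightarrow> real \<Rightarrow> (real \<times> real \<times> real \<Rightarrow> real) \<Rightarrow> real \<times> real \<times> real \<Rightarrow> real" where
  "Ut k n m U x = om (snd (snd x)) ^ 2 *
      (- 2 * fst (snd x) * (k - n * (1 - fst (snd x) ^ 2)) * U x + (1 - fst (snd x) ^ 2) ^ 2 * dt U x)
    + 2 * fst (snd x) * (1 - fst (snd x) ^ 2) * snd (snd x) * Uz k m U x"

lemma smooth_Uz: "smooth U \<Longrightarrow> smooth (Uz k m U)"
  unfolding Uz_def[abs_def]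
  by (intro smooth_add smooth_mult smooth_power smooth_dz smooth_lift[OF smooth_om] smooth_lift[OF smooth_coeffs(1)])

lemma smooth_Ut: "smooth U \<Longrightarrow> smooth (Ut k n m U)"
  unfolding Ut_def[abs_def] by (intro smooth_intros smooth_Uz smooth_dt smooth_lift[OF smooth_om])

lemma tip_nonzero:
  assumes "tip e k n m U (t, r) \<noteq> 0" "e > 0"
  shows "\<bar>t\<bar> < 1" "\<bar>r - 1/2\<bar> < e"
proof -
  let ?h = "1 - t ^ 2"
  have "flat k n ?h \<noteq> 0" "wt k m ((r - 1/2) / (e * ?h)) \<noteq> 0" using assms(1) by (auto simp: tip_def)
  then have h: "?h > 0" and z: "\<bar>(r - 1/2) / (e * ?h)\<bar> < 1"
    using flat_nonpos[of ?h k n] wt_zero[of "(r - 1/2) / (e * ?h)" k m] by force+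
  show "\<bar>t\<bar> < 1" using h by (simp add: abs_square_less_1)
  have "\<bar>r - 1/2\<bar> < e * ?h" using z h assms(2) by (simp add: abs_mult divide_less_eq)
  also have "\<dots> \<le> e" using assms(2) by (simp add: mult_left_le)
  finally show "\<bar>r - 1/2\<bar> < e" .
qed

text \<open>The weight in \<open>z\<close> is smooth across \<open>\<bar>z\<bar> = 1\<close>, so
  only \<open>t = +-1\<close> is singular. For \<open>\<bar>t\<bar> < 1\<close> the chain rule
  applies; otherwise the time weight, which is flat, multiplies a bounded factor. The division by
  zero at \<open>t = +-1\<close> is harmless, because the time weight vanishes there.\<close>

lemma tip_has_derivative:
  assumes "smooth U" "k > 0" "e > 0"
  shows "(tip e k n m U has_derivative (\<lambda>v. fst v * tip e k (n + 2) (m + 2) (Ut k n m U) x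
    + snd v * (inverse e * tip e k (n + 1) (m + 2) (Uz k m U) x))) (at x)"
proof -
  define \<Psi> where "\<Psi> y = wt k m (snd y) * U (e, y)" for y :: "real \<times> real"
  have s\<Psi>: "smooth \<Psi>"
    unfolding \<Psi>_def[abs_def]
    by (rule smooth_mult[OF smooth_compose[OF smooth_wt[OF assms(2)]] smooth_compose[OF assms(1)]])
      (intro smooth_intros)+
  obtain t r where x: "x = (t, r)" by (cases x)
  let ?h = "1 - t ^ 2" and ?z = "(r - 1/2) / (e * (1 - t ^ 2))"
  have flat': "((\<lambda>y. flat k n (1 - fst y ^ 2)) has_derivative
      (\<lambda>v. (- 2 * t * fst v) * (k * flat k (n + 2) ?h - n * flat k (n + 1) ?h))) (at x)"
  proof -
    have "((\<lambda>y. 1 - fst y ^ 2) has_derivative (\<lambda>v. - 2 * t * fst v)) (at x)"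
      by (auto intro!: derivative_eq_intros simp: x)
    from DERIV_compose_FDERIV[OF _ this, of "flat k n"] show ?thesis
      using DERIV_flat[OF assms(2), of n "1 - fst x ^ 2"] by (simp add: x)
  qed
  show ?thesis
  proof (cases "\<bar>t\<bar> < 1")
    case True
    then have h: "?h > 0" by (simp add: abs_square_less_1)
    have pt: "partial_t \<Psi> (t, ?z) = wt k m ?z * dt U (e, t, ?z)"
      by (rule DERIV_unique[OF smooth_partials(4)[OF s\<Psi>]])
        (auto simp: \<Psi>_def intro!: derivative_eq_intros DERIV_dt assms)
    have pr: "partial_r \<Psi> (t, ?z) = wt k (m + 2) ?z * Uz k m U (e, t, ?z)"
      by (rule DERIV_unique[OF smooth_partials(5)[OF s\<Psi>]])
        (use DERIV_wt[OF assms(2) DERIV_dz[OF assms(1), of e t ?z], of m] in \<open>simp add: \<Psi>_def Uz_def\<close>)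
    have "((\<lambda>y. (fst y, (snd y - 1/2) / (e * (1 - fst y ^ 2)))) has_derivative
       (\<lambda>v. (fst v, snd v / (e * ?h) + 2 * t * ?z * fst v / ?h))) (at x)"
    proof (rule has_derivative_Pair)
      have a: "((\<lambda>y. snd y - 1/2) has_derivative snd) (at x)"
        by (auto intro!: derivative_eq_intros simp: x)
      have b: "((\<lambda>y. e * (1 - fst y ^ 2)) has_derivative (\<lambda>v. e * (- 2 * t * fst v))) (at x)"
        by (auto intro!: derivative_eq_intros simp: x)
      have q: "(s * (e * h) - w * (e * (- 2 * t * u))) / ((e * h) * (e * h)) = s / (e * h) + 2 * t * (w / (e * h)) * u / h"
        if "h \<noteq> 0" for s w u h :: real
        using that assms(3) by (simp add: field_simps)
      have nz: "e * (1 - fst x ^ 2) \<noteq> 0" using h assms(3) by (simp add: x)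
      show "((\<lambda>y. (snd y - 1/2) / (e * (1 - fst y ^ 2))) has_derivative
          (\<lambda>v. snd v / (e * ?h) + 2 * t * ?z * fst v / ?h)) (at x)"
        by (rule has_derivative_eq_rhs[OF has_derivative_divide'[OF a b nz]])
          (unfold x fst_conv snd_conv, intro ext q, use h in simp)
    qed (auto intro!: derivative_eq_intros)
    moreover have "(\<Psi> has_derivative (\<lambda>v. fst v * partial_t \<Psi> (t, ?z) + snd v * partial_r \<Psi> (t, ?z)))
        (at (fst x, (snd x - 1/2) / (e * (1 - fst x ^ 2))))"
      unfolding x fst_conv snd_conv by (rule smooth_partials(1)[OF s\<Psi>])
    ultimately have "((\<lambda>y. \<Psi> (fst y, (snd y - 1/2) / (e * (1 - fst y ^ 2)))) has_derivative
       (\<lambda>v. fst (fst v, snd v / (e * ?h) + 2 * t * ?z * fst v / ?h) * partial_t \<Psi> (t, ?z)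
         + snd (fst v, snd v / (e * ?h) + 2 * t * ?z * fst v / ?h) * partial_r \<Psi> (t, ?z))) (at x)"
      by (rule has_derivative_compose)
    then have "((\<lambda>y. \<Psi> (fst y, (snd y - 1/2) / (e * (1 - fst y ^ 2)))) has_derivative
       (\<lambda>v. fst v * partial_t \<Psi> (t, ?z) + (snd v / (e * ?h) + 2 * t * ?z * fst v / ?h) * partial_r \<Psi> (t, ?z))) (at x)"
      unfolding fst_conv snd_conv .
    from has_derivative_mult[OF flat' this]
    have D: "((\<lambda>y. flat k n (1 - fst y ^ 2) * \<Psi> (fst y, (snd y - 1/2) / (e * (1 - fst y ^ 2)))) has_derivative
      (\<lambda>v. flat k n ?h * (fst v * partial_t \<Psi> (t, ?z) + (snd v / (e * ?h) + 2 * t * ?z * fst v / ?h) * partial_r \<Psi> (t, ?z))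
        + (- 2 * t * fst v) * (k * flat k (n + 2) ?h - n * flat k (n + 1) ?h) * \<Psi> (t, ?z))) (at x)"
      by (simp add: x)
    have f: "flat k (n + 1) ?h = ?h * flat k (n + 2) ?h" "flat k n ?h = ?h * (?h * flat k (n + 2) ?h)"
      using flat_Suc[of k "n + 1" ?h] flat_Suc[of k n ?h] by (simp_all add: add.assoc)
    have w: "wt k m ?z = om ?z ^ 2 * wt k (m + 2) ?z"
      using flat_add[of k m "om ?z" 2] by (simp add: wt_def)
    have tipeq: "tip e k n m U = (\<lambda>y. flat k n (1 - fst y ^ 2) * \<Psi> (fst y, (snd y - 1/2) / (e * (1 - fst y ^ 2))))"
      by (rule ext) (simp add: tip_def \<Psi>_def)
    \<comment> \<open>The derivative formula with free variables: \<open>F\<close> and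
      \<open>W\<close> stand for the raised weights, \<open>o2\<close> for \<open>om^2\<close>, and
      \<open>u\<close>, \<open>A\<close>, \<open>Z\<close> for \<open>U\<close>, \<open>dt U\<close>
      and \<open>Uz\<close>.\<close>
    have key: "h * (h * F) * (a * (o2 * W * A) + (b / (e * h) + 2 * t * z * a / h) * (W * Z)) + (- 2 * t * a) * (k * F - n * (h * F)) * (o2 * W * u)
      = a * (F * (W * (o2 * (- 2 * t * (k - n * h) * u + h ^ 2 * A) + 2 * t * h * z * Z))) + b * (inverse e * (h * F * (W * Z)))"
      if "h \<noteq> 0" for h F a o2 W A b z Z u :: real
    proof -
      have "h * (b / (e * h) + 2 * t * z * a / h) = b * inverse e + 2 * t * z * a"
        using that assms(3) by (simp add: field_simps)
      moreover have "h * (h * F) * (a * (o2 * W * A) + Q * (W * Z)) = h * (h * F) * a * (o2 * W * A) + (h * F) * (h * Q) * (W * Z)" for Q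
        by (simp add: algebra_simps)
      ultimately have "h * (h * F) * (a * (o2 * W * A) + (b / (e * h) + 2 * t * z * a / h) * (W * Z))
        = h * (h * F) * a * (o2 * W * A) + (h * F) * (b * inverse e + 2 * t * z * a) * (W * Z)"
        by simp
      then show ?thesis by (simp add: algebra_simps power2_eq_square)
    qed
    have "(\<lambda>v. flat k n ?h * (fst v * partial_t \<Psi> (t, ?z) + (snd v / (e * ?h) + 2 * t * ?z * fst v / ?h) * partial_r \<Psi> (t, ?z))
        + (- 2 * t * fst v) * (k * flat k (n + 2) ?h - n * flat k (n + 1) ?h) * \<Psi> (t, ?z)) =
        (\<lambda>v. fst v * tip e k (n + 2) (m + 2) (Ut k n m U) x
         + snd v * (inverse e * tip e k (n + 1) (m + 2) (Uz k m U) x))"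
    proof
      fix v :: "real \<times> real"
      show "flat k n ?h * (fst v * partial_t \<Psi> (t, ?z) + (snd v / (e * ?h) + 2 * t * ?z * fst v / ?h) * partial_r \<Psi> (t, ?z))
        + (- 2 * t * fst v) * (k * flat k (n + 2) ?h - n * flat k (n + 1) ?h) * \<Psi> (t, ?z) =
        fst v * tip e k (n + 2) (m + 2) (Ut k n m U) x
         + snd v * (inverse e * tip e k (n + 1) (m + 2) (Uz k m U) x)"
        unfolding pt pr f \<Psi>_def snd_conv w x tip_def fst_conv
          Ut_def
        by (rule key) (use h in simp)
    qed
    then show ?thesis using D unfolding tipeq[symmetric] by simp
  next
    case False
    then have h: "?h \<le> 0" using abs_square_less_1[of t] by linarith
    have zero: "tip e k n' m' V x = 0" for n' m' V by (simp add: tip_def x flat_nonpos[OF h])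
    \<comment> \<open>A bound on the square suffices, as the weights kill the product
      elsewhere.\<close>
    have "compact ({-1..1::real} \<times> {-1..1::real})" by (intro compact_Times compact_Icc)
    then have "bounded (\<Psi> ` ({-1..1} \<times> {-1..1}))"
      by (intro compact_imp_bounded compact_continuous_image smooth_continuous_on[OF s\<Psi>])
    then obtain M where M': "\<forall>y \<in> \<Psi> ` ({-1..1} \<times> {-1..1}). norm y \<le> M"
      unfolding bounded_iff by blast
    have M: "\<bar>\<Psi> (t, z)\<bar> \<le> M" if "\<bar>t\<bar> \<le> 1" "\<bar>z\<bar> \<le> 1" for t z
    proof -
      have "(t, z) \<in> {-1..1} \<times> {-1..1}" using that by auto
      then show ?thesis using M' by (metis imageI real_norm_def)
    qed
    have "(tip e k n m U has_derivative (\<lambda>_. 0)) (at x)"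
    proof (rule has_derivative_zero_bound)
      have "((\<lambda>y. M * flat k n (1 - fst y ^ 2)) has_derivative
        (\<lambda>v. M * ((- 2 * t * fst v) * (k * flat k (n + 2) ?h - n * flat k (n + 1) ?h)))) (at x)"
        by (intro has_derivative_mult_right flat')
      then show "((\<lambda>y. M * flat k n (1 - fst y ^ 2)) has_derivative (\<lambda>_. 0)) (at x)"
        using h by (simp add: flat_nonpos)
      show "M * flat k n (1 - fst x ^ 2) = 0" using h by (simp add: flat_nonpos x)
      show "\<bar>tip e k n m U y\<bar> \<le> M * flat k n (1 - fst y ^ 2)" for y
      proof -
        obtain t' r' where y: "y = (t', r')" by (cases y)
        let ?h' = "1 - t' ^ 2" and ?z' = "(r' - 1/2) / (e * (1 - t' ^ 2))"
        have tip: "tip e k n m U y = flat k n ?h' * \<Psi> (t', ?z')" by (simp add: tip_def \<Psi>_def y)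
        have M0: "0 \<le> M" using M[of 0 0] by linarith
        show ?thesis
        proof (cases "?h' > 0 \<and> \<bar>?z'\<bar> < 1")
          case True
          then have "\<bar>\<Psi> (t', ?z')\<bar> \<le> M" using abs_square_less_1[of t'] by (intro M) auto
          then show ?thesis
            unfolding tip using mult_left_mono[of "\<bar>\<Psi> (t', ?z')\<bar>" M "flat k n ?h'"]
            by (simp add: abs_mult flat_nonneg y mult.commute)
        next
          case False
          then have "tip e k n m U y = 0"
            unfolding tip by (auto simp: flat_nonpos \<Psi>_def wt_zero not_less)
          then show ?thesis using M0 by (simp add: flat_nonneg)
        qed
      qed
    qed
    then show ?thesis by (simp add: zero)
  qed
qed

text \<open>Smoothness holds for all parameters at once: the functions \<open>tip e k n m U\<close>
  with smooth \<open>U\<close> form a family closed under both partial derivatives up to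
  constants.\<close>

lemma tip_partials:
  assumes "smooth U" "k > 0" "e > 0"
  shows "smooth (tip e k n m U)"
    and "partial_t (tip e k n m U) = tip e k (n + 2) (m + 2) (Ut k n m U)"
    and "partial_r (tip e k n m U) = (\<lambda>x. inverse e * tip e k (n + 1) (m + 2) (Uz k m U) x)"
proof -
  show s: "smooth (tip e k n m U)"
  proof (rule smoothI_class[where F = "{tip e k n m U | n m U. smooth U}"])
    fix g assume "g \<in> {tip e k n m U | n m U. smooth U}"
    then obtain n m U where g: "g = tip e k n m U" and U: "smooth U" by blast
    show "\<exists>g'. (\<forall>x. (g has_derivative g' x) (at x)) \<and>
           (\<forall>v. \<exists>c d p q. p \<in> {tip e k n m U | n m U. smooth U} \<and> q \<in> {tip e k n m U | n m U. smooth U} \<and>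
              (\<lambda>x. g' x v) = (\<lambda>x. c *\<^sub>R p x + d *\<^sub>R q x))"
    proof (intro exI conjI allI)
      show "(g has_derivative (\<lambda>v. fst v * tip e k (n + 2) (m + 2) (Ut k n m U) x
        + snd v * (inverse e * tip e k (n + 1) (m + 2) (Uz k m U) x))) (at x)" for x
        unfolding g by (rule tip_has_derivative[OF U assms(2,3)])
      show "tip e k (n + 2) (m + 2) (Ut k n m U) \<in> {tip e k n m U | n m U. smooth U}"
        "tip e k (n + 1) (m + 2) (Uz k m U) \<in> {tip e k n m U | n m U. smooth U}"
        using smooth_Ut[OF U] smooth_Uz[OF U] by blast+
      show "(\<lambda>x. fst v * tip e k (n + 2) (m + 2) (Ut k n m U) x + snd v * (inverse e * tip e k (n + 1) (m + 2) (Uz k m U) x))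
        = (\<lambda>x. fst v *\<^sub>R tip e k (n + 2) (m + 2) (Ut k n m U) x + (snd v * inverse e) *\<^sub>R tip e k (n + 1) (m + 2) (Uz k m U) x)" for v
        by (simp add: mult.assoc)
    qed
  qed (use assms(1) in blast)
  have eq: "fst v * partial_t (tip e k n m U) x + snd v * partial_r (tip e k n m U) x =
      fst v * tip e k (n + 2) (m + 2) (Ut k n m U) x + snd v * (inverse e * tip e k (n + 1) (m + 2) (Uz k m U) x)" for v x
    using has_derivative_unique[OF smooth_partials(1)[OF s] tip_has_derivative[OF assms]] by (rule fun_cong)
  show "partial_t (tip e k n m U) = tip e k (n + 2) (m + 2) (Ut k n m U)"
    using eq[of "(1, 0)"] by auto
  show "partial_r (tip e k n m U) = (\<lambda>x. inverse e * tip e k (n + 1) (m + 2) (Uz k m U) x)"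
    using eq[of "(0, 1)"] by auto
qed

lemma dz_Uz:
  assumes "smooth U"
  shows "dz (Uz k m U) = (\<lambda>x. om (snd (snd x)) ^ 2 * dz (dz U) x - 4 * snd (snd x) * om (snd (snd x)) * dz U x
    + c1 k m (snd (snd x)) * dz U x + (2 * m * om (snd (snd x)) - 4 * m * snd (snd x) ^ 2 - 2 * k) * U x)"
proof (rule dz_eqI[OF smooth_Uz[OF assms]])
  fix e t z
  show "((\<lambda>z. Uz k m U (e, t, z)) has_real_derivative
    (om (snd (snd (e, t, z))) ^ 2 * dz (dz U) (e, t, z) - 4 * snd (snd (e, t, z)) * om (snd (snd (e, t, z))) * dz U (e, t, z)
    + c1 k m (snd (snd (e, t, z))) * dz U (e, t, z) + (2 * m * om (snd (snd (e, t, z))) - 4 * m * snd (snd (e, t, z)) ^ 2 - 2 * k) * U (e, t, z))) (at z)"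
    unfolding Uz_def om_def c1_def snd_conv
    by (rule DERIV_cong, (rule derivative_eq_intros DERIV_dz[OF assms] DERIV_dz[OF smooth_dz[OF assms]] refl)+)
      (simp add: power2_eq_square algebra_simps)
qed

section \<open>The radial heat operator on functions of the scaled region\<close>

definition heat :: "real \<Rightarrow> (real \<times> real \<Rightarrow> real) \<Rightarrow> real \<Rightarrow> real \<Rightarrow> real" where
  "heat c u t r = partial_t u (t, r) - partial_r (partial_r u) (t, r) - c / r * partial_r u (t, r)"

lemma partial_cmult:
  assumes "smooth f"
  shows "partial_t (\<lambda>x. a * f x) = (\<lambda>x. a * partial_t f x)" "partial_r (\<lambda>x. a * f x) = (\<lambda>x. a * partial_r f x)"
proof -
  have "partial_t (\<lambda>x. a * f x) (t, r) = a * partial_t f (t, r)" for t r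
    unfolding partial_t_def[of "\<lambda>x. a * f x"] split_conv
    by (rule DERIV_imp_deriv[OF DERIV_cmult[OF smooth_partials(4)[OF assms]]])
  moreover have "partial_r (\<lambda>x. a * f x) (t, r) = a * partial_r f (t, r)" for t r
    unfolding partial_r_def[of "\<lambda>x. a * f x"] split_conv
    by (rule DERIV_imp_deriv[OF DERIV_cmult[OF smooth_partials(5)[OF assms]]])
  ultimately show "partial_t (\<lambda>x. a * f x) = (\<lambda>x. a * partial_t f x)" "partial_r (\<lambda>x. a * f x) = (\<lambda>x. a * partial_r f x)"
    by auto
qed

lemma heat_cmult: "smooth f \<Longrightarrow> heat c (\<lambda>x. a * f x) t r = a * heat c f t r"
  by (simp add: heat_def partial_cmult smooth_partials(3) algebra_simps)

text \<open>Outside the region both sides vanish, whatever \<open>c / r\<close> is. Inside it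
  \<open>e \<le> 1/4\<close> gives \<open>r \<ge> 1/4\<close>, so that \<open>pos_ext\<close> in
  \<open>pcoef\<close> is the identity and the true coefficient appears.\<close>

lemma heat_tip:
  assumes U: "smooth U" "k > 0" and e: "0 < e" "e \<le> 1/4"
  shows "heat c (tip e k n m U) t r = inverse (e ^ 2) * tip e k (n + 2) (m + 4) (LL c k m n U) (t, r)"
proof -
  let ?h = "1 - t ^ 2" and ?z = "(r - 1/2) / (e * (1 - t ^ 2))"
  have pr: "partial_r (tip e k n m U) = (\<lambda>x. inverse e * tip e k (n + 1) (m + 2) (Uz k m U) x)"
    by (rule tip_partials(3)[OF U e(1)])
  have prr: "partial_r (partial_r (tip e k n m U)) = (\<lambda>x. inverse e * (inverse e * tip e k (n + 2) (m + 4) (Uz k (m + 2) (Uz k m U)) x))"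
    unfolding pr partial_cmult(2)[OF tip_partials(1)[OF smooth_Uz[OF U(1)] U(2) e(1)]]
      tip_partials(3)[OF smooth_Uz[OF U(1)] U(2) e(1)] by (simp add: add.assoc)
  have pt: "partial_t (tip e k n m U) = tip e k (n + 2) (m + 2) (Ut k n m U)"
    by (rule tip_partials(2)[OF U e(1)])
  show ?thesis
  proof (cases "?h > 0 \<and> \<bar>?z\<bar> < 1")
    case False
    have "tip e k n' m' V (t, r) = 0" for n' m' V
    proof (cases "?h > 0")
      case True
      then show ?thesis using False by (simp add: tip_def wt_zero)
    qed (simp add: tip_def flat_nonpos)
    then show ?thesis unfolding heat_def prr unfolding pr pt by simp
  next
    case True
    then have h: "?h > 0" and z: "\<bar>?z\<bar> < 1" by auto
    define z h where "z = ?z" and "h = ?h"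
    have h': "0 < h" "h \<le> 1" and z': "\<bar>z\<bar> < 1"
      using h z by (simp_all add: z_def h_def del: abs_divide)
    have "e * h \<noteq> 0" using e h' by simp
    then have "e * h * z = r - 1/2" unfolding z_def h_def by simp
    then have r: "1/2 + e * h * z = r" by simp
    have "\<bar>e * h * z\<bar> \<le> 1/4 * 1 * 1"
      unfolding abs_mult using e h' z' by (intro mult_mono) auto
    then have r14: "r \<ge> 1/4" using r by linarith
    have lam: "lam (e, t, z) = e * h" by (simp add: lam_def h_def)
    have p: "pcoef c (e, t, z) = c / r * e * h"
    proof -
      have "pcoef c (e, t, z) = c * (e * h) * inverse (pos_ext (1/4) (1/2 + e * h * z))"
        unfolding pcoef_def lam snd_conv ..
      also have "pos_ext (1/4) (1/2 + e * h * z) = r" unfolding r by (rule pos_ext_eq) (use r14 in auto)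
      finally show ?thesis by (simp add: divide_inverse mult.assoc)
    qed
    have w: "wt k (m + 2) z = om z ^ 2 * wt k (m + 4) z"
      using flat_add[of k "m + 2" "om z" 2] by (simp add: wt_def add.assoc)
    have f: "flat k (n + 1) h = h * flat k (n + 2) h"
      using flat_Suc[of k "n + 1" h] by (simp add: add.assoc)
    let ?x = "(e, t, z)"
    have L: "LL c k m n U ?x = e ^ 2 * om z ^ 2 * Ut k n m U ?x - Uz k (m + 2) (Uz k m U) ?x - pcoef c ?x * om z ^ 2 * Uz k m U ?x"
      unfolding LL_def zop_def Uz_def[of _ _ "Uz k m U"] dz_Uz[OF U(1)] Ut_def Uz_def[of _ _ U] lam fst_conv snd_conv ll_def cB_def cC_def
        h_def[symmetric]
      by (simp add: algebra_simps power2_eq_square power4_eq_xxxx)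
    have te: "tip e k n' m' V (t, r) = flat k n' h * (wt k m' z * V ?x)" for n' m' V
      unfolding tip_def fst_conv snd_conv h_def z_def ..
    have "heat c (tip e k n m U) t r = flat k (n + 2) h * wt k (m + 4) z *
       (om z ^ 2 * Ut k n m U ?x - inverse e ^ 2 * Uz k (m + 2) (Uz k m U) ?x - c / r * inverse e * h * om z ^ 2 * Uz k m U ?x)"
      unfolding heat_def prr unfolding pt pr te w f
      by (simp add: algebra_simps power2_eq_square)
    also have "om z ^ 2 * Ut k n m U ?x - inverse e ^ 2 * Uz k (m + 2) (Uz k m U) ?x - c / r * inverse e * h * om z ^ 2 * Uz k m U ?x
        = inverse (e ^ 2) * LL c k m n U ?x"
    proof -
      have "o2 * T - inverse e ^ 2 * V - X * inverse e * h * o2 * W = inverse (e ^ 2) * (e ^ 2 * o2 * T - V - X * e * h * o2 * W)"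
        for o2 T V X W :: real
        using e(1) by (simp add: field_simps power2_eq_square)
      then show ?thesis unfolding L p .
    qed
    finally show ?thesis
      unfolding te by (simp add: mult_ac)
  qed
qed

lemma flat_cube: "flat k n x ^ 3 = flat (3 * k) (3 * n) x"
  by (simp add: power3_eq_cube flat_mult)

text \<open>This fixes the exponents \<open>(k, n, m)\<close>: the operator adds
  \<open>(0, 2, 4)\<close>, so \<open>(1, 0, 0)\<close> for \<open>a\<close> leads to
  \<open>(1, 2, 4) / 3\<close> for \<open>b\<close>, and this to \<open>(1/3, 8/3, 16/3) / 3\<close>
  for \<open>c\<close>.\<close>

lemma tip_cube: "tip e k n m U x ^ 3 = tip e (3 * k) (3 * n) (3 * m) (\<lambda>x. U x ^ 3) x"
  by (simp add: tip_def power_mult_distrib flat_cube wt_def)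

lemma tip_cong:
  assumes "\<And>t z. \<bar>t\<bar> \<le> 1 \<Longrightarrow> \<bar>z\<bar> \<le> 1 \<Longrightarrow> U (e, t, z) = V (e, t, z)"
  shows "tip e k n m U x = tip e k n m V x"
proof (cases "1 - fst x ^ 2 > 0 \<and> \<bar>(snd x - 1/2) / (e * (1 - fst x ^ 2))\<bar> < 1")
  case True
  then have "\<bar>fst x\<bar> \<le> 1" using abs_square_less_1[of "fst x"] by auto
  then show ?thesis using True assms by (simp add: tip_def)
next
  case False
  then show ?thesis
    by (cases "1 - fst x ^ 2 > 0") (simp_all add: tip_def wt_zero flat_nonpos)
qed

section \<open>Even reflection in \<open>r\<close>\<close>

definition reflect :: "(real \<times> real \<Rightarrow> real) \<Rightarrow> real \<times> real \<Rightarrow> real" where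
  "reflect f x = f (fst x, - snd x)"

lemma smooth_reflect: "smooth f \<Longrightarrow> smooth (reflect f)"
  unfolding reflect_def[abs_def] by (rule smooth_compose, assumption, intro smooth_intros)

text \<open>The factor \<open>a\<close> allows iteration: an \<open>r\<close>-derivative replaces it
  by \<open>- a\<close>, so two of them restore it.\<close>

lemma partial_reflect:
  assumes "smooth f" "smooth g"
  shows "partial_t (\<lambda>x. f x + a * reflect g x) = (\<lambda>x. partial_t f x + a * reflect (partial_t g) x)"
    and "partial_r (\<lambda>x. f x + a * reflect g x) = (\<lambda>x. partial_r f x + (- a) * reflect (partial_r g) x)"
proof -
  have "partial_t (\<lambda>x. f x + a * reflect g x) (t, r) = partial_t f (t, r) + a * reflect (partial_t g) (t, r)" for t r
    unfolding partial_t_def[of "\<lambda>x. f x + a * reflect g x"] split_conv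
    unfolding reflect_def fst_conv snd_conv
    by (intro DERIV_imp_deriv DERIV_add DERIV_cmult smooth_partials(4) assms)
  moreover have "partial_r (\<lambda>x. f x + a * reflect g x) (t, r) = partial_r f (t, r) + (- a) * reflect (partial_r g) (t, r)" for t r
  proof -
    have "((\<lambda>s. g (t, - s)) has_real_derivative - partial_r g (t, - r)) (at r)"
      using DERIV_mirror[THEN iffD1, OF smooth_partials(5)[OF assms(2), of t "- r"]] by simp
    from DERIV_add[OF smooth_partials(5)[OF assms(1), of t r] DERIV_cmult[OF this, of a]]
    have "((\<lambda>s. f (t, s) + a * g (t, - s)) has_real_derivative partial_r f (t, r) + (- a) * partial_r g (t, - r)) (at r)"
      by simp
    then show ?thesis
      unfolding partial_r_def[of "\<lambda>x. f x + a * reflect g x"] split_conv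
      unfolding reflect_def fst_conv snd_conv
      by (rule DERIV_imp_deriv)
  qed
  ultimately show "partial_t (\<lambda>x. f x + a * reflect g x) = (\<lambda>x. partial_t f x + a * reflect (partial_t g) x)"
    "partial_r (\<lambda>x. f x + a * reflect g x) = (\<lambda>x. partial_r f x + (- a) * reflect (partial_r g) x)"
    by auto
qed

text \<open>The factor 1 gives the sum the shape of \<open>partial_reflect\<close>.\<close>

definition sym2 :: "(real \<times> real \<Rightarrow> real) \<Rightarrow> real \<times> real \<Rightarrow> real" where
  "sym2 f x = f x + 1 * reflect f x"

lemma heat_sym2:
  assumes "smooth f"
  shows "heat c (sym2 f) t r = heat c f t r + heat c f t (- r)"
  unfolding heat_def sym2_def[abs_def] partial_reflect[OF assms assms]
    partial_reflect[OF smooth_partials(3)[OF assms] smooth_partials(3)[OF assms]]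
  by (simp add: reflect_def algebra_simps)

lemma sym2_C0_infinity:
  assumes "smooth f" "\<And>t r. f (t, r) \<noteq> 0 \<Longrightarrow> \<bar>t\<bar> \<le> 1 \<and> 0 < r \<and> r \<le> 1"
  shows "sym2 f \<in> C0_infinity" "supp (sym2 f) \<subseteq> {-1..1} \<times> {-1..1}"
proof -
  have "\<bar>t\<bar> \<le> 1 \<and> \<bar>r\<bar> \<le> 1" if "sym2 f (t, r) \<noteq> 0" for t r
  proof -
    have "f (t, r) \<noteq> 0 \<or> f (t, - r) \<noteq> 0" using that by (auto simp: sym2_def reflect_def)
    then show ?thesis using assms(2)[of t r] assms(2)[of t "- r"] by auto
  qed
  then have "{x. sym2 f x \<noteq> 0} \<subseteq> {-1..1} \<times> {-1..1}" by (force simp: abs_le_iff)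
  then show supp: "supp (sym2 f) \<subseteq> {-1..1} \<times> {-1..1}"
    unfolding supp_def by (rule closure_minimal) (intro closed_Times closed_atLeastAtMost)
  have "compact ({-1..1::real} \<times> {-1..1::real})" by (intro compact_Times compact_Icc)
  then have "compact (supp (sym2 f))"
    using bounded_subset[OF compact_imp_bounded supp] by (simp add: compact_eq_bounded_closed supp_def)
  moreover have "smooth (sym2 f)"
    unfolding sym2_def[abs_def] by (intro smooth_intros smooth_reflect assms(1))
  ultimately show "sym2 f \<in> C0_infinity" by (simp add: C0_infinity_def)
qed

text \<open>At each point at most one of the two copies is nonzero, so no mixed terms arise.\<close>

lemma sym2_cube:
  assumes "\<And>t r. f (t, r) \<noteq> 0 \<Longrightarrow> \<bar>t\<bar> \<le> 1 \<and> 0 < r \<and> r \<le> 1"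
  shows "sym2 f (t, r) ^ 3 = f (t, r) ^ 3 + f (t, - r) ^ 3"
proof -
  have "f (t, r) = 0 \<or> f (t, - r) = 0" using assms[of t r] assms[of t "- r"] by force
  then show ?thesis by (auto simp: sym2_def reflect_def)
qed

section \<open>From the scaled system to the triple on the whole plane\<close>

theorem theorem2:
  fixes N :: nat
  assumes "N > 0"
  shows "\<exists>a b c :: real \<times> real \<Rightarrow> real.
    a \<in> C0_infinity \<and> b \<in> C0_infinity \<and> c \<in> C0_infinity \<and>
    supp a \<subseteq> {-1..1} \<times> {-1..1} \<and>
    supp b \<subseteq> {-1..1} \<times> {-1..1} \<and>
    supp c \<subseteq> {-1..1} \<times> {-1..1} \<and>
    {(t, r). r > 0 \<and> b (t, r) \<noteq> 0 \<and> c (t, r) \<noteq> 0} \<noteq> {} \<and>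
    (\<forall>t r. a (t, r) = a (t, - r) \<and> b (t, r) = b (t, - r) \<and> c (t, r) = c (t, - r)) \<and>
    (\<forall>t r. r \<noteq> 0 \<longrightarrow>
       partial_t a (t, r) - partial_r (partial_r a) (t, r)
         - (real N - 1) / r * partial_r a (t, r) = b (t, r) ^ 3) \<and>
    (\<forall>t r. r \<noteq> 0 \<longrightarrow>
       partial_t b (t, r) - partial_r (partial_r b) (t, r)
         - (real N - 1) / r * partial_r b (t, r) = c (t, r) ^ 3)"
proof -
  let ?n = "real N - 1"
  obtain e0 G B C Z1 Z2 where e0: "e0 > 0" and s: "smooth G" "smooth B" "smooth C" and Z: "finite Z1" "finite Z2"
    and G: "\<And>e t z. \<bar>e\<bar> \<le> e0 \<Longrightarrow> \<bar>t\<bar> \<le> 1 \<Longrightarrow> \<bar>z\<bar> \<le> 1 \<Longrightarrow> LL ?n 1 0 0 G (e, t, z) = B (e, t, z) ^ 3"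
    and B: "\<And>e t z. \<bar>e\<bar> \<le> e0 \<Longrightarrow> \<bar>t\<bar> \<le> 1 \<Longrightarrow> \<bar>z\<bar> \<le> 1 \<Longrightarrow> LL ?n (1/3) (4/3) (2/3) B (e, t, z) = C (e, t, z) ^ 3"
    and nz: "\<And>e t z. \<bar>e\<bar> \<le> e0 \<Longrightarrow> \<bar>t\<bar> \<le> 1 \<Longrightarrow> \<bar>z\<bar> \<le> 1 \<Longrightarrow> z \<notin> Z1 \<Longrightarrow> B (e, t, z) \<noteq> 0"
      "\<And>e t z. z \<notin> Z2 \<Longrightarrow> C (e, t, z) \<noteq> 0"
    by (rule scaled_solution[of ?n]) ((assumption | rule that)+)
  define e where "e = min e0 (1/4)"
  have e: "0 < e" "e \<le> 1/4" "\<bar>e\<bar> \<le> e0" using e0 by (auto simp: e_def)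
  \<comment> \<open>Each application of the operator to a \<open>tip\<close> leaves a factor
    \<open>1 / e^2\<close>; the constants \<open>k1\<close> and \<open>k2\<close> absorb it into the
    cubes.\<close>
  define k1 where "k1 = inverse (e ^ 2) powr (1/3)"
  define k2 where "k2 = (k1 * inverse (e ^ 2)) powr (1/3)"
  have k1: "k1 > 0" "k1 ^ 3 = inverse (e ^ 2)"
    using e powr_third_cube[of "inverse (e ^ 2)"] by (simp_all add: k1_def)
  have k2: "k2 > 0" "k2 ^ 3 = k1 * inverse (e ^ 2)"
    using e k1(1) powr_third_cube[of "k1 * inverse (e ^ 2)"] by (simp_all add: k2_def)
  define a1 where "a1 = tip e 1 0 0 G"
  define b0 where "b0 = tip e (1/3) (2/3) (4/3) B"
  define b1 where "b1 x = k1 * b0 x" for x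
  define c1' where "c1' x = k2 * tip e (1/9) (8/9) (16/9) C x" for x
  have sb0: "smooth b0" unfolding b0_def by (rule tip_partials(1)[OF s(2) _ e(1)]) simp
  have sm: "smooth a1" "smooth b1" "smooth c1'"
    unfolding a1_def b1_def[abs_def] c1'_def[abs_def]
    by (intro smooth_intros sb0 tip_partials(1) s e(1); simp)+
  have tip_supp: "\<bar>t\<bar> \<le> 1 \<and> 0 < r \<and> r \<le> 1" if "tip e k n m U (t, r) \<noteq> 0" for k n m U t r
    using tip_nonzero[OF that e(1)] e(2) by (auto simp: abs_less_iff)
  have sup: "\<And>t r. a1 (t, r) \<noteq> 0 \<Longrightarrow> \<bar>t\<bar> \<le> 1 \<and> 0 < r \<and> r \<le> 1"
    "\<And>t r. b1 (t, r) \<noteq> 0 \<Longrightarrow> \<bar>t\<bar> \<le> 1 \<and> 0 < r \<and> r \<le> 1"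
    "\<And>t r. c1' (t, r) \<noteq> 0 \<Longrightarrow> \<bar>t\<bar> \<le> 1 \<and> 0 < r \<and> r \<le> 1"
    unfolding a1_def b1_def b0_def c1'_def by (rule tip_supp, force)+
  have heat_a: "heat ?n a1 t r = b1 (t, r) ^ 3" for t r
  proof -
    have "heat ?n a1 t r = inverse (e ^ 2) * tip e 1 (0 + 2) (0 + 4) (LL ?n 1 0 0 G) (t, r)"
      unfolding a1_def by (rule heat_tip[OF s(1) _ e(1,2)]) simp
    also have "tip e 1 (0 + 2) (0 + 4) (LL ?n 1 0 0 G) (t, r) = tip e 1 (0 + 2) (0 + 4) (\<lambda>x. B x ^ 3) (t, r)"
      by (rule tip_cong) (rule G[OF e(3)])
    also have "\<dots> = b0 (t, r) ^ 3" by (simp add: b0_def tip_cube)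
    finally show ?thesis by (simp add: b1_def power_mult_distrib k1)
  qed
  have heat_b: "heat ?n b1 t r = c1' (t, r) ^ 3" for t r
  proof -
    have "heat ?n b0 t r = inverse (e ^ 2) * tip e (1/3) (2/3 + 2) (4/3 + 4) (LL ?n (1/3) (4/3) (2/3) B) (t, r)"
      unfolding b0_def by (rule heat_tip[OF s(2) _ e(1,2)]) simp
    also have "tip e (1/3) (2/3 + 2) (4/3 + 4) (LL ?n (1/3) (4/3) (2/3) B) (t, r) = tip e (1/3) (2/3 + 2) (4/3 + 4) (\<lambda>x. C x ^ 3) (t, r)"
      by (rule tip_cong) (rule B[OF e(3)])
    also have "\<dots> = tip e (1/9) (8/9) (16/9) C (t, r) ^ 3" by (simp add: tip_cube)
    finally show ?thesis unfolding b1_def[abs_def] heat_cmult[OF sb0] by (simp add: c1'_def power_mult_distrib k2)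
  qed
  have heat_a2: "heat ?n (sym2 a1) t r = sym2 b1 (t, r) ^ 3" for t r
    unfolding heat_sym2[OF sm(1)] heat_a by (rule sym2_cube[symmetric]) (rule sup(2))
  have heat_b2: "heat ?n (sym2 b1) t r = sym2 c1' (t, r) ^ 3" for t r
    unfolding heat_sym2[OF sm(2)] heat_b by (rule sym2_cube[symmetric]) (rule sup(3))
  \<comment> \<open>On the slice \<open>t = 0\<close> the width is \<open>e\<close>, so any
    \<open>z\<close> avoiding the finitely many roots gives the point \<open>r = 1/2 + e z\<close>
    with \<open>b\<close> and \<open>c\<close> both nonzero.\<close>
  have "infinite {-1<..<1::real}" by (rule infinite_Ioo) simp
  then have "\<not> {-1<..<1} \<subseteq> Z1 \<union> Z2" using Z finite_subset by blast
  then obtain z where "z \<in> {-1<..<1}" "z \<notin> Z1 \<union> Z2" by blast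
  then have z: "-1 < z" "z < 1" "z \<notin> Z1" "z \<notin> Z2" by auto
  then have z1: "\<bar>z\<bar> < 1" by auto
  let ?r = "1/2 + e * z"
  have tipz: "tip e k n m U (0, ?r) \<noteq> 0" if "U (e, 0, z) \<noteq> 0" for k n m U
    using e that flat_pos[of 1 k n] wt_pos[OF z1, of k m] by (simp add: tip_def)
  have bz: "b1 (0, ?r) \<noteq> 0" "c1' (0, ?r) \<noteq> 0"
    using nz(1)[OF e(3), of 0 z] nz(2)[of z e 0] z z1 k1(1) k2(1) tipz
    by (auto simp: b1_def b0_def c1'_def)
  have rpos: "?r > 0" using sup(2)[OF bz(1)] by simp
  \<comment> \<open>The reflected copies vanish for positive \<open>r\<close> and cannot cancel
    these values.\<close>
  have "b1 (0, - ?r) = 0" "c1' (0, - ?r) = 0" using sup(2)[of 0 "- ?r"] sup(3)[of 0 "- ?r"] rpos by force+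
  then have "sym2 b1 (0, ?r) \<noteq> 0" "sym2 c1' (0, ?r) \<noteq> 0" using bz by (simp_all add: sym2_def reflect_def)
  then have "(0, ?r) \<in> {(t, r). r > 0 \<and> sym2 b1 (t, r) \<noteq> 0 \<and> sym2 c1' (t, r) \<noteq> 0}" using rpos by simp
  then have ne: "{(t, r). r > 0 \<and> sym2 b1 (t, r) \<noteq> 0 \<and> sym2 c1' (t, r) \<noteq> 0} \<noteq> {}" by blast
  have even: "sym2 f (t, r) = sym2 f (t, - r)" for f t r by (simp add: sym2_def reflect_def)
  have C0: "sym2 a1 \<in> C0_infinity" "sym2 b1 \<in> C0_infinity" "sym2 c1' \<in> C0_infinity"
    by (rule sym2_C0_infinity(1), rule sm, erule sup)+
  have supp: "supp (sym2 a1) \<subseteq> {-1..1} \<times> {-1..1}" "supp (sym2 b1) \<subseteq> {-1..1} \<times> {-1..1}" "supp (sym2 c1') \<subseteq> {-1..1} \<times> {-1..1}"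
    by (rule sym2_C0_infinity(2), rule sm, erule sup)+
  show ?thesis
  proof (rule exI[of _ "sym2 a1"], rule exI[of _ "sym2 b1"], rule exI[of _ "sym2 c1'"], intro conjI allI impI)
    show "sym2 a1 (t, r) = sym2 a1 (t, - r)" "sym2 b1 (t, r) = sym2 b1 (t, - r)" "sym2 c1' (t, r) = sym2 c1' (t, - r)" for t r
      by (rule even)+
  qed (simp_all only: C0 supp ne heat_a2[unfolded heat_def] heat_b2[unfolded heat_def] not_False_eq_True)
qed

end
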